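(* Let $x(t)$ evolve by the ODE $\frac{\mathrm d}{\mathrm dt}x=f(x)$, $x(0)=x_0$, where $f:\mathbb R^n\to\mathbb R^n$ is a vector of real polynomials and $\mathcal B=\{x\in\mathbb R^n: g_i(x)\ge0,\ i=1,\dots,I,\ h_j(x)=0,\ j=1,\dots,J\}$, with given $g_i,h_j\in\mathbb R[x]$, is a semialgebraic set that is forward invariant. Let $\Sigma^\Omega$ be the quadratic module for the set $\Omega=\mathcal B\times\mathbb R^{\binom nk}$, using the same constraints $g_i(x)\ge0$, $h_j(x)=0$ that specify $\mathcal B$. For $B\in\mathbb R$ let $m_k^B(x,w^k)=Df^{[k]}(x)w^k-Bw^k$. 1. Suppose each trajectory $x(t)$ in $\mathcal B$ is bounded for $t\ge0$. For each $k\in\{1,\dots,n\}$ and each pair of polynomial degrees $(\nu,\nu')$, $$\sup_{x_0\in\mathcal B}M_k(x_0)\le C_3(k,\nu,\nu'),$$ where $$C_3(k,\nu,\nu')=\inf_{B\in\mathbb R,\ V\in\mathbb R[x,w^k]_\nu}B\quad\text{s.t.}\quad V-|w^k|^2\in\Sigma^\Omega_{\nu'}\ \text{ and }\ -\left[f\cdot D_xV+m_k^B\cdot D_{w^k}V\right]\in\Sigma^\Omega_{\nu'}.$$ 2. Suppose $\mathcal B$ is compact and its semialgebraic specification is Archimedean. Then, for each $k$, $$\sup_{x_0\in\mathcal B}M_k(x_0)=\inf_{\nu,\nu'\in\mathbb Z_\ge}C_3(k,\nu,\nu'),$$ where the infimum defining $C_3$ is restricted to $V(x,w^k)=(w^k)^{\mathsf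 T}U(x)w^k$ with $U\in\mathbb R^{\binom nk\times\binom nk}[x]$ a symmetric polynomial matrix, and where the polynomials $\sigma_i(x,w^k)$ and $\rho_j(x,w^k)$ in the quadratic module representations are likewise quadratic in $w^k$.
   Context: Forward invariant means trajectories starting in $\mathcal B$ remain in $\mathcal B$ for all $t\ge0$. $Df(x)$ is the $n\times n$ Jacobian. $\mathbb S^{m-1}=\{z\in\mathbb R^m:|z|=1\}$. $\mathbb Z_\ge$ is the set of nonnegative integers. $\mathbb R[\cdot]_\nu$ denotes real polynomials of total degree at most $\nu$. $D_xV,D_{w^k}V$ are gradients. An infimum over an empty set is $+\infty$. The case $\mathcal B=\mathbb R^n$ corresponds to there being no $g_i$ or $h_j$. For a set $\Omega$ specified by polynomial constraints $g_i\ge0$ ($i=1,\dots,I$) and $h_j=0$ ($j=1,\dots,J$), its quadratic module is $$\Sigma^\Omega=\Big\{\sigma_0+\sum_i\sigma_ig_i+\sum_j\rho_jh_j:\ \sigma_i\in\Sigma\ (i=0,\dots,I),\ \rho_j\text{ real polynomials}\Big\},$$ where $\Sigma$ is the set of polynomials that are sums of squares of polynomials; $\Sigma^\Omega_{\nu'}$ is the subset in which all $\sigma_i$ and $\rho_j$ can be chosen with degree at most $\nu'$. The specification of $\mathcal B$ is Archimedean if $R^2-|x|^2$ belongs to its quadratic module (in $\mathbb R[x]$) for some constant $R$. For $A\in\mathbb R^{n\times n}$, the $k$th multiplicative compound $A^{(k)}\in\mathbb R^{\binom nk\times\binom nk}$ is the matrix of all $k\times k$ minors of $A$, rows and columns indexed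 by increasing $k$-tuples from $\{1,\dots,n\}$ in lexicographic order. The $k$th additive compound is $A^{[k]}=\frac{\mathrm d}{\mathrm d\delta}(I+\delta A)^{(k)}\big|_{\delta=0}$. $Df^{[k]}(x)$ denotes the $k$th additive compound of $Df(x)$. Along a trajectory $x(t)$ from $x_0$, let $y^k(t)\in\mathbb R^{\binom nk}$ solve $\frac{\mathrm d}{\mathrm dt}y^k=Df^{[k]}(x(t))\,y^k$, $y^k(0)=y^k_0$. The sum of the $k$ leading Lyapunov exponents is $$M_k(x_0)=\sup_{y_0^k\in\mathbb S^{\binom nk-1}}\ \limsup_{t\to\infty}\frac1t\log|y^k(t)|.$$ *)

theory Defs
  imports "HOL-Analysis.Analysis"
begin

section \<open>Real polynomials, sums of squares, quadratic modules\<close>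

text \<open>
  Real polynomials in \<open>d\<close> variables are identified with the polynomial functions on a Euclidean
  space of dimension \<open>d\<close> (as \<open>\<real>\<close> is infinite, this loses nothing); membership in the full ring is
  the library predicate \<^const>\<open>real_polynomial_function\<close>. The set below is \<open>\<real>[z]\<^sub>\<nu>\<close>, the polynomials
  of total degree at most \<open>\<nu>\<close>: finite linear combinations of monomials \<open>z\<^sup>\<alpha>\<close> with \<open>|\<alpha>| \<le> \<nu>\<close>.
\<close>

definition poly_upto :: "nat \<Rightarrow> ('a::euclidean_space \<Rightarrow> real) set" where
  "poly_upto \<nu> =
    {p. \<exists>A c. finite A \<and> (\<forall>\<alpha>\<in>A. (\<Sum>b\<in>Basis. \<alpha> b) \<le> \<nu>) \<and>
          p = (\<lambda>z. \<Sum>\<alpha>\<in>A. c \<alpha> * (\<Prod>b\<in>Basis. (z \<bullet> b) ^ \<alpha> b))}"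

lemma poly_upto_const: "(\<lambda>z::'a::euclidean_space. a) \<in> poly_upto 0"
  unfolding poly_upto_def
  by (rule CollectI, rule exI[of _ "{\<lambda>_. 0}"], rule exI[of _ "\<lambda>_. a"]) auto

lemma poly_upto_coord:
  assumes "b0 \<in> Basis"
  shows "(\<lambda>z::'a::euclidean_space. z \<bullet> b0) \<in> poly_upto 1"
proof -
  have "(\<Prod>b\<in>Basis. (z \<bullet> b) ^ (if b = b0 then 1 else 0)) = z \<bullet> b0" for z :: 'a
    using assms by (subst prod.remove[of _ b0]) auto
  then show ?thesis
    unfolding poly_upto_def using assms
    by (intro CollectI exI[of _ "{\<lambda>b. if b = b0 then 1 else 0}"] exI[of _ "\<lambda>_. 1"]) auto
qed

lemma poly_upto_mono:
  assumes "\<mu> \<le> \<nu>"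
  shows "poly_upto \<mu> \<subseteq> poly_upto \<nu>"
proof
  fix p :: "'a \<Rightarrow> real" assume "p \<in> poly_upto \<mu>"
  then obtain A c where A: "finite A" "\<forall>\<alpha>\<in>A. (\<Sum>b\<in>Basis. \<alpha> b) \<le> \<mu>"
    "p = (\<lambda>z. \<Sum>\<alpha>\<in>A. c \<alpha> * (\<Prod>b\<in>Basis. (z \<bullet> b) ^ \<alpha> b))"
    unfolding poly_upto_def by blast
  from A(2) assms have "\<forall>\<alpha>\<in>A. (\<Sum>b\<in>Basis. \<alpha> b) \<le> \<nu>" by (meson order_trans)
  with A(1,3) show "p \<in> poly_upto \<nu>" unfolding poly_upto_def by blast
qed

lemma poly_upto_add:
  assumes "p \<in> poly_upto \<nu>" "q \<in> poly_upto \<nu>"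
  shows "(\<lambda>z. p z + q z) \<in> poly_upto \<nu>"
proof -
  let ?m = "\<lambda>z \<alpha>. \<Prod>b\<in>Basis. (z \<bullet> b) ^ \<alpha> b"
  obtain A c where A: "finite A" "\<forall>\<alpha>\<in>A. (\<Sum>b\<in>Basis. \<alpha> b) \<le> \<nu>" "p = (\<lambda>z. \<Sum>\<alpha>\<in>A. c \<alpha> * ?m z \<alpha>)"
    using assms(1) unfolding poly_upto_def by auto
  obtain B d where B: "finite B" "\<forall>\<alpha>\<in>B. (\<Sum>b\<in>Basis. \<alpha> b) \<le> \<nu>" "q = (\<lambda>z. \<Sum>\<alpha>\<in>B. d \<alpha> * ?m z \<alpha>)"
    using assms(2) unfolding poly_upto_def by auto
  define e where "e \<alpha> = (if \<alpha> \<in> A then c \<alpha> else 0) + (if \<alpha> \<in> B then d \<alpha> else 0)" for \<alpha>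
  have "p z + q z = (\<Sum>\<alpha>\<in>A \<union> B. e \<alpha> * ?m z \<alpha>)" for z
  proof -
    have "p z = (\<Sum>\<alpha>\<in>A \<union> B. (if \<alpha> \<in> A then c \<alpha> else 0) * ?m z \<alpha>)"
      unfolding A(3) using A(1) B(1) by (intro sum.mono_neutral_cong_left) auto
    moreover have "q z = (\<Sum>\<alpha>\<in>A \<union> B. (if \<alpha> \<in> B then d \<alpha> else 0) * ?m z \<alpha>)"
      unfolding B(3) using A(1) B(1) by (intro sum.mono_neutral_cong_left) auto
    ultimately show ?thesis by (simp add: e_def distrib_right sum.distrib)
  qed
  then show ?thesis
    unfolding poly_upto_def using A B by (intro CollectI exI[of _ "A \<union> B"] exI[of _ e]) auto
qed

lemma poly_upto_sum:
  assumes "\<And>i. i \<in> X \<Longrightarrow> p i \<in> poly_upto \<nu>"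
  shows "(\<lambda>z. \<Sum>i\<in>X. p i z) \<in> poly_upto \<nu>"
  using assms
proof (induction X rule: infinite_finite_induct)
  case (insert x F)
  then show ?case using poly_upto_add[of "p x" \<nu> "\<lambda>z. \<Sum>i\<in>F. p i z"] by simp
qed (use poly_upto_const[of 0] poly_upto_mono[of 0 \<nu>] in auto)

lemma poly_upto_mult:
  assumes "p \<in> poly_upto \<mu>" "q \<in> poly_upto \<nu>"
  shows "(\<lambda>z. p z * q z) \<in> poly_upto (\<mu> + \<nu>)"
proof -
  let ?m = "\<lambda>z \<alpha>. \<Prod>b\<in>Basis. (z \<bullet> b) ^ \<alpha> b"
  obtain A c where A: "finite A" "\<forall>\<alpha>\<in>A. (\<Sum>b\<in>Basis. \<alpha> b) \<le> \<mu>" "p = (\<lambda>z. \<Sum>\<alpha>\<in>A. c \<alpha> * ?m z \<alpha>)"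
    using assms(1) unfolding poly_upto_def by auto
  obtain B d where B: "finite B" "\<forall>\<alpha>\<in>B. (\<Sum>b\<in>Basis. \<alpha> b) \<le> \<nu>" "q = (\<lambda>z. \<Sum>\<alpha>\<in>B. d \<alpha> * ?m z \<alpha>)"
    using assms(2) unfolding poly_upto_def by auto
  have "(\<lambda>z. (c \<alpha> * ?m z \<alpha>) * (d \<beta> * ?m z \<beta>)) \<in> poly_upto (\<mu> + \<nu>)" if "\<alpha> \<in> A" "\<beta> \<in> B" for \<alpha> \<beta>
  proof -
    have "(\<Sum>b\<in>Basis. \<alpha> b + \<beta> b) \<le> \<mu> + \<nu>"
      unfolding sum.distrib using A(2) B(2) that by (intro add_mono) auto
    moreover have "(c \<alpha> * ?m z \<alpha>) * (d \<beta> * ?m z \<beta>) = (c \<alpha> * d \<beta>) * ?m z (\<lambda>b. \<alpha> b + \<beta> b)" for z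
      unfolding power_add prod.distrib by (simp only: mult.assoc mult.left_commute)
    ultimately show ?thesis
      unfolding poly_upto_def
      by (intro CollectI exI[of _ "{\<lambda>b. \<alpha> b + \<beta> b}"] exI[of _ "\<lambda>_. c \<alpha> * d \<beta>"])
         (simp only: finite.intros ball_simps simp_thms sum.insert sum.empty empty_iff add_0_right if_False finite)
  qed
  then have "(\<lambda>z. \<Sum>\<alpha>\<in>A. \<Sum>\<beta>\<in>B. (c \<alpha> * ?m z \<alpha>) * (d \<beta> * ?m z \<beta>)) \<in> poly_upto (\<mu> + \<nu>)"
    by (intro poly_upto_sum)
  moreover have "(\<lambda>z. p z * q z) = (\<lambda>z. \<Sum>\<alpha>\<in>A. \<Sum>\<beta>\<in>B. (c \<alpha> * ?m z \<alpha>) * (d \<beta> * ?m z \<beta>))"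
    unfolding A(3) B(3) by (simp add: sum_product)
  ultimately show ?thesis by simp
qed

lemma real_polynomial_function_iff_poly_upto:
  "real_polynomial_function p \<longleftrightarrow> (\<exists>\<nu>. p \<in> poly_upto \<nu>)" for p :: "'a::euclidean_space \<Rightarrow> real"
proof
  assume "real_polynomial_function p"
  then show "\<exists>\<nu>. p \<in> poly_upto \<nu>"
  proof induction
    case (linear f)
    have "f z = (\<Sum>b\<in>Basis. f b * (z \<bullet> b))" for z
    proof -
      interpret bounded_linear f by fact
      have "f z = f (\<Sum>b\<in>Basis. (z \<bullet> b) *\<^sub>R b)" by (simp add: euclidean_representation)
      then show ?thesis by (simp add: sum scaleR mult.commute)
    qed
    then have "f = (\<lambda>z. \<Sum>b\<in>Basis. f b * (z \<bullet> b))" by blast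
    moreover have "(\<lambda>z. f b * (z \<bullet> b)) \<in> poly_upto (0 + 1)" if "b \<in> Basis" for b
      using poly_upto_mult[OF poly_upto_const poly_upto_coord[OF that]] .
    ultimately show ?case using poly_upto_sum[of Basis "\<lambda>b z. f b * (z \<bullet> b)" 1] by auto
  next
    case (const c)
    show ?case using poly_upto_const by blast
  next
    case (add f g)
    then obtain \<mu> \<nu> where "f \<in> poly_upto \<mu>" "g \<in> poly_upto \<nu>" by blast
    then have "f \<in> poly_upto (max \<mu> \<nu>)" "g \<in> poly_upto (max \<mu> \<nu>)"
      using poly_upto_mono[of \<mu> "max \<mu> \<nu>"] poly_upto_mono[of \<nu> "max \<mu> \<nu>"] by auto
    then show ?case using poly_upto_add by blast
  next
    case (mult f g)
    then show ?case using poly_upto_mult by blast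
  qed
next
  assume "\<exists>\<nu>. p \<in> poly_upto \<nu>"
  then obtain A c where A: "finite A" "p = (\<lambda>z. \<Sum>\<alpha>\<in>A. c \<alpha> * (\<Prod>b\<in>Basis. (z \<bullet> b) ^ \<alpha> b))"
    unfolding poly_upto_def by blast
  have "real_polynomial_function (\<lambda>z::'a. z \<bullet> b)" for b
    by (rule real_polynomial_function.intros(1)[OF bounded_linear_inner_left])
  then show "real_polynomial_function p"
    unfolding A(2)
    by (intro real_polynomial_function_sum real_polynomial_function.intros(4)
        real_polynomial_function.intros(2) real_polynomial_function_prod
        real_polynomial_function_power A(1) finite_Basis)
qed

definition sos :: "('a::real_normed_vector \<Rightarrow> real) set" where
  "sos = {p. \<exists>(N::nat) q. (\<forall>i<N. real_polynomial_function (q i)) \<and> p = (\<lambda>z. \<Sum>i<N. (q i z)\<^sup>2)}"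

definition semialg_set ::
  "nat \<Rightarrow> (nat \<Rightarrow> 'a \<Rightarrow> real) \<Rightarrow> nat \<Rightarrow> (nat \<Rightarrow> 'a \<Rightarrow> real) \<Rightarrow> 'a set" where
  "semialg_set I g J h = {z. (\<forall>i\<in>{1..I}. g i z \<ge> 0) \<and> (\<forall>j\<in>{1..J}. h j z = 0)}"

text \<open>
  The parameter \<open>M\<close> is the set of polynomials from which the multipliers \<open>\<sigma>\<^sub>i\<close>, \<open>\<rho>\<^sub>j\<close> are taken: all
  polynomials for the quadratic module itself, \<open>poly_upto \<nu>'\<close> for its truncation, and
  \<open>poly_upto \<nu>' \<inter> Q\<close> when the multipliers must in addition have a prescribed form \<open>Q\<close>.
\<close>

definition quad_module_over ::
  "('a \<Rightarrow> real) set \<Rightarrow> nat \<Rightarrow> (nat \<Rightarrow> 'a \<Rightarrow> real) \<Rightarrow> nat \<Rightarrow> (nat \<Rightarrow> 'a \<Rightarrow> real)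
    \<Rightarrow> ('a::real_normed_vector \<Rightarrow> real) set" where
  "quad_module_over M I g J h =
    {p. \<exists>\<sigma> \<rho>. (\<forall>i\<in>{0..I}. \<sigma> i \<in> sos \<inter> M) \<and> (\<forall>j\<in>{1..J}. \<rho> j \<in> M) \<and>
          p = (\<lambda>z. \<sigma> 0 z + (\<Sum>i=1..I. \<sigma> i z * g i z) + (\<Sum>j=1..J. \<rho> j z * h j z))}"

definition quad_module ::
  "nat \<Rightarrow> (nat \<Rightarrow> 'a \<Rightarrow> real) \<Rightarrow> nat \<Rightarrow> (nat \<Rightarrow> 'a \<Rightarrow> real)
    \<Rightarrow> ('a::real_normed_vector \<Rightarrow> real) set" where
  "quad_module I g J h = quad_module_over (Collect real_polynomial_function) I g J h"

definition archimedean_spec ::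
  "nat \<Rightarrow> (nat \<Rightarrow> 'a \<Rightarrow> real) \<Rightarrow> nat \<Rightarrow> (nat \<Rightarrow> 'a::real_normed_vector \<Rightarrow> real) \<Rightarrow> bool" where
  "archimedean_spec I g J h \<longleftrightarrow> (\<exists>R::real. (\<lambda>x. R\<^sup>2 - (norm x)\<^sup>2) \<in> quad_module I g J h)"


section \<open>Increasing tuples and compound matrices\<close>

text \<open>
  The number \<open>k\<close> is \<open>CARD('k)\<close> for a finite linear order \<open>'k\<close>, and \<open>('k,'n) ktuple\<close> is the type of
  increasing \<open>k\<close>-tuples of indices in \<open>'n\<close>, so that \<open>\<real>\<close> to the power \<open>n choose k\<close> is
  \<open>('k,'n) kvec\<close>, defined below as \<open>real ^ ('k,'n) ktuple\<close>. Vectors and matrices being indexed by the tuples themselves, no enumeration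
  of the tuples is needed. HOL types are nonempty: the second disjunct only matters for \<open>k > n\<close>.
\<close>

lemma ex_strict_mono_into:
  fixes S :: "'n::{finite,linorder} set"
  assumes "CARD('k::{finite,linorder}) \<le> card S"
  shows "\<exists>c :: 'k \<Rightarrow> 'n. strict_mono c \<and> range c \<subseteq> S"
proof -
  define c where "c x = sorted_list_of_set S ! card {..<x}" for x :: 'k
  have len: "card {..<x} < length (sorted_list_of_set S)" for x :: 'k
  proof -
    have "card {..<x} < CARD('k)"
      by (rule psubset_card_mono) auto
    with assms show ?thesis by simp
  qed
  have "strict_mono c"
  proof (rule strict_monoI)
    fix x y :: 'k assume "x < y"
    then have "card {..<x} < card {..<y}"
      by (intro psubset_card_mono) auto
    then show "c x < c y"
      unfolding c_def using len[of y] by (intro sorted_wrt_nth_less[of "(<)"]) auto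
  qed
  moreover have "range c \<subseteq> S"
  proof safe
    fix x :: 'k
    have "c x \<in> set (sorted_list_of_set S)"
      unfolding c_def by (rule nth_mem[OF len])
    then show "c x \<in> S" by simp
  qed
  ultimately show ?thesis by blast
qed

typedef (overloaded) ('k, 'n) ktuple =
    "{c :: 'k::{finite,linorder} \<Rightarrow> 'n::{finite,linorder}. strict_mono c \<or> CARD('n) < CARD('k)}"
  morphisms tuple_nth Abs_ktuple
  using ex_strict_mono_into[of "UNIV :: 'n set", where 'k='k] by (cases "CARD('n) < CARD('k)") auto

instance ktuple :: ("{finite,linorder}", "{finite,linorder}") finite
proof
  have "inj (tuple_nth :: ('a,'b) ktuple \<Rightarrow> _)"
    by (simp add: inj_def tuple_nth_inject)
  then show "finite (UNIV :: ('a,'b) ktuple set)"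
    by (rule inj_on_finite[of _ _ "UNIV :: ('a \<Rightarrow> 'b) set"]) auto
qed

lemma card_ktuple:
  assumes "CARD('k) \<le> CARD('n)"
  shows "CARD(('k::{finite,linorder}, 'n::{finite,linorder}) ktuple) = CARD('n) choose CARD('k)"
proof -
  have sm: "strict_mono (tuple_nth r)" for r :: "('k,'n) ktuple"
    using tuple_nth[of r] assms by auto
  have "bij_betw (\<lambda>r :: ('k,'n) ktuple. range (tuple_nth r)) UNIV {S. card S = CARD('k)}"
    unfolding bij_betw_def
  proof
    show "inj (\<lambda>r :: ('k,'n) ktuple. range (tuple_nth r))"
    proof (rule injI)
      fix r r' :: "('k,'n) ktuple" assume eq: "range (tuple_nth r) = range (tuple_nth r')"
      let ?l = "sorted_list_of_set (UNIV :: 'k set)"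
      have *: "sorted (map (tuple_nth q) ?l) \<and> distinct (map (tuple_nth q) ?l)" for q :: "('k,'n) ktuple"
        using sm[of q] by (auto simp: distinct_map strict_mono_mono sorted_map_mono strict_mono_imp_inj_on)
      have "map (tuple_nth r) ?l = map (tuple_nth r') ?l"
        using * eq by (intro sorted_distinct_set_unique) auto
      then have "tuple_nth r = tuple_nth r'"
        by (auto simp: map_eq_conv)
      then show "r = r'" by (simp add: tuple_nth_inject)
    qed
    show "range (\<lambda>r :: ('k,'n) ktuple. range (tuple_nth r)) = {S. card S = CARD('k)}"
    proof safe
      fix r :: "('k,'n) ktuple"
      show "card (range (tuple_nth r)) = CARD('k)"
        using sm by (intro card_image strict_mono_imp_inj_on)
    next
      fix S :: "'n set" assume S: "card S = CARD('k)"
      obtain c :: "'k \<Rightarrow> 'n" where c: "strict_mono c" "range c \<subseteq> S"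
        using ex_strict_mono_into[of S] S by auto
      have "card (range c) = card S"
        using c(1) S by (simp add: card_image strict_mono_imp_inj_on)
      then have "range c = S" using c(2) by (simp add: card_subset_eq)
      moreover have "tuple_nth (Abs_ktuple c) = c" using c(1) by (intro Abs_ktuple_inverse) auto
      ultimately show "S \<in> range (\<lambda>r :: ('k,'n) ktuple. range (tuple_nth r))" by (metis rangeI)
    qed
  qed
  then have "CARD(('k,'n) ktuple) = card {S :: 'n set. card S = CARD('k)}"
    by (rule bij_betw_same_card)
  also have "\<dots> = CARD('n) choose CARD('k)"
    using n_subsets[of "UNIV :: 'n set"] by simp
  finally show ?thesis .
qed

type_synonym ('k, 'n) kvec = "(real, ('k, 'n) ktuple) vec"
type_synonym ('k, 'n) kmat = "(('k, 'n) kvec, ('k, 'n) ktuple) vec"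

definition mult_compound ::
  "((real, 'n::{finite,linorder}) vec, 'n) vec \<Rightarrow> ('k::{finite,linorder}, 'n) kmat" where
  "mult_compound A = (\<chi> r c. det (\<chi> a b. A $ tuple_nth r a $ tuple_nth c b))"

definition add_compound ::
  "((real, 'n::{finite,linorder}) vec, 'n) vec \<Rightarrow> ('k::{finite,linorder}, 'n) kmat" where
  "add_compound A = vector_derivative (\<lambda>\<delta>. mult_compound (mat 1 + \<delta> *\<^sub>R A)) (at 0)"


section \<open>Trajectories, forward invariance and leading Lyapunov exponents\<close>

definition solves_ode_on ::
  "real set \<Rightarrow> (real \<Rightarrow> 'a \<Rightarrow> 'a::real_normed_vector) \<Rightarrow> (real \<Rightarrow> 'a) \<Rightarrow> bool" where
  "solves_ode_on T F x \<longleftrightarrow> (\<forall>t\<in>T. (x has_vector_derivative F t (x t)) (at t within T))"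

definition trajectory ::
  "('a::real_normed_vector \<Rightarrow> 'a) \<Rightarrow> 'a \<Rightarrow> (real \<Rightarrow> 'a) \<Rightarrow> bool" where
  "trajectory f x0 x \<longleftrightarrow> solves_ode_on {0..} (\<lambda>_. f) x \<and> x 0 = x0"

text \<open>
  Quantifying over all solution segments covers trajectories that might cease to exist in finite
  time; existence for all \<open>t \<ge> 0\<close> is not part of forward invariance.
\<close>

definition forward_invariant :: "('a::real_normed_vector \<Rightarrow> 'a) \<Rightarrow> 'a set \<Rightarrow> bool" where
  "forward_invariant f S \<longleftrightarrow>
    (\<forall>T\<ge>0. \<forall>x. solves_ode_on {0..T} (\<lambda>_. f) x \<and> x 0 \<in> S \<longrightarrow> (\<forall>t\<in>{0..T}. x t \<in> S))"

text \<open>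
  \<open>M\<^sub>k(x\<^sub>0)\<close>. For polynomial \<open>f\<close> the trajectory \<open>x\<close> from \<open>x\<^sub>0\<close> is unique on \<open>t \<ge> 0\<close>, and so is \<open>y\<close> given \<open>x\<close>
  and its unit initial vector, so this supremum ranges exactly over the initial vectors \<open>y 0\<close> in
  the unit sphere, provided that the trajectory from \<open>x\<^sub>0\<close> exists for all \<open>t \<ge> 0\<close>.
\<close>

definition lyap_sum ::
  "'k::{finite,linorder} itself \<Rightarrow> ((real, 'n::{finite,linorder}) vec \<Rightarrow> (real, 'n) vec)
    \<Rightarrow> (real, 'n) vec \<Rightarrow> ereal" where
  "lyap_sum _ f x0 =
    Sup {Limsup at_top (\<lambda>t. ereal (ln (norm (y t)) / t)) | x (y :: real \<Rightarrow> ('k, 'n) kvec).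
          trajectory f x0 x \<and>
          solves_ode_on {0..} (\<lambda>t v. add_compound (jacobian f (at (x t))) *v v) y \<and>
          y 0 \<in> sphere 0 1}"


section \<open>The optimization problem\<close>

definition gradient :: "('a::real_inner \<Rightarrow> real) \<Rightarrow> 'a \<Rightarrow> 'a" where
  "gradient F x = (THE D. GDERIV F x :> D)"

definition m_field ::
  "((real, 'n::{finite,linorder}) vec \<Rightarrow> (real, 'n) vec) \<Rightarrow> real
    \<Rightarrow> (real, 'n) vec \<Rightarrow> ('k::{finite,linorder}, 'n) kvec \<Rightarrow> ('k, 'n) kvec" where
  "m_field f B x w = add_compound (jacobian f (at x)) *v w - B *\<^sub>R w"

text \<open>
  \<open>Q\<close> is the form to which \<open>V\<close> and all multipliers are restricted. The constraints of
  \<open>S \<times> \<real>\<^sup>N\<close>, with \<open>N = n choose k\<close>, are those of \<open>S\<close>, read as polynomials in \<open>(x, w)\<close>. In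
  \<^typ>\<open>ereal\<close> the infimum of the empty set is \<open>\<infinity>\<close>.
\<close>

definition C3_over ::
  "((real, 'n::{finite,linorder}) vec \<times> ('k::{finite,linorder}, 'n) kvec \<Rightarrow> real) set
    \<Rightarrow> ((real, 'n) vec \<Rightarrow> (real, 'n) vec)
    \<Rightarrow> nat \<Rightarrow> (nat \<Rightarrow> (real, 'n) vec \<Rightarrow> real) \<Rightarrow> nat \<Rightarrow> (nat \<Rightarrow> (real, 'n) vec \<Rightarrow> real)
    \<Rightarrow> nat \<Rightarrow> nat \<Rightarrow> ereal" where
  "C3_over Q f I g J h \<nu> \<nu>' =
    (let QM = quad_module_over (poly_upto \<nu>' \<inter> Q) I (\<lambda>i z. g i (fst z)) J (\<lambda>j z. h j (fst z)) in
      Inf {ereal B | B V. V \<in> poly_upto \<nu> \<inter> Q \<and>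
            (\<lambda>(x, w). V (x, w) - (norm w)\<^sup>2) \<in> QM \<and>
            (\<lambda>(x, w). - (f x \<bullet> gradient (\<lambda>x'. V (x', w)) x +
                          m_field f B x w \<bullet> gradient (\<lambda>w'. V (x, w')) w)) \<in> QM})"

definition C3 ::
  "'k::{finite,linorder} itself \<Rightarrow> ((real, 'n::{finite,linorder}) vec \<Rightarrow> (real, 'n) vec)
    \<Rightarrow> nat \<Rightarrow> (nat \<Rightarrow> (real, 'n) vec \<Rightarrow> real) \<Rightarrow> nat \<Rightarrow> (nat \<Rightarrow> (real, 'n) vec \<Rightarrow> real)
    \<Rightarrow> nat \<Rightarrow> nat \<Rightarrow> ereal" where
  "C3 _ = C3_over (UNIV :: ((real, 'n) vec \<times> ('k, 'n) kvec \<Rightarrow> real) set)"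

text \<open>The polynomials \<open>w\<^sup>T U(x) w\<close> with \<open>U\<close> a symmetric polynomial matrix.\<close>

definition quadratic_in_w :: "((real^'n) \<times> (real^'m) \<Rightarrow> real) set" where
  "quadratic_in_w =
    {p. \<exists>U :: real^'n \<Rightarrow> real^'m^'m.
          polynomial_function U \<and> (\<forall>x. transpose (U x) = U x) \<and> p = (\<lambda>(x, w). w \<bullet> (U x *v w))}"

definition C3_quadratic ::
  "'k::{finite,linorder} itself \<Rightarrow> ((real, 'n::{finite,linorder}) vec \<Rightarrow> (real, 'n) vec)
    \<Rightarrow> nat \<Rightarrow> (nat \<Rightarrow> (real, 'n) vec \<Rightarrow> real) \<Rightarrow> nat \<Rightarrow> (nat \<Rightarrow> (real, 'n) vec \<Rightarrow> real)
    \<Rightarrow> nat \<Rightarrow> nat \<Rightarrow> ereal" where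
  "C3_quadratic _ = C3_over (quadratic_in_w :: ((real, 'n) vec \<times> ('k, 'n) kvec \<Rightarrow> real) set)"

end

theory Submission
  imports Defs
begin

text \<open>
  Upper bound: along a trajectory \<open>V(x, e\<^sup>-\<^sup>B\<^sup>t y)\<close> is nonincreasing and dominates
  \<open>|e\<^sup>-\<^sup>B\<^sup>t y|\<^sup>2\<close>, so \<open>|y|\<close> grows at most like \<open>e\<^sup>B\<^sup>t\<close>.

  Sharpness: let \<open>B\<close> exceed the supremum. Every solution \<open>w\<close> of \<open>w' = (Df\<^sup>[\<^sup>k\<^sup>](x) - B) w\<close> over \<open>x(t) \<in> S\<close>
  is eventually small, and compactness of \<open>S \<times> sphere 0 1\<close> together with the cocycle property turns
  this into a uniform contraction by the factor \<open>1/2\<close> at one time \<open>T\<close>. The usual Lyapunov function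
  \<open>\<integral>\<^sub>0\<^sup>T |w|\<^sup>2 dt\<close> is replaced by its Riemann sum along the explicit Euler scheme: the Euler iterates are
  polynomial in \<open>x\<close> and linear in \<open>w\<close>, so the sum is already a polynomial quadratic form, and it
  satisfies both Lyapunov inequalities strictly once the step is small. Strictly positive
  polynomial quadratic forms have the required certificates by the matrix version of Putinar's
  theorem: a multiple of the constraints is subtracted to make the form positive on a cube, where
  Bernstein coefficients of high degree are positive definite.
\<close>

section \<open>Bernstein coefficients of polynomials\<close>

text \<open>The flow is not polynomial, and replacing the integral by a polynomial would need C^1
  control of the flow in its initial data. An Euler iterate is polynomial from the start, and its
  derivative in the direction \<open>G\<close> obeys a discrete variational equation, so only
  derivatives of \<open>G\<close> have to be estimated. The telescoped derivative is
  \<open>|w|^2\<close> at time \<open>T\<close> minus \<open>|w|^2\<close> at time 0; it must be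
  negative for one \<open>T\<close> valid everywhere, because a single polynomial serves all initial
  points. This is why contraction at varying times is not enough. The strict inequality for
  \<open>B\<close> leaves the margin that pays for the Euler and Bernstein errors. The cube is
  dictated by multiplication: with several generators certificates cannot in general be multiplied,
  but for the single generator \<open>b = r^2 - |x|^2\<close> the set of all \<open>s + t b\<close>
  is closed under products. Once the other constraints are absorbed, only products of the factors
  \<open>r + x_e\<close> and \<open>r - x_e\<close> remain, and each factor has this form. The
  matrix coefficients are constant, so symmetry and semidefiniteness alone make them sums of squares
  of linear forms.\<close>

definition bernstein_coeff :: "nat \<Rightarrow> nat \<Rightarrow> nat \<Rightarrow> real" where
  "bernstein_coeff N j k = real (k choose j) / real (N choose j)"

text \<open>Multiply \<open>t ^ j\<close> by \<open>(t + (1 - t)) ^ (N - j) = 1\<close> and expand;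
  the terms with \<open>k < j\<close> drop out because \<open>k choose j\<close> vanishes.\<close>

lemma power_eq_sum_Bernstein:
  assumes "j \<le> N"
  shows "t ^ j = (\<Sum>k\<le>N. bernstein_coeff N j k * Bernstein N k t)"
proof -
  have "(\<Sum>k\<le>N. bernstein_coeff N j k * Bernstein N k t)
      = (\<Sum>k\<in>{j..N}. bernstein_coeff N j k * Bernstein N k t)"
    by (intro sum.mono_neutral_right) (auto simp: bernstein_coeff_def)
  also have "\<dots> = (\<Sum>k\<in>{j..N}. real ((N - j) choose (k - j)) * t ^ k * (1 - t) ^ (N - k))"
  proof (intro sum.cong refl)
    fix k assume k: "k \<in> {j..N}"
    have "real (N choose k) * real (k choose j) = real (N choose j) * real ((N - j) choose (k - j))"
      using choose_mult[of j k N] k by (metis atLeastAtMost_iff of_nat_mult)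
    then show "bernstein_coeff N j k * Bernstein N k t = real ((N - j) choose (k - j)) * t ^ k * (1 - t) ^ (N - k)"
      using assms by (simp add: bernstein_coeff_def Bernstein_def field_simps)
  qed
  also have "\<dots> = (\<Sum>l\<le>N - j. real ((N - j) choose l) * t ^ (l + j) * (1 - t) ^ (N - j - l))"
    using assms by (intro sum.reindex_bij_witness[of _ "\<lambda>l. l + j" "\<lambda>k. k - j"]) (auto simp: add.commute)
  also have "\<dots> = t ^ j * (\<Sum>l\<le>N - j. real ((N - j) choose l) * t ^ l * (1 - t) ^ (N - j - l))"
    by (simp add: sum_distrib_left power_add mult_ac)
  also have "(\<Sum>l\<le>N - j. real ((N - j) choose l) * t ^ l * (1 - t) ^ (N - j - l)) = 1"
    using binomial_ring[of t "1 - t" "N - j"] by simp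
  finally show ?thesis by simp
qed

text \<open>The coefficient is the product of the factors \<open>(k - i) / (N - i)\<close> for
  \<open>i < j\<close>, each within \<open>2 j / N\<close> of \<open>k / N\<close>. All factors have
  modulus at most 1, so their errors simply add up. The condition \<open>2 * j \<le> N\<close> keeps
  the denominators above \<open>N / 2\<close>, and the factors bounded even for
  \<open>k < i\<close>.\<close>

lemma bernstein_coeff_approx:
  assumes "2 * j \<le> N" "k \<le> N" "0 < N"
  shows "\<bar>bernstein_coeff N j k\<bar> \<le> 1" "\<bar>bernstein_coeff N j k - (real k / real N) ^ j\<bar> \<le> 2 * real j ^ 2 / real N"
proof -
  let ?a = "\<lambda>i. (real k - real i) / (real N - real i)"
  have pr: "fact j * real (m choose j) = (\<Prod>i = 0..<j. real m - real i)" for m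
    by (simp add: binomial_gbinomial gbinomial_mult_fact)
  have "bernstein_coeff N j k = (fact j * real (k choose j)) / (fact j * real (N choose j))"
    by (simp add: bernstein_coeff_def)
  also have "\<dots> = (\<Prod>i = 0..<j. ?a i)"
    unfolding pr by (simp add: prod_dividef)
  finally have eq: "bernstein_coeff N j k = (\<Prod>i = 0..<j. ?a i)" .
  have a1: "\<bar>?a i\<bar> \<le> 1" if "i < j" for i
    using that assms by (simp add: abs_le_iff field_simps)
  show "\<bar>bernstein_coeff N j k\<bar> \<le> 1"
    unfolding eq abs_prod using a1 by (intro prod_le_1) auto
  have pw: "(real k / real N) ^ j = (\<Prod>i = 0..<j. real k / real N)" by simp
  have d: "\<bar>?a i - real k / real N\<bar> \<le> 2 * real j / real N" if "i < j" for i
  proof -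
    have pos: "real N - real i > 0" "2 * (real N - real i) \<ge> real N"
    proof -
      have "real (2 * j) \<le> real N" "real i < real j" using assms(1) that by (simp_all only: of_nat_le_iff of_nat_less_iff)
      then show "real N - real i > 0" "2 * (real N - real i) \<ge> real N" by simp_all
    qed
    have "?a i - real k / real N = - (real i * (real N - real k)) / (real N * (real N - real i))"
      using pos assms(3) by (simp add: divide_simps) (simp add: algebra_simps)
    then have "\<bar>?a i - real k / real N\<bar> = real i * (real N - real k) / (real N * (real N - real i))"
      using pos assms by (simp add: abs_mult)
    also have "\<dots> \<le> real j * real N / (real N * (real N / 2))"
      using pos assms that by (intro frac_le mult_mono) auto
    also have "\<dots> = 2 * real j / real N" using assms(3) by simp
    finally show ?thesis .
  qed
  have "\<bar>bernstein_coeff N j k - (real k / real N) ^ j\<bar> \<le> (\<Sum>i = 0..<j. \<bar>?a i - real k / real N\<bar>)"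
    unfolding eq pw using a1 assms by (intro norm_prod_diff[where 'a=real, unfolded real_norm_def]) auto
  also have "\<dots> \<le> (\<Sum>i = 0..<j. 2 * real j / real N)" using d by (intro sum_mono) auto
  also have "\<dots> = 2 * real j ^ 2 / real N" by (simp add: power2_eq_square)
  finally show "\<bar>bernstein_coeff N j k - (real k / real N) ^ j\<bar> \<le> 2 * real j ^ 2 / real N" .
qed

section \<open>Bernstein coefficients in several variables\<close>

definition tensor_bernstein :: "nat \<Rightarrow> ('a::euclidean_space \<Rightarrow> nat) \<Rightarrow> 'a \<Rightarrow> real" where
  "tensor_bernstein N k x = (\<Prod>b\<in>Basis. Bernstein N (k b) (x \<bullet> b))"

abbreviation bernstein_index :: "nat \<Rightarrow> ('a::euclidean_space \<Rightarrow> nat) set" where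
  "bernstein_index N \<equiv> PiE Basis (\<lambda>_. {..N})"

definition bernstein_node :: "nat \<Rightarrow> ('a::euclidean_space \<Rightarrow> nat) \<Rightarrow> 'a" where
  "bernstein_node N k = (\<Sum>b\<in>Basis. (real (k b) / real N) *\<^sub>R b)"

lemma bernstein_node_inner [simp]: "b \<in> Basis \<Longrightarrow> bernstein_node N k \<bullet> b = real (k b) / real N"
  by (simp add: bernstein_node_def inner_sum_left inner_Basis if_distrib sum.delta cong: if_cong)

text \<open>Two requirements with different roles: the representation is exact once \<open>N\<close>
  is large, while the coefficients merely approximate the values at the grid nodes. Uniformity over
  all nodes is what passes a lower bound on the cube to every coefficient.\<close>

definition bernstein_coeffs :: "('a::euclidean_space \<Rightarrow> real) \<Rightarrow> (nat \<Rightarrow> ('a \<Rightarrow> nat) \<Rightarrow> real) \<Rightarrow> bool" where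
  "bernstein_coeffs p c \<longleftrightarrow>
     (\<forall>\<^sub>F N in sequentially. \<forall>x. p x = (\<Sum>k\<in>bernstein_index N. c N k * tensor_bernstein N k x)) \<and>
     (\<forall>e>0. \<forall>\<^sub>F N in sequentially. \<forall>k\<in>bernstein_index N. \<bar>c N k - p (bernstein_node N k)\<bar> < e)"

lemma bernstein_coeffs_add_cmult:
  assumes c: "bernstein_coeffs p c" and d: "bernstein_coeffs q d"
  shows "bernstein_coeffs (\<lambda>x. a * p x + q x) (\<lambda>N k. a * c N k + d N k)"
proof -
  note c = c[unfolded bernstein_coeffs_def] and d = d[unfolded bernstein_coeffs_def]
  show ?thesis
    unfolding bernstein_coeffs_def
  proof (intro conjI allI impI)
    show "\<forall>\<^sub>F N in sequentially. \<forall>x. a * p x + q x = (\<Sum>k\<in>bernstein_index N. (a * c N k + d N k) * tensor_bernstein N k x)"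
      using conjunct1[OF c] conjunct1[OF d] by eventually_elim (simp add: distrib_right sum.distrib sum_distrib_left mult.assoc)
    fix e :: real assume "e > 0"
    then have "e / 2 / (\<bar>a\<bar> + 1) > 0" "e / 2 > 0" by simp_all
    from conjunct2[OF c, rule_format, OF this(1)] conjunct2[OF d, rule_format, OF this(2)]
    show "\<forall>\<^sub>F N in sequentially. \<forall>k\<in>bernstein_index N. \<bar>a * c N k + d N k - (a * p (bernstein_node N k) + q (bernstein_node N k))\<bar> < e"
    proof eventually_elim
      case (elim N)
      show ?case
      proof
        fix k :: "'a \<Rightarrow> nat" assume "k \<in> bernstein_index N"
        with elim have *: "\<bar>c N k - p (bernstein_node N k)\<bar> < e / 2 / (\<bar>a\<bar> + 1)"
          and **: "\<bar>d N k - q (bernstein_node N k)\<bar> < e / 2" by blast+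
        have "\<bar>a * c N k - a * p (bernstein_node N k)\<bar> = \<bar>a\<bar> * \<bar>c N k - p (bernstein_node N k)\<bar>"
          by (simp add: abs_mult flip: right_diff_distrib)
        also have "\<dots> \<le> (\<bar>a\<bar> + 1) * \<bar>c N k - p (bernstein_node N k)\<bar>" by (intro mult_right_mono) auto
        also have "\<dots> < e / 2" using * by (simp add: field_simps)
        finally show "\<bar>a * c N k + d N k - (a * p (bernstein_node N k) + q (bernstein_node N k))\<bar> < e"
          using ** by argo
      qed
    qed
  qed
qed

text \<open>The coefficients are products of univariate ones. As these and the powers of
  \<open>k / N\<close> have modulus at most 1, the error of the product is at most the sum of the
  univariate errors, which is \<open>C / N\<close>.\<close>

lemma bernstein_coeffs_monomial:
  "\<exists>c. bernstein_coeffs (\<lambda>x::'a::euclidean_space. \<Prod>b\<in>Basis. (x \<bullet> b) ^ \<alpha> b) c"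
proof -
  define d where "d = Max (\<alpha> ` (Basis :: 'a set))"
  have d: "\<alpha> b \<le> d" if "b \<in> Basis" for b :: 'a
    using that by (simp add: d_def)
  define c where "c N k = (\<Prod>b\<in>(Basis :: 'a set). bernstein_coeff N (\<alpha> b) (k b))" for N k
  define C where "C = (\<Sum>b\<in>(Basis :: 'a set). 2 * real (\<alpha> b) ^ 2)"
  have C0: "C \<ge> 0" by (simp add: C_def sum_nonneg)
  show ?thesis
    unfolding bernstein_coeffs_def
  proof (intro exI[of _ c] conjI allI impI)
    show "\<forall>\<^sub>F N in sequentially. \<forall>x::'a. (\<Prod>b\<in>Basis. (x \<bullet> b) ^ \<alpha> b) = (\<Sum>k\<in>bernstein_index N. c N k * tensor_bernstein N k x)"
      using eventually_ge_at_top[of d]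
    proof eventually_elim
      case (elim N)
      show ?case
      proof
        fix x :: 'a
        have "(\<Prod>b\<in>Basis. (x \<bullet> b) ^ \<alpha> b) = (\<Prod>b\<in>Basis. \<Sum>k\<le>N. bernstein_coeff N (\<alpha> b) k * Bernstein N k (x \<bullet> b))"
          using d elim by (intro prod.cong refl power_eq_sum_Bernstein) (meson order_trans)
        also have "\<dots> = (\<Sum>k\<in>bernstein_index N. c N k * tensor_bernstein N k x)"
          by (subst prod_sum_PiE) (auto simp: c_def tensor_bernstein_def prod.distrib)
        finally show "(\<Prod>b\<in>Basis. (x \<bullet> b) ^ \<alpha> b) = (\<Sum>k\<in>bernstein_index N. c N k * tensor_bernstein N k x)" .
      qed
    qed
    fix e :: real assume e: "e > 0"
    obtain M :: nat where M: "C / e < real M" using reals_Archimedean2 by blast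
    show "\<forall>\<^sub>F N in sequentially. \<forall>k\<in>bernstein_index N. \<bar>c N k - (\<Prod>b\<in>Basis. (bernstein_node N k \<bullet> b) ^ \<alpha> b)\<bar> < e"
      using eventually_ge_at_top[of "2 * d"] eventually_ge_at_top[of M] eventually_gt_at_top[of 0]
    proof eventually_elim
      case (elim N)
      show ?case
      proof
        fix k :: "'a \<Rightarrow> nat" assume k: "k \<in> bernstein_index N"
        have a: "2 * \<alpha> b \<le> N" "k b \<le> N" if "b \<in> Basis" for b
          using that d[OF that] elim k by (auto simp: PiE_iff)
        have "\<bar>c N k - (\<Prod>b\<in>Basis. (bernstein_node N k \<bullet> b) ^ \<alpha> b)\<bar>
            = \<bar>c N k - (\<Prod>b\<in>Basis. (real (k b) / real N) ^ \<alpha> b)\<bar>" by simp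
        also have "\<dots> \<le> (\<Sum>b\<in>Basis. \<bar>bernstein_coeff N (\<alpha> b) (k b) - (real (k b) / real N) ^ \<alpha> b\<bar>)"
          unfolding c_def using a bernstein_coeff_approx(1)[OF a elim(3)] elim(3)
          by (intro norm_prod_diff[where 'a=real, unfolded real_norm_def]) (auto intro!: power_le_one)
        also have "\<dots> \<le> (\<Sum>b\<in>(Basis::'a set). 2 * real (\<alpha> b) ^ 2 / real N)"
          using bernstein_coeff_approx(2)[OF a elim(3)] by (intro sum_mono) auto
        also have "\<dots> = C / real N" by (simp add: C_def sum_divide_distrib)
        also have "\<dots> < e"
        proof -
          have "C / e < real N" using M elim(2) by linarith
          then show ?thesis using e elim(3) by (simp add: field_simps)
        qed
        finally show "\<bar>c N k - (\<Prod>b\<in>Basis. (bernstein_node N k \<bullet> b) ^ \<alpha> b)\<bar> < e" .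
      qed
    qed
  qed
qed

lemma bernstein_coeffs_polynomial:
  assumes "real_polynomial_function (p :: 'a::euclidean_space \<Rightarrow> real)"
  shows "\<exists>c. bernstein_coeffs p c"
proof -
  obtain \<nu> where "p \<in> poly_upto \<nu>" using assms real_polynomial_function_iff_poly_upto by blast
  then obtain A c where A: "finite A" "p = (\<lambda>z. \<Sum>\<alpha>\<in>A. c \<alpha> * (\<Prod>b\<in>Basis. (z \<bullet> b) ^ \<alpha> b))"
    unfolding poly_upto_def by blast
  show ?thesis
    unfolding A(2) using A(1)
  proof (induction A rule: finite_induct)
    case empty
    have "bernstein_coeffs (\<lambda>x::'a. 0) (\<lambda>_ _. 0)"
      by (simp add: bernstein_coeffs_def)
    then show ?case by auto
  next
    case (insert \<alpha> A)
    obtain d e where "bernstein_coeffs (\<lambda>x::'a. \<Prod>b\<in>Basis. (x \<bullet> b) ^ \<alpha> b) d"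
      "bernstein_coeffs (\<lambda>z. \<Sum>\<alpha>\<in>A. c \<alpha> * (\<Prod>b\<in>Basis. (z \<bullet> b) ^ \<alpha> b)) e"
      using insert.IH bernstein_coeffs_monomial by blast
    from bernstein_coeffs_add_cmult[OF this, of "c \<alpha>"] show ?case
      unfolding sum.insert[OF insert.hyps] by blast
  qed
qed

section \<open>Sums of squares and quadratic forms in w\<close>

lemmas rpf_linear = real_polynomial_function.intros(1)
  and rpf_const = real_polynomial_function.intros(2)
  and rpf_add = real_polynomial_function.intros(3)
  and rpf_mult = real_polynomial_function.intros(4)

lemma rpf_compose_linear:
  assumes "real_polynomial_function p" "bounded_linear l"
  shows "real_polynomial_function (\<lambda>z. p (l z))"
  using real_polynomial_function_compose[OF polynomial_function_bounded_linear[OF assms(2)] assms(1)]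
  by (simp add: o_def)

lemma rpf_fst:
  assumes "real_polynomial_function p"
  shows "real_polynomial_function (\<lambda>z. p (fst z))"
  using rpf_compose_linear[OF assms bounded_linear_fst] .

lemma rpf_cmult: "real_polynomial_function p \<Longrightarrow> real_polynomial_function (\<lambda>z. c * p z)"
  by (rule rpf_mult[OF rpf_const])

lemma rpf_coord: "real_polynomial_function (\<lambda>x::'a::real_inner. x \<bullet> b)"
  by (intro rpf_linear bounded_linear_inner_left)

lemma rpf_norm_sq: "real_polynomial_function (\<lambda>x::'a::euclidean_space. (norm x)\<^sup>2)"
proof -
  have "(\<lambda>x::'a. (norm x)\<^sup>2) = (\<lambda>x. \<Sum>b\<in>Basis. (x \<bullet> b)^2)"
  proof
    fix x :: 'a
    show "(norm x)\<^sup>2 = (\<Sum>b\<in>Basis. (x \<bullet> b)^2)"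
      unfolding power2_norm_eq_inner by (subst euclidean_inner) (simp add: power2_eq_square)
  qed
  then show ?thesis by (auto intro!: real_polynomial_function_sum real_polynomial_function_power rpf_coord)
qed

section \<open>Polynomial matrices and quadratic forms in w\<close>

lemma polynomial_function_vec:
  fixes f :: "'a::real_normed_vector \<Rightarrow> 'b::euclidean_space ^ 'n"
  shows "polynomial_function f \<longleftrightarrow> (\<forall>i. polynomial_function (\<lambda>x. f x $ i))"
  by (auto simp: polynomial_function_iff_Basis_inner Basis_vec_def inner_axis)

lemma polynomial_function_mat:
  fixes f :: "'a::real_normed_vector \<Rightarrow> real^'m^'n"
  shows "polynomial_function f \<longleftrightarrow> (\<forall>i j. real_polynomial_function (\<lambda>x. f x $ i $ j))"
  by (simp add: polynomial_function_vec real_polynomial_function_eq)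

lemma inner_matrix_vector:
  fixes M :: "real^'m^'n"
  shows "v \<bullet> (M *v w) = (\<Sum>i\<in>UNIV. \<Sum>j\<in>UNIV. v $ i * M $ i $ j * w $ j)"
  by (simp add: inner_vec_def matrix_vector_mult_def sum_distrib_left mult.assoc)

text \<open>A matrix for each \<open>x\<close> separately suffices, without regularity in
  \<open>x\<close> and without symmetry: polarization expresses the symmetrized entries through
  values of \<open>p\<close> at basis vectors and their sums, so they are polynomial in
  \<open>x\<close>. Closure properties of \<open>quadratic_in_w\<close> can therefore be checked
  pointwise.\<close>

lemma quadratic_in_wI:
  fixes p :: "(real^'n) \<times> (real^'m) \<Rightarrow> real"
  assumes p: "real_polynomial_function p"
    and q: "\<And>x. \<exists>M::real^'m^'m. \<forall>w. p (x, w) = w \<bullet> (M *v w)"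
  shows "p \<in> quadratic_in_w"
proof -
  obtain M :: "real^'n \<Rightarrow> real^'m^'m" where M: "\<And>x w. p (x, w) = w \<bullet> (M x *v w)"
    using q by metis
  define U where "U x = (\<chi> i j. (M x $ i $ j + M x $ j $ i) / 2)" for x
  have ax: "axis i 1 \<bullet> (M x *v axis j 1) = M x $ i $ j" for x i j
    by (simp add: inner_axis' matrix_vector_mult_basis column_def)
  have pol: "U x $ i $ j = (p (x, axis i 1 + axis j 1) - p (x, axis i 1) - p (x, axis j 1)) / 2" for x i j
    by (simp add: M U_def matrix_vector_right_distrib inner_add_left inner_add_right ax)
  have rp: "real_polynomial_function (\<lambda>x. p (x, w))" for w
  proof -
    have "polynomial_function (\<lambda>x::real^'n. (x, 0::real^'m) + (0, w))"
      by (intro polynomial_function_add polynomial_function_const polynomial_function_bounded_linear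
            bounded_linear_Pair bounded_linear_ident bounded_linear_zero)
    from real_polynomial_function_compose[OF this p] show ?thesis by (simp add: o_def)
  qed
  have "polynomial_function U"
    unfolding polynomial_function_mat pol by (intro allI real_polynomial_function_divide real_polynomial_function_diff rp)
  moreover have "transpose (U x) = U x" for x
    by (simp add: U_def transpose_def vec_eq_iff add.commute)
  moreover have "p (x, w) = w \<bullet> (U x *v w)" for x w
  proof -
    have "w \<bullet> (M x *v w) = (\<Sum>i\<in>UNIV. \<Sum>j\<in>UNIV. w $ i * M x $ j $ i * w $ j)"
      unfolding inner_matrix_vector by (subst sum.swap) (simp add: mult_ac)
    moreover have "w $ i * U x $ i $ j * w $ j = (w $ i * M x $ i $ j * w $ j + w $ i * M x $ j $ i * w $ j) / 2" for i j
      by (simp add: U_def algebra_simps add_divide_distrib)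
    then have "w \<bullet> (U x *v w) = ((\<Sum>i\<in>UNIV. \<Sum>j\<in>UNIV. w $ i * M x $ i $ j * w $ j)
        + (\<Sum>i\<in>UNIV. \<Sum>j\<in>UNIV. w $ i * M x $ j $ i * w $ j)) / 2"
      unfolding inner_matrix_vector by (simp only: sum.distrib flip: sum_divide_distrib)
    ultimately have "w \<bullet> (U x *v w) = (w \<bullet> (M x *v w) + w \<bullet> (M x *v w)) / 2"
      by (simp only: inner_matrix_vector)
    then show ?thesis by (simp add: M)
  qed
  ultimately show ?thesis
    unfolding quadratic_in_w_def by (intro CollectI exI[of _ U]) auto
qed

lemma quadratic_in_wE:
  fixes p :: "(real^'n) \<times> (real^'m) \<Rightarrow> real"
  assumes "p \<in> quadratic_in_w"
  obtains U :: "real^'n \<Rightarrow> real^'m^'m" where "polynomial_function U" "\<And>x. transpose (U x) = U x"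
    "\<And>x w. p (x, w) = w \<bullet> (U x *v w)"
  using assms unfolding quadratic_in_w_def by auto

lemma rpf_bilinear_form:
  fixes M :: "'c::euclidean_space \<Rightarrow> real^'m^'n"
  assumes "polynomial_function v" "polynomial_function M" "polynomial_function w"
  shows "real_polynomial_function (\<lambda>z. v z \<bullet> (M z *v w z))"
  unfolding inner_matrix_vector using assms
  by (intro real_polynomial_function_sum rpf_mult)
     (auto simp: polynomial_function_mat polynomial_function_vec real_polynomial_function_eq[symmetric])

lemma polynomial_function_fst: "polynomial_function (fst :: 'a::euclidean_space \<times> 'b::euclidean_space \<Rightarrow> 'a)"
  by (intro polynomial_function_bounded_linear bounded_linear_fst)

lemma polynomial_function_snd: "polynomial_function (snd :: 'a::euclidean_space \<times> 'b::euclidean_space \<Rightarrow> 'b)"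
  by (intro polynomial_function_bounded_linear bounded_linear_snd)

lemma polynomial_function_comp_fst:
  "polynomial_function p \<Longrightarrow> polynomial_function (\<lambda>z::'a::euclidean_space \<times> 'b::euclidean_space. p (fst z))"
  using polynomial_function_compose[OF polynomial_function_fst] by (simp add: o_def)

lemma quadratic_in_w_rpf:
  fixes p :: "(real^'n) \<times> (real^'m) \<Rightarrow> real"
  assumes "p \<in> quadratic_in_w"
  shows "real_polynomial_function p"
proof -
  obtain U :: "real^'n \<Rightarrow> real^'m^'m" where U: "polynomial_function U" "\<And>x w. p (x, w) = w \<bullet> (U x *v w)"
    using quadratic_in_wE[OF assms] by metis
  then have "p = (\<lambda>z. snd z \<bullet> (U (fst z) *v snd z))" by auto
  then show ?thesis
    using rpf_bilinear_form[OF polynomial_function_snd polynomial_function_comp_fst[OF U(1)] polynomial_function_snd]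
    by simp
qed

lemma quadratic_in_w_matrix:
  fixes p :: "(real^'n) \<times> (real^'m) \<Rightarrow> real"
  assumes "p \<in> quadratic_in_w"
  obtains M :: "real^'m^'m" where "\<And>w. p (x, w) = w \<bullet> (M *v w)"
  using quadratic_in_wE[OF assms] by metis

lemma quadratic_in_w_add:
  fixes p q :: "(real^'n) \<times> (real^'m) \<Rightarrow> real"
  assumes "p \<in> quadratic_in_w" "q \<in> quadratic_in_w"
  shows "(\<lambda>z. p z + q z) \<in> quadratic_in_w"
proof (rule quadratic_in_wI)
  show "real_polynomial_function (\<lambda>z. p z + q z)"
    using assms by (intro rpf_add quadratic_in_w_rpf)
  fix x
  obtain M :: "real^'m^'m" where M: "\<And>w. p (x, w) = w \<bullet> (M *v w)"
    using quadratic_in_w_matrix[OF assms(1)] by metis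
  obtain M' :: "real^'m^'m" where M': "\<And>w. q (x, w) = w \<bullet> (M' *v w)"
    using quadratic_in_w_matrix[OF assms(2)] by metis
  show "\<exists>M::real^'m^'m. \<forall>w. p (x, w) + q (x, w) = w \<bullet> (M *v w)"
    by (intro exI[of _ "M + M'"]) (simp add: M M' matrix_vector_mult_add_rdistrib inner_add_right)
qed

lemma quadratic_in_w_mult:
  fixes q :: "(real^'n) \<times> (real^'m) \<Rightarrow> real"
  assumes "real_polynomial_function a" "q \<in> quadratic_in_w"
  shows "(\<lambda>z. a (fst z) * q z) \<in> quadratic_in_w"
proof (rule quadratic_in_wI)
  show "real_polynomial_function (\<lambda>z::(real^'n) \<times> (real^'m). a (fst z) * q z)"
    using assms by (intro rpf_mult quadratic_in_w_rpf rpf_fst)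
  fix x
  obtain M :: "real^'m^'m" where M: "\<And>w. q (x, w) = w \<bullet> (M *v w)"
    using quadratic_in_w_matrix[OF assms(2)] by metis
  show "\<exists>M::real^'m^'m. \<forall>w. a (fst (x, w)) * q (x, w) = w \<bullet> (M *v w)"
    by (intro exI[of _ "a x *\<^sub>R M"])
       (simp add: M scaleR_matrix_vector_assoc[symmetric])
qed

lemma quadratic_in_w_const_mat:
  "(\<lambda>z. snd z \<bullet> (C *v snd z)) \<in> (quadratic_in_w :: ((real^'n) \<times> (real^'m) \<Rightarrow> real) set)"
  by (rule quadratic_in_wI) (auto intro!: rpf_bilinear_form polynomial_function_snd)

lemma quadratic_in_w_zero: "(\<lambda>z. 0) \<in> (quadratic_in_w :: ((real^'n) \<times> (real^'m) \<Rightarrow> real) set)"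
  using quadratic_in_w_const_mat[of 0] by simp

lemma quadratic_in_w_norm: "(\<lambda>z. (norm (snd z))\<^sup>2) \<in> (quadratic_in_w :: ((real^'n) \<times> (real^'m) \<Rightarrow> real) set)"
  using quadratic_in_w_const_mat[of "mat 1"] by (simp add: power2_norm_eq_inner)

lemma quadratic_in_w_sum:
  fixes q :: "'i \<Rightarrow> (real^'n) \<times> (real^'m) \<Rightarrow> real"
  assumes "\<And>i. i \<in> A \<Longrightarrow> q i \<in> quadratic_in_w"
  shows "(\<lambda>z. \<Sum>i\<in>A. q i z) \<in> quadratic_in_w"
  using assms
  by (induction A rule: infinite_finite_induct) (auto intro: quadratic_in_w_zero quadratic_in_w_add)

section \<open>Sums of squares\<close>

lemma sos_finite_sum:
  assumes "finite A" "\<And>a. a \<in> A \<Longrightarrow> real_polynomial_function (q a)"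
  shows "(\<lambda>z. \<Sum>a\<in>A. (q a z)\<^sup>2) \<in> sos"
proof -
  obtain e where e: "bij_betw e {..<card A} A"
    using ex_bij_betw_nat_finite[OF assms(1)] by (auto simp: atLeast0LessThan)
  have "(\<Sum>a\<in>A. (q a z)\<^sup>2) = (\<Sum>i<card A. (q (e i) z)\<^sup>2)" for z
    by (rule sum.reindex_bij_betw[OF e, symmetric])
  moreover have "real_polynomial_function (q (e i))" if "i < card A" for i
    using assms(2) e that by (auto simp: bij_betw_def)
  ultimately show ?thesis
    unfolding sos_def by (intro CollectI exI[of _ "card A"] exI[of _ "\<lambda>i. q (e i)"]) auto
qed

lemma sosE:
  assumes "p \<in> sos"
  obtains N :: nat and q where "\<And>i. i < N \<Longrightarrow> real_polynomial_function (q i)" "p = (\<lambda>z. \<Sum>i<N. (q i z)\<^sup>2)"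
  using assms unfolding sos_def by blast

lemma sos_zero: "(\<lambda>z. 0) \<in> sos"
  using sos_finite_sum[of "{}"] by simp

lemma sos_square: "real_polynomial_function q \<Longrightarrow> (\<lambda>z. (q z)\<^sup>2) \<in> sos"
  using sos_finite_sum[of "{()}" "\<lambda>_. q"] by simp

lemma sos_const: "c \<ge> 0 \<Longrightarrow> (\<lambda>z. c) \<in> sos"
  using sos_square[OF rpf_const[of "sqrt c"]] by simp

lemma sos_add:
  assumes "p \<in> sos" "q \<in> sos"
  shows "(\<lambda>z. p z + q z) \<in> sos"
proof -
  obtain N :: nat and P where P: "\<And>i. i < N \<Longrightarrow> real_polynomial_function (P i)" "p = (\<lambda>z. \<Sum>i<N. (P i z)\<^sup>2)"
    using assms(1) by (rule sosE) blast
  obtain M :: nat and Q where Q: "\<And>i. i < M \<Longrightarrow> real_polynomial_function (Q i)" "q = (\<lambda>z. \<Sum>i<M. (Q i z)\<^sup>2)"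
    using assms(2) by (rule sosE) blast
  have "(\<lambda>z. \<Sum>a\<in>{..<N} <+> {..<M}. (case_sum P Q a z)\<^sup>2) \<in> sos"
    by (intro sos_finite_sum) (auto simp: P(1) Q(1))
  then show ?thesis by (simp add: sum.Plus P(2) Q(2))
qed

lemma sos_mult:
  assumes "p \<in> sos" "q \<in> sos"
  shows "(\<lambda>z. p z * q z) \<in> sos"
proof -
  obtain N :: nat and P where P: "\<And>i. i < N \<Longrightarrow> real_polynomial_function (P i)" "p = (\<lambda>z. \<Sum>i<N. (P i z)\<^sup>2)"
    using assms(1) by (rule sosE) blast
  obtain M :: nat and Q where Q: "\<And>i. i < M \<Longrightarrow> real_polynomial_function (Q i)" "q = (\<lambda>z. \<Sum>i<M. (Q i z)\<^sup>2)"
    using assms(2) by (rule sosE) blast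
  have "(\<lambda>z. \<Sum>a\<in>{..<N} \<times> {..<M}. (P (fst a) z * Q (snd a) z)\<^sup>2) \<in> sos"
    by (intro sos_finite_sum rpf_mult) (auto simp: P(1) Q(1))
  then show ?thesis by (simp add: P(2) Q(2) sum_product sum.cartesian_product power_mult_distrib split_def)
qed

lemma sos_sum:
  assumes "\<And>i. i \<in> A \<Longrightarrow> q i \<in> sos"
  shows "(\<lambda>z. \<Sum>i\<in>A. q i z) \<in> sos"
  using assms
  by (induction A rule: infinite_finite_induct) (auto intro: sos_zero sos_add)

lemma sos_rpf:
  assumes "p \<in> sos"
  shows "real_polynomial_function p"
proof -
  obtain N :: nat and P where P: "\<And>i. i < N \<Longrightarrow> real_polynomial_function (P i)" "p = (\<lambda>z. \<Sum>i<N. (P i z)\<^sup>2)"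
    using assms by (rule sosE) blast
  then show ?thesis by (auto intro!: real_polynomial_function_sum real_polynomial_function_power)
qed

lemma sos_nonneg:
  assumes "p \<in> sos"
  shows "p z \<ge> 0"
proof -
  obtain N :: nat and P where "p = (\<lambda>z. \<Sum>i<N. (P i z)\<^sup>2)"
    using assms by (rule sosE) blast
  then show ?thesis by (simp add: sum_nonneg)
qed

lemma sos_fst:
  assumes "p \<in> sos"
  shows "(\<lambda>z. p (fst z)) \<in> sos"
proof -
  obtain N :: nat and P where P: "\<And>i. i < N \<Longrightarrow> real_polynomial_function (P i)" "p = (\<lambda>z. \<Sum>i<N. (P i z)\<^sup>2)"
    using assms by (rule sosE) blast
  show ?thesis unfolding P(2) by (intro sos_finite_sum) (auto intro!: rpf_fst P(1))
qed

text \<open>Completing the square along the basis vectors one at a time.\<close>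
lemma psd_sum_squares_aux:
  fixes F :: "'a::euclidean_space \<Rightarrow> 'a"
  assumes "linear F" "\<And>u v. u \<bullet> F v = F u \<bullet> v" "\<And>u. u \<bullet> F u \<ge> 0"
    "A \<subseteq> Basis" "\<And>b. b \<in> Basis - A \<Longrightarrow> F b = 0"
  shows "\<exists>(N::nat) v. \<forall>w. w \<bullet> F w = (\<Sum>l<N. (v l \<bullet> w)\<^sup>2)"
proof -
  have "finite A" using assms(4) by (rule finite_subset) simp
  then show ?thesis
    using assms
  proof (induction A arbitrary: F rule: finite_induct)
    case empty
    have "F w = 0" for w
    proof -
      have "F w = F (\<Sum>b\<in>Basis. (w \<bullet> b) *\<^sub>R b)" by (simp add: euclidean_representation)
      also have "\<dots> = (\<Sum>b\<in>Basis. (w \<bullet> b) *\<^sub>R F b)"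
        using empty.prems(1) by (simp add: linear_sum linear_cmul)
      also have "\<dots> = 0" using empty.prems(5) by simp
      finally show ?thesis .
    qed
    then show ?case by (intro exI[of _ 0]) simp
  next
    case (insert b A)
    interpret F: linear F by fact
    show ?case
    proof (cases "b \<bullet> F b = 0")
      case True
      \<comment> \<open>A semidefinite form vanishing at \<open>b\<close> has \<open>b\<close> in
        its kernel: otherwise a small step \<open>s\<close> from \<open>b\<close> against
        \<open>F b\<close> would make the form negative, the decrease being linear and the increase
        quadratic in \<open>s\<close>.\<close>
      have "F b = 0"
      proof (rule ccontr)
        assume nz: "F b \<noteq> 0"
        define v where "v = F b"
        define K where "K = v \<bullet> F v"
        have K: "K \<ge> 0" using insert.prems(3) by (simp add: K_def)
        have vv: "v \<bullet> v > 0" using nz by (simp add: v_def)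
        have "(b - s *\<^sub>R v) \<bullet> F (b - s *\<^sub>R v) = - 2 * s * (v \<bullet> v) + s\<^sup>2 * K" for s
          using insert.prems(2)[of b v] True
          by (simp add: F.diff F.scale inner_diff_left inner_diff_right K_def v_def[symmetric] power2_eq_square inner_commute algebra_simps)
        then have *: "- 2 * s * (v \<bullet> v) + s\<^sup>2 * K \<ge> 0" for s
          using insert.prems(3)[of "b - s *\<^sub>R v"] by simp
        define s where "s = (v \<bullet> v) / (K + 1)"
        have s: "s > 0" using vv K by (simp add: s_def)
        have "s * K \<le> v \<bullet> v" using vv K by (simp add: s_def field_simps)
        then have "s * (s * K) \<le> s * (v \<bullet> v)" using s by (intro mult_left_mono) auto
        moreover have "s * (v \<bullet> v) > 0" using s vv by simp
        ultimately show False using *[of s] by (simp add: power2_eq_square)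
      qed
      then show ?thesis using insert.prems by (intro insert.IH) auto
    next
      case False
      define d where "d = b \<bullet> F b"
      have d: "d > 0" using False insert.prems(3)[of b] by (simp add: d_def)
      \<comment> \<open>Schur complement: subtracting the square
        \<open>(F b \<bullet> v)^2 / d\<close> puts \<open>b\<close> in the kernel. The form of
        \<open>G\<close> at \<open>u\<close> is that of \<open>F\<close> at \<open>u - s b\<close>
        with \<open>s = (F b \<bullet> u) / d\<close>, hence still nonnegative.\<close>
      define G where "G v = F v - ((F b \<bullet> v) / d) *\<^sub>R F b" for v
      have "\<exists>(N::nat) v. \<forall>w. w \<bullet> G w = (\<Sum>l<N. (v l \<bullet> w)\<^sup>2)"
      proof (rule insert.IH)
        show "linear G"
          by (rule linearI)
             (simp_all add: G_def F.add F.scale inner_add_right add_divide_distrib scaleR_add_left scaleR_diff_right)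
        show "u \<bullet> G v = G u \<bullet> v" for u v
          using insert.prems(2)[of u v] by (simp add: G_def inner_diff_left inner_diff_right inner_commute)
        show "u \<bullet> G u \<ge> 0" for u
        proof -
          define s where "s = (F b \<bullet> u) / d"
          have ub: "u \<bullet> F b = s * d" "b \<bullet> F u = s * d"
            using d insert.prems(2)[of b u] by (simp_all add: s_def inner_commute)
          have "(u - s *\<^sub>R b) \<bullet> F (u - s *\<^sub>R b) = u \<bullet> F u - s * (s * d)"
            by (simp add: F.diff F.scale inner_diff_left inner_diff_right ub d_def[symmetric] algebra_simps)
          also have "\<dots> = u \<bullet> G u"
            by (simp add: G_def inner_diff_right ub s_def[symmetric])
          finally show ?thesis using insert.prems(3)[of "u - s *\<^sub>R b"] by simp
        qed
        show "A \<subseteq> Basis" using insert.prems by auto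
        show "G c = 0" if "c \<in> Basis - A" for c
        proof (cases "c = b")
          case True
          then show ?thesis using d by (simp add: G_def d_def inner_commute)
        next
          case False
          then have "F c = 0" using insert.prems(5) that by auto
          moreover have "F b \<bullet> c = 0" using insert.prems(2)[of b c] \<open>F c = 0\<close> by simp
          ultimately show ?thesis by (simp add: G_def)
        qed
      qed
      then obtain N :: nat and v where v: "\<And>w. w \<bullet> G w = (\<Sum>l<N. (v l \<bullet> w)\<^sup>2)" by blast
      have "w \<bullet> F w = (\<Sum>l<Suc N. ((v(N := (1 / sqrt d) *\<^sub>R F b)) l \<bullet> w)\<^sup>2)" for w
      proof -
        have "w \<bullet> F w = w \<bullet> G w + (F b \<bullet> w)\<^sup>2 / d"
          by (simp add: G_def inner_diff_right inner_commute power2_eq_square)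
        also have "(F b \<bullet> w)\<^sup>2 / d = (((1 / sqrt d) *\<^sub>R F b) \<bullet> w)\<^sup>2"
          using d by (simp add: power_divide)
        finally show ?thesis by (simp add: v)
      qed
      then show ?thesis by blast
    qed
  qed
qed

lemma psd_sos:
  fixes C :: "real^'m^'m"
  assumes "transpose C = C" "\<And>w. w \<bullet> (C *v w) \<ge> 0"
  shows "(\<lambda>z::(real^'n) \<times> (real^'m). snd z \<bullet> (C *v snd z)) \<in> sos"
proof -
  have "\<exists>(N::nat) v. \<forall>w. w \<bullet> (C *v w) = (\<Sum>l<N. (v l \<bullet> w)\<^sup>2)"
  proof (rule psd_sum_squares_aux[where A = Basis])
    show "u \<bullet> (C *v v) = (C *v u) \<bullet> v" for u v
      by (metis assms(1) dot_lmul_matrix transpose_matrix_vector)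
  qed (use assms(2) in auto)
  then obtain N :: nat and v where v: "\<And>w. w \<bullet> (C *v w) = (\<Sum>l<N. (v l \<bullet> w)\<^sup>2)" by blast
  have "real_polynomial_function (\<lambda>z::(real^'n) \<times> (real^'m). v l \<bullet> snd z)" for l
    by (intro rpf_linear bounded_linear_inner_right_comp bounded_linear_snd)
  then show ?thesis unfolding v by (intro sos_finite_sum) auto
qed

section \<open>A Positivstellensatz for polynomial quadratic forms\<close>

text \<open>The weight turns \<open>u = g i x\<close> into a one-sided penalty:
  \<open>(1 - u) ^ (2 * N) * u\<close> is at most \<open>1 / (2 * N + 1)\<close> for
  \<open>0 \<le> u \<le> 1\<close> and at most \<open>u\<close> for \<open>u < 0\<close>.
  Subtracting it costs almost nothing where the constraint holds and gains at least the violation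
  where it fails. The even exponent makes the weight a square, hence usable as a multiplier.\<close>

lemma compact_certificate:
  fixes \<phi> :: "'a::metric_space \<Rightarrow> real"
  assumes X: "compact X" "continuous_on X \<phi>"
    and g: "\<And>i. i \<in> {1..I} \<Longrightarrow> continuous_on X (g i)" "\<And>i x. i \<in> {1..I} \<Longrightarrow> x \<in> X \<Longrightarrow> g i x \<le> 1"
    and h: "\<And>j. j \<in> {1..J} \<Longrightarrow> continuous_on X (h j)"
    and pos: "\<And>x. x \<in> X \<Longrightarrow> (\<forall>i\<in>{1..I::nat}. g i x \<ge> 0) \<Longrightarrow> (\<forall>j\<in>{1..J::nat}. h j x = 0) \<Longrightarrow> \<phi> x > 0"
  shows "\<exists>c\<ge>0. \<exists>N::nat. \<forall>x\<in>X. \<phi> x - c * (\<Sum>i=1..I. (1 - g i x) ^ (2 * N) * g i x) + c * (\<Sum>j=1..J. (h j x)\<^sup>2) > 0"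
proof -
  define viol where "viol x = (\<Sum>i=1..I. max 0 (- g i x)) + (\<Sum>j=1..J. (h j x)\<^sup>2)" for x
  have vc: "continuous_on X viol"
    unfolding viol_def using g(1) h by (intro continuous_intros) auto
  have v0: "viol x \<ge> 0" for x
    unfolding viol_def by (intro add_nonneg_nonneg sum_nonneg) auto
  have vpos: "viol x > 0" if "x \<in> X" "\<phi> x \<le> 0" for x
  proof (rule ccontr)
    assume "\<not> viol x > 0"
    then have "(\<Sum>i=1..I. max 0 (- g i x)) = 0 \<and> (\<Sum>j=1..J. (h j x)\<^sup>2) = 0"
    proof -
      have "(\<Sum>i=1..I. max 0 (- g i x)) \<ge> 0" "(\<Sum>j=1..J. (h j x)\<^sup>2) \<ge> 0" by (intro sum_nonneg; simp)+
      with \<open>\<not> viol x > 0\<close> show ?thesis unfolding viol_def by linarith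
    qed
    then have "(\<forall>i\<in>{1..I}. max 0 (- g i x) = 0) \<and> (\<forall>j\<in>{1..J}. (h j x)\<^sup>2 = 0)"
      by (simp add: sum_nonneg_eq_0_iff)
    then have "(\<forall>i\<in>{1..I}. g i x \<ge> 0)" "(\<forall>j\<in>{1..J}. h j x = 0)"
      by (auto simp: max_def split: if_splits)
    from pos[OF that(1) this] that(2) show False by simp
  qed
  obtain a where a: "a > 0" "\<And>x. x \<in> X \<Longrightarrow> max (\<phi> x) (viol x) \<ge> a"
  proof (cases "X = {}")
    case True
    then show ?thesis using that[of 1] by simp
  next
    case False
    have "continuous_on X (\<lambda>x. max (\<phi> x) (viol x))"
      using X vc by (intro continuous_intros)
    from continuous_attains_inf[OF X(1) False this] obtain x0
      where x0: "x0 \<in> X" "\<And>x. x \<in> X \<Longrightarrow> max (\<phi> x0) (viol x0) \<le> max (\<phi> x) (viol x)" by blast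
    have "max (\<phi> x0) (viol x0) > 0" using vpos[OF x0(1)] by (cases "\<phi> x0 \<le> 0") auto
    from that[OF this x0(2)] show ?thesis .
  qed
  obtain L where L: "L > 0" "\<And>x. x \<in> X \<Longrightarrow> \<bar>\<phi> x\<bar> \<le> L"
    using compact_imp_bounded[OF compact_continuous_image[OF X(2) X(1)]]
    unfolding bounded_pos by auto
  \<comment> \<open>Since \<open>c * a = L + a\<close>, a violation of size \<open>a\<close>
    outweighs both the worst value \<open>- L\<close> of \<open>\<phi>\<close> and the loss
    \<open>a\<close> granted to the penalties of satisfied constraints.\<close>
  define c where "c = (L + a) / a"
  have c: "c > 0" "c * a = L + a" using a(1) L(1) by (auto simp: c_def)
  obtain N :: nat where N: "c * real I / a < real N" using reals_Archimedean2 by blast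
  have small: "c * real I / (2 * real N + 1) < a"
  proof -
    have "c * real I < a * real N" using N a(1) by (simp add: pos_divide_less_eq mult.commute)
    also have "\<dots> \<le> a * (2 * real N + 1)" using a(1) by (intro mult_left_mono) auto
    finally show ?thesis by (simp add: pos_divide_less_eq add_pos_nonneg)
  qed
  have "\<phi> x - c * (\<Sum>i=1..I. (1 - g i x) ^ (2 * N) * g i x) + c * (\<Sum>j=1..J. (h j x)\<^sup>2) > 0" if x: "x \<in> X" for x
  proof -
    have bnd: "(1 - u) ^ (2 * N) * u \<le> 1 / (2 * real N + 1) - max 0 (- u)" if "u \<le> 1" for u :: real
    proof (cases "u \<ge> 0")
      case True
      have "(1 - u) ^ (2 * N) * u \<le> 1 / (2 * real N + 1)"
      proof -
        let ?n = "2 * N + 1"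
        \<comment> \<open>The left side is the Bernstein polynomial of degree
          \<open>2 * N + 1\<close> and index 1, one nonnegative term of a partition of
          unity.\<close>
        have "(2 * real N + 1) * u * (1 - u) ^ (2 * N) \<le> 1"
        proof -
          have "(\<Sum>k\<le>?n. Bernstein ?n k u) = 1" by simp
          moreover have "Bernstein ?n 1 u \<le> (\<Sum>k\<le>?n. Bernstein ?n k u)"
            using True that by (intro member_le_sum) (auto intro: Bernstein_nonneg)
          ultimately have "Bernstein ?n 1 u \<le> 1" by linarith
          then show ?thesis by (simp add: Bernstein_def add.commute)
        qed
        then show ?thesis by (simp add: field_simps)
      qed
      then show ?thesis using True by simp
    next
      case False
      then have "(1 - u) ^ (2 * N) \<ge> 1" by (intro one_le_power) auto
      then have "(1 - u) ^ (2 * N) * u \<le> 1 * u" using False by (intro mult_right_mono_neg) auto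
      moreover have "1 / (2 * real N + 1) \<ge> 0" by simp
      ultimately show ?thesis using False by linarith
    qed
    have "(\<Sum>i=1..I. (1 - g i x) ^ (2 * N) * g i x) \<le> (\<Sum>i=1..I. 1 / (2 * real N + 1) - max 0 (- g i x))"
      using g(2) x by (intro sum_mono bnd) auto
    also have "\<dots> = real I / (2 * real N + 1) - (\<Sum>i=1..I. max 0 (- g i x))"
      by (simp add: sum_subtractf)
    finally have "c * (\<Sum>i=1..I. (1 - g i x) ^ (2 * N) * g i x) - c * (\<Sum>j=1..J. (h j x)\<^sup>2)
        \<le> c * (real I / (2 * real N + 1) - viol x)"
      using c(1) unfolding viol_def right_diff_distrib[symmetric] by (intro mult_left_mono) auto
    also have "\<dots> = c * real I / (2 * real N + 1) - c * viol x"
      by (simp add: right_diff_distrib)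
    finally have main: "\<phi> x - c * (\<Sum>i=1..I. (1 - g i x) ^ (2 * N) * g i x) + c * (\<Sum>j=1..J. (h j x)\<^sup>2)
       > \<phi> x - a + c * viol x"
      using small by linarith
    have "\<phi> x - a + c * viol x \<ge> 0"
    proof (cases "\<phi> x \<ge> a")
      case True
      then show ?thesis using c(1) v0[of x] by simp
    next
      case False
      then have "viol x \<ge> a" using a(2)[OF x] by auto
      then have "c * viol x \<ge> c * a" using c(1) by simp
      then show ?thesis using c(2) L(2)[OF x] by linarith
    qed
    with main show ?thesis by linarith
  qed
  then show ?thesis using c(1) by (intro exI[of _ c] conjI exI[of _ N]) auto
qed

section \<open>The preordering of a ball\<close>

definition preorder_of :: "('a::real_normed_vector \<Rightarrow> real) \<Rightarrow> ('a \<Rightarrow> real) set" where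
  "preorder_of b = {p. \<exists>s\<in>sos. \<exists>t\<in>sos. p = (\<lambda>x. s x + t x * b x)}"

lemma preorder_ofI: "s \<in> sos \<Longrightarrow> t \<in> sos \<Longrightarrow> (\<lambda>x. s x + t x * b x) \<in> preorder_of b"
  unfolding preorder_of_def by auto

text \<open>The product of the two terms containing \<open>b\<close> moves into the sum of squares,
  because \<open>b^2\<close> is itself a square.\<close>

lemma preorder_of_mult:
  assumes "p \<in> preorder_of b" "q \<in> preorder_of b" "real_polynomial_function b"
  shows "(\<lambda>x. p x * q x) \<in> preorder_of b"
proof -
  obtain s t where st: "s \<in> sos" "t \<in> sos" "p = (\<lambda>x. s x + t x * b x)"
    using assms(1) unfolding preorder_of_def by auto
  obtain s' t' where st': "s' \<in> sos" "t' \<in> sos" "q = (\<lambda>x. s' x + t' x * b x)"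
    using assms(2) unfolding preorder_of_def by auto
  have "(\<lambda>x. (s x * s' x + (t x * t' x) * (b x)\<^sup>2) + (s x * t' x + t x * s' x) * b x) \<in> preorder_of b"
    by (intro preorder_ofI sos_add sos_mult sos_square st st' assms)
  then show ?thesis
    by (simp add: st st' algebra_simps power2_eq_square)
qed

lemma preorder_of_const: "c \<ge> 0 \<Longrightarrow> (\<lambda>x. c) \<in> preorder_of b"
  using preorder_ofI[OF sos_const sos_zero, of c b] by simp

lemma preorder_of_prod:
  assumes "\<And>i. i \<in> A \<Longrightarrow> q i \<in> preorder_of b" "real_polynomial_function b"
  shows "(\<lambda>x. \<Prod>i\<in>A. q i x) \<in> preorder_of b"
  using assms(1)
  by (induction A rule: infinite_finite_induct) (auto intro!: preorder_of_const preorder_of_mult assms(2))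

lemma preorder_of_power:
  assumes "q \<in> preorder_of b" "real_polynomial_function b"
  shows "(\<lambda>x. q x ^ n) \<in> preorder_of b"
  using preorder_of_prod[of "{..<n}" "\<lambda>_. q" b] assms by simp

text \<open>The squares \<open>(r + \<epsilon> x_e)^2\<close> and \<open>x_b^2\<close> for the other
  coordinates, added to \<open>r^2 - |x|^2\<close>, give \<open>2 r (r + \<epsilon> x_e)\<close>.
  Thus the ball constraint certifies the faces of the cube around it.\<close>

lemma preorder_ball_coord:
  fixes e :: "'a::euclidean_space"
  assumes r: "r > 0" and e: "e \<in> Basis" and sg: "\<epsilon> = 1 \<or> \<epsilon> = - 1"
  shows "(\<lambda>x. (r + \<epsilon> * (x \<bullet> e)) / (2 * r)) \<in> preorder_of (\<lambda>x. r\<^sup>2 - (norm x)\<^sup>2)"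
proof -
  let ?c = "1 / (4 * r\<^sup>2)"
  have c: "?c \<ge> 0" by simp
  have "(\<lambda>x. ?c * ((r + \<epsilon> * (x \<bullet> e))\<^sup>2 + (\<Sum>b\<in>Basis - {e}. (x \<bullet> b)\<^sup>2)) + ?c * (r\<^sup>2 - (norm x)\<^sup>2))
      \<in> preorder_of (\<lambda>x. r\<^sup>2 - (norm x)\<^sup>2)"
    by (intro preorder_ofI sos_mult sos_add sos_const[OF c] sos_square sos_sum rpf_add rpf_cmult rpf_const rpf_coord)
  moreover have "?c * ((r + \<epsilon> * (x \<bullet> e))\<^sup>2 + (\<Sum>b\<in>Basis - {e}. (x \<bullet> b)\<^sup>2)) + ?c * (r\<^sup>2 - (norm x)\<^sup>2)
      = (r + \<epsilon> * (x \<bullet> e)) / (2 * r)" for x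
  proof -
    have "(norm x)\<^sup>2 = (\<Sum>b\<in>Basis. (x \<bullet> b)\<^sup>2)"
      unfolding power2_norm_eq_inner by (subst euclidean_inner) (simp add: power2_eq_square)
    also have "\<dots> = (x \<bullet> e)\<^sup>2 + (\<Sum>b\<in>Basis - {e}. (x \<bullet> b)\<^sup>2)"
      using e by (subst sum.remove[of _ e]) auto
    finally have nx: "(norm x)\<^sup>2 = (x \<bullet> e)\<^sup>2 + (\<Sum>b\<in>Basis - {e}. (x \<bullet> b)\<^sup>2)" .
    have "\<epsilon>\<^sup>2 = 1" using sg by auto
    then have "(\<epsilon> * (x \<bullet> e))\<^sup>2 = (x \<bullet> e)\<^sup>2" by (simp add: power_mult_distrib)
    then show ?thesis
      unfolding nx using r by (simp add: divide_simps power2_sum) (simp add: algebra_simps power2_eq_square)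
  qed
  ultimately show ?thesis by simp
qed

text \<open>The affine map sends the cube of half side \<open>r\<close>, which contains the ball, to
  the unit cube. There the factors \<open>t\<close> and \<open>1 - t\<close> of a Bernstein
  polynomial are the two functions of \<open>preorder_ball_coord\<close>.\<close>

lemma tensor_bernstein_preorder:
  fixes k :: "'a::euclidean_space \<Rightarrow> nat"
  assumes "r > 0"
  shows "(\<lambda>x. tensor_bernstein N k ((1 / (2 * r)) *\<^sub>R (x + r *\<^sub>R (\<Sum>Basis)))) \<in> preorder_of (\<lambda>x. r\<^sup>2 - (norm x)\<^sup>2)"
proof -
  let ?b = "\<lambda>x::'a. r\<^sup>2 - (norm x)\<^sup>2"
  have b: "real_polynomial_function ?b"
    by (intro real_polynomial_function_diff rpf_const rpf_norm_sq)
  have t: "((1 / (2 * r)) *\<^sub>R (x + r *\<^sub>R (\<Sum>Basis))) \<bullet> e = (r + 1 * (x \<bullet> e)) / (2 * r)"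
     "1 - (r + 1 * (x \<bullet> e)) / (2 * r) = (r + (- 1) * (x \<bullet> e)) / (2 * r)" if "e \<in> Basis" for e x :: 'a
  proof -
    have "(\<Sum>Basis) \<bullet> e = 1" using that by (simp add: inner_sum_left inner_Basis)
    then show "((1 / (2 * r)) *\<^sub>R (x + r *\<^sub>R (\<Sum>Basis))) \<bullet> e = (r + 1 * (x \<bullet> e)) / (2 * r)"
      by (simp add: inner_add_left add_ac)
    show "1 - (r + 1 * (x \<bullet> e)) / (2 * r) = (r + (- 1) * (x \<bullet> e)) / (2 * r)"
      using assms by (simp add: field_simps)
  qed
  have "(\<lambda>x::'a. \<Prod>e\<in>Basis. real (N choose k e) * ((r + 1 * (x \<bullet> e)) / (2 * r)) ^ k e * ((r + (- 1) * (x \<bullet> e)) / (2 * r)) ^ (N - k e))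
      \<in> preorder_of ?b"
    by (intro preorder_of_prod preorder_of_mult preorder_of_const preorder_of_power preorder_ball_coord b assms) auto
  moreover have "(\<lambda>x::'a. \<Prod>e\<in>Basis. real (N choose k e) * ((r + 1 * (x \<bullet> e)) / (2 * r)) ^ k e * ((r + (- 1) * (x \<bullet> e)) / (2 * r)) ^ (N - k e))
     = (\<lambda>x. tensor_bernstein N k ((1 / (2 * r)) *\<^sub>R (x + r *\<^sub>R (\<Sum>Basis))))"
    unfolding tensor_bernstein_def Bernstein_def by (intro ext prod.cong refl) (simp only: t)
  ultimately show ?thesis by simp
qed

section \<open>Certificates with multipliers quadratic in w\<close>

definition quad_cert ::
  "nat \<Rightarrow> (nat \<Rightarrow> real^'n \<Rightarrow> real) \<Rightarrow> nat \<Rightarrow> (nat \<Rightarrow> real^'n \<Rightarrow> real) \<Rightarrow> ((real^'n) \<times> (real^'m) \<Rightarrow> real) set" where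
  "quad_cert I g J h =
     quad_module_over quadratic_in_w I (\<lambda>i z. g i (fst z)) J (\<lambda>j z. h j (fst z))"

lemma quad_cert_iff:
  fixes g h :: "nat \<Rightarrow> real^'n \<Rightarrow> real" and p :: "(real^'n) \<times> (real^'m) \<Rightarrow> real"
  shows "p \<in> quad_cert I g J h \<longleftrightarrow>
    (\<exists>\<sigma> \<rho>. (\<forall>i\<in>{0..I}. \<sigma> i \<in> sos \<inter> quadratic_in_w) \<and> (\<forall>j\<in>{1..J}. \<rho> j \<in> quadratic_in_w) \<and>
     p = (\<lambda>z. \<sigma> 0 z + (\<Sum>i=1..I. \<sigma> i z * g i (fst z)) + (\<Sum>j=1..J. \<rho> j z * h j (fst z))))"
  unfolding quad_cert_def quad_module_over_def mem_Collect_eq ..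

lemma quad_certI:
  fixes g h :: "nat \<Rightarrow> real^'n \<Rightarrow> real" and \<sigma> \<rho> :: "nat \<Rightarrow> (real^'n) \<times> (real^'m) \<Rightarrow> real"
  assumes "\<And>i. i \<le> I \<Longrightarrow> \<sigma> i \<in> sos" "\<And>i. i \<le> I \<Longrightarrow> \<sigma> i \<in> quadratic_in_w"
    "\<And>j. j \<in> {1..J} \<Longrightarrow> \<rho> j \<in> quadratic_in_w"
    "\<And>z. p z = \<sigma> 0 z + (\<Sum>i=1..I. \<sigma> i z * g i (fst z)) + (\<Sum>j=1..J. \<rho> j z * h j (fst z))"
  shows "p \<in> quad_cert I g J h"
  unfolding quad_cert_iff
  by (rule exI[of _ \<sigma>], rule exI[of _ \<rho>]) (use assms in auto)

lemma quad_cert_add: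
  fixes p q :: "(real^'n) \<times> (real^'m) \<Rightarrow> real"
  assumes "p \<in> quad_cert I g J h" "q \<in> quad_cert I g J h"
  shows "(\<lambda>z. p z + q z) \<in> quad_cert I g J h"
proof -
  obtain \<sigma> \<rho> where P: "(\<forall>i\<in>{0..I}. \<sigma> i \<in> sos \<inter> quadratic_in_w) \<and> (\<forall>j\<in>{1..J}. \<rho> j \<in> quadratic_in_w) \<and>
     p = (\<lambda>z. \<sigma> 0 z + (\<Sum>i=1..I. \<sigma> i z * g i (fst z)) + (\<Sum>j=1..J. \<rho> j z * h j (fst z)))"
    using assms(1) unfolding quad_cert_iff by (elim exE) (rule that)
  obtain \<sigma>' \<rho>' where Q: "(\<forall>i\<in>{0..I}. \<sigma>' i \<in> sos \<inter> quadratic_in_w) \<and> (\<forall>j\<in>{1..J}. \<rho>' j \<in> quadratic_in_w) \<and>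
     q = (\<lambda>z. \<sigma>' 0 z + (\<Sum>i=1..I. \<sigma>' i z * g i (fst z)) + (\<Sum>j=1..J. \<rho>' j z * h j (fst z)))"
    using assms(2) unfolding quad_cert_iff by (elim exE) (rule that)
  show ?thesis
  proof (rule quad_certI[of _ "\<lambda>i z. \<sigma> i z + \<sigma>' i z" _ "\<lambda>i z. \<rho> i z + \<rho>' i z"])
    show "(\<lambda>z. \<sigma> i z + \<sigma>' i z) \<in> sos" "(\<lambda>z. \<sigma> i z + \<sigma>' i z) \<in> quadratic_in_w" if "i \<le> I" for i
      using P Q that by (auto intro!: sos_add quadratic_in_w_add)
    show "(\<lambda>z. \<rho> i z + \<rho>' i z) \<in> quadratic_in_w" if "i \<in> {1..J}" for i
      using P Q that by (auto intro!: quadratic_in_w_add)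
    fix z
    have "p z = \<sigma> 0 z + (\<Sum>i=1..I. \<sigma> i z * g i (fst z)) + (\<Sum>j=1..J. \<rho> j z * h j (fst z))" using P by simp
    moreover have "q z = \<sigma>' 0 z + (\<Sum>i=1..I. \<sigma>' i z * g i (fst z)) + (\<Sum>j=1..J. \<rho>' j z * h j (fst z))" using Q by simp
    ultimately show "p z + q z = \<sigma> 0 z + \<sigma>' 0 z + (\<Sum>i=1..I. (\<sigma> i z + \<sigma>' i z) * g i (fst z))
        + (\<Sum>j=1..J. (\<rho> j z + \<rho>' j z) * h j (fst z))"
      by (simp only: distrib_right sum.distrib add_ac)
  qed
qed

lemma quad_cert_sos:
  fixes s :: "(real^'n) \<times> (real^'m) \<Rightarrow> real"
  assumes "s \<in> sos" "s \<in> quadratic_in_w"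
  shows "s \<in> quad_cert I g J h"
  by (rule quad_certI[of _ "\<lambda>i. if i = 0 then s else (\<lambda>z. 0)" _ "\<lambda>j z. 0"])
     (use assms in \<open>auto intro: sos_zero quadratic_in_w_zero\<close>)

lemma quad_cert_sum:
  fixes q :: "'i \<Rightarrow> (real^'n) \<times> (real^'m) \<Rightarrow> real"
  assumes "\<And>i. i \<in> A \<Longrightarrow> q i \<in> quad_cert I g J h"
  shows "(\<lambda>z. \<Sum>i\<in>A. q i z) \<in> quad_cert I g J h"
  using assms
  by (induction A rule: infinite_finite_induct)
     (auto intro: quad_cert_add quad_cert_sos sos_zero quadratic_in_w_zero)

text \<open>The multipliers of \<open>b\<close> depend on \<open>x\<close> only, so multiplying the
  whole identity by \<open>s\<close> keeps them sums of squares where required and makes them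
  quadratic in \<open>w\<close>. The prescribed form of the multipliers originates here.\<close>

lemma quad_cert_mult:
  fixes s :: "(real^'n) \<times> (real^'m) \<Rightarrow> real"
  assumes s: "s \<in> sos" "s \<in> quadratic_in_w" and b: "b \<in> quad_module I g J h"
  shows "(\<lambda>z. b (fst z) * s z) \<in> quad_cert I g J h"
proof -
  obtain \<tau> \<rho> where "(\<forall>i\<in>{0..I}. \<tau> i \<in> sos \<inter> Collect real_polynomial_function) \<and>
    (\<forall>j\<in>{1..J}. real_polynomial_function (\<rho> j)) \<and>
    b = (\<lambda>z. \<tau> 0 z + (\<Sum>i=1..I. \<tau> i z * g i z) + (\<Sum>j=1..J. \<rho> j z * h j z))"
    using b unfolding quad_module_def quad_module_over_def mem_Collect_eq by (elim exE) (rule that)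
  then have b: "\<forall>i\<in>{0..I}. \<tau> i \<in> sos \<inter> Collect real_polynomial_function"
    "\<forall>j\<in>{1..J}. real_polynomial_function (\<rho> j)"
    "b = (\<lambda>z. \<tau> 0 z + (\<Sum>i=1..I. \<tau> i z * g i z) + (\<Sum>j=1..J. \<rho> j z * h j z))" by blast+
  show ?thesis
  proof (rule quad_certI[of _ "\<lambda>i z. \<tau> i (fst z) * s z" _ "\<lambda>i z. \<rho> i (fst z) * s z"])
    show "(\<lambda>z. \<tau> i (fst z) * s z) \<in> sos" if "i \<le> I" for i
      using b(1) that by (intro sos_mult s sos_fst) auto
    show "(\<lambda>z. \<tau> i (fst z) * s z) \<in> quadratic_in_w" if "i \<le> I" for i
      using b(1) that by (intro quadratic_in_w_mult s) auto
    show "(\<lambda>z. \<rho> j (fst z) * s z) \<in> quadratic_in_w" if "j \<in> {1..J}" for j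
      using b(2) that by (intro quadratic_in_w_mult s) auto
  qed (simp add: b(3) distrib_left distrib_right sum_distrib_left sum_distrib_right mult_ac)
qed

lemma quad_cert_preorder:
  fixes s :: "(real^'n) \<times> (real^'m) \<Rightarrow> real"
  assumes s: "s \<in> sos" "s \<in> quadratic_in_w" and b: "b \<in> quad_module I g J h" and u: "u \<in> preorder_of b"
  shows "(\<lambda>z. u (fst z) * s z) \<in> quad_cert I g J h"
proof -
  obtain s0 s1 where u: "s0 \<in> sos" "s1 \<in> sos" "u = (\<lambda>x. s0 x + s1 x * b x)"
    using u unfolding preorder_of_def by auto
  have "(\<lambda>z. s0 (fst z) * s z + b (fst z) * (s1 (fst z) * s z)) \<in> quad_cert I g J h"
    by (intro quad_cert_add quad_cert_sos quad_cert_mult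
        sos_mult quadratic_in_w_mult sos_fst sos_rpf u s b)
  then show ?thesis by (simp add: u(3) algebra_simps)
qed

text \<open>Positive definite matrix polynomials on the cube have positive semidefinite Bernstein
  coefficients once the Bernstein degree is large.\<close>
lemma positive_on_cube_certificate:
  fixes p :: "(real^'n) \<times> (real^'m) \<Rightarrow> real"
  assumes p: "p \<in> quadratic_in_w" and r: "r > 0"
    and b: "(\<lambda>x. r\<^sup>2 - (norm x)\<^sup>2) \<in> quad_module I g J h"
    and pos: "\<And>x w. (\<forall>e\<in>Basis. \<bar>x \<bullet> e\<bar> \<le> r) \<Longrightarrow> norm w = 1 \<Longrightarrow> p (x, w) > 0"
  shows "p \<in> quad_cert I g J h"
proof -
  obtain U :: "real^'n \<Rightarrow> real^'m^'m" where U: "polynomial_function U" "\<And>x. transpose (U x) = U x"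
    "\<And>x w. p (x, w) = w \<bullet> (U x *v w)"
    using quadratic_in_wE[OF p] by metis
  define \<phi> where "\<phi> t = (2 * r) *\<^sub>R t - r *\<^sub>R (\<Sum>Basis)" for t :: "real^'n"
  define \<psi> where "\<psi> x = (1 / (2 * r)) *\<^sub>R (x + r *\<^sub>R (\<Sum>Basis))" for x :: "real^'n"
  have \<phi>\<psi>: "\<phi> (\<psi> x) = x" for x
    using r by (simp add: \<phi>_def \<psi>_def)
  define P where "P i j t = U (\<phi> t) $ i $ j" for i j t
  have \<phi>pol: "polynomial_function \<phi>"
    unfolding \<phi>_def by (intro polynomial_function_diff polynomial_function_cmul polynomial_function_id polynomial_function_const)
  have Ppol: "real_polynomial_function (P i j)" for i j
    using real_polynomial_function_compose[OF \<phi>pol, of "\<lambda>x. U x $ i $ j"] U(1)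
    by (simp add: polynomial_function_mat o_def P_def[abs_def])
  have Psym: "P i j = P j i" for i j
  proof
    fix t
    have "U (\<phi> t) $ i $ j = transpose (U (\<phi> t)) $ i $ j" by (simp only: U(2))
    then show "P i j t = P j i t" by (simp add: P_def transpose_def)
  qed
  \<comment> \<open>Choosing the coefficients as a function of the polynomial, not of the indices,
    makes those of \<open>P i j\<close> and \<open>P j i\<close> coincide, so the coefficient
    matrices are symmetric.\<close>
  define cc where "cc q = (SOME c. bernstein_coeffs q c)" for q :: "real^'n \<Rightarrow> real"
  have "bernstein_coeffs q (cc q)" if "real_polynomial_function q" for q
    unfolding cc_def by (rule someI_ex[OF bernstein_coeffs_polynomial[OF that]])
  note cc = this[unfolded bernstein_coeffs_def, THEN conjunct1]
    this[unfolded bernstein_coeffs_def, THEN conjunct2, rule_format]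
  have one: "(\<Sum>Basis) \<bullet> e = 1" if "e \<in> Basis" for e :: "real^'n"
    using that by (simp add: inner_sum_left inner_Basis)
  have cube: "\<bar>\<phi> t \<bullet> e\<bar> \<le> r" if "t \<in> cbox 0 (\<Sum>Basis)" "e \<in> Basis" for t e :: "real^'n"
  proof -
    have t: "0 \<le> t \<bullet> e" "t \<bullet> e \<le> 1" using that one by (auto simp: mem_box)
    have "r * (t \<bullet> e) \<le> r * 1" "0 \<le> r * (t \<bullet> e)" using r t by (auto intro: mult_left_mono)
    then show ?thesis using one[OF that(2)] by (simp add: \<phi>_def inner_diff_left abs_le_iff)
  qed
  obtain e where e: "e > 0" "\<And>t w. t \<in> cbox 0 (\<Sum>Basis) \<Longrightarrow> norm w = 1 \<Longrightarrow> p (\<phi> t, w) \<ge> e"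
  proof -
    let ?K = "cbox 0 (\<Sum>Basis) \<times> sphere (0::real^'m) 1 :: ((real^'n) \<times> (real^'m)) set"
    have K: "compact ?K" by (intro compact_Times compact_cbox) simp
    have "(0, axis undefined 1) \<in> ?K" by (simp add: mem_box one norm_axis_1)
    then have ne: "?K \<noteq> {}" by blast
    have pc: "continuous_on UNIV p"
      using quadratic_in_w_rpf[OF p] continuous_on_polymonial_function[of p]
      by (simp add: real_polynomial_function_eq)
    have "continuous_on ?K (\<lambda>z. p (\<phi> (fst z), snd z))"
      by (intro continuous_on_compose2[OF pc] continuous_intros continuous_on_compose2[OF continuous_on_polymonial_function[OF \<phi>pol, of UNIV]]) auto
    from continuous_attains_inf[OF K ne this] obtain z0 where z0: "z0 \<in> ?K"
      "\<And>z. z \<in> ?K \<Longrightarrow> p (\<phi> (fst z0), snd z0) \<le> p (\<phi> (fst z), snd z)" by blast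
    have z1: "p (\<phi> (fst z0), snd z0) > 0" using z0(1) by (intro pos) (auto intro: cube)
    have "p (\<phi> (fst z0), snd z0) \<le> p (\<phi> t, w)" if "t \<in> cbox 0 (\<Sum>Basis)" "norm w = 1" for t w
      using z0(2)[of "(t, w)"] that by simp
    from that[OF z1 this] show ?thesis .
  qed
  \<comment> \<open>Each matrix entry may be off by \<open>d\<close>. All \<open>CARD('m)^2\<close>
    entries together then change the form by at most \<open>e * |w|^2\<close>, which is its lower
    bound on the cube, so the coefficient matrices stay semidefinite.\<close>
  define d where "d = e / (real CARD('m))\<^sup>2"
  have d: "d > 0" using e by (simp add: d_def)
  have "\<forall>\<^sub>F N in sequentially. \<forall>i\<in>UNIV. \<forall>j\<in>UNIV. (\<forall>x. P i j x = (\<Sum>k\<in>bernstein_index N. cc (P i j) N k * tensor_bernstein N k x))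
     \<and> (\<forall>k\<in>bernstein_index N. \<bar>cc (P i j) N k - P i j (bernstein_node N k)\<bar> < d)"
    by (intro eventually_ball_finite ballI eventually_conj cc Ppol d) auto
  from eventually_happens'[OF sequentially_bot eventually_conj[OF this eventually_gt_at_top[of 0]]]
  obtain N where NN: "(\<forall>i\<in>UNIV. \<forall>j\<in>UNIV. (\<forall>x. P i j x = (\<Sum>k\<in>bernstein_index N. cc (P i j) N k * tensor_bernstein N k x))
     \<and> (\<forall>k\<in>bernstein_index N. \<bar>cc (P i j) N k - P i j (bernstein_node N k)\<bar> < d)) \<and> N > 0"
    by (elim exE) (rule that)
  have "N > 0" and N: "\<And>i j x. P i j x = (\<Sum>k\<in>bernstein_index N. cc (P i j) N k * tensor_bernstein N k x)"
     "\<And>i j k. k\<in>bernstein_index N \<Longrightarrow> \<bar>cc (P i j) N k - P i j (bernstein_node N k)\<bar> < d"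
    using conjunct2[OF NN] conjunct1[OF bspec[OF bspec[OF conjunct1[OF NN] UNIV_I] UNIV_I], rule_format]
      conjunct2[OF bspec[OF bspec[OF conjunct1[OF NN] UNIV_I] UNIV_I], rule_format]
    .
  define C :: "(real^'n \<Rightarrow> nat) \<Rightarrow> real^'m^'m" where "C k = (\<chi> i j. cc (P i j) N k)" for k
  have Csym: "transpose (C k) = C k" for k
  proof -
    have "cc (P j i) N k = cc (P i j) N k" for i j by (rule arg_cong[OF Psym, of "\<lambda>q. cc q N k"])
    then show ?thesis by (simp add: C_def transpose_def)
  qed
  have Cpsd: "w \<bullet> (C k *v w) \<ge> 0" if k: "k \<in> bernstein_index N" for k w
  proof -
    let ?t = "bernstein_node N k :: real^'n"
    have t: "?t \<in> cbox 0 (\<Sum>Basis)"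
      using k \<open>N > 0\<close> by (auto simp: mem_box one PiE_iff)
    have "w \<bullet> (U (\<phi> ?t) *v w) - w \<bullet> (C k *v w) = (\<Sum>i\<in>UNIV. \<Sum>j\<in>UNIV. w $ i * (P i j ?t - cc (P i j) N k) * w $ j)"
      unfolding inner_matrix_vector by (simp add: C_def P_def sum_subtractf[symmetric] left_diff_distrib right_diff_distrib)
    also have "\<dots> \<le> (\<Sum>i\<in>(UNIV::'m set). \<Sum>j\<in>(UNIV::'m set). norm w * d * norm w)"
    proof (intro sum_mono)
      fix i j
      have "w $ i * (P i j ?t - cc (P i j) N k) * w $ j \<le> \<bar>w $ i\<bar> * \<bar>P i j ?t - cc (P i j) N k\<bar> * \<bar>w $ j\<bar>"
        by (metis abs_ge_self abs_mult)
      also have "\<dots> \<le> norm w * d * norm w"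
      proof -
        have "\<bar>P i j ?t - cc (P i j) N k\<bar> \<le> d"
          using N(2)[OF k, of i j] by (simp add: abs_minus_commute)
        then show ?thesis using d by (intro mult_mono component_le_norm_cart mult_nonneg_nonneg) auto
      qed
      finally show "w $ i * (P i j ?t - cc (P i j) N k) * w $ j \<le> norm w * d * norm w" .
    qed
    also have "\<dots> = e * (norm w)\<^sup>2"
      by (simp add: d_def power2_eq_square)
    finally have 1: "w \<bullet> (U (\<phi> ?t) *v w) - w \<bullet> (C k *v w) \<le> e * (norm w)\<^sup>2" .
    have 2: "w \<bullet> (U (\<phi> ?t) *v w) \<ge> e * (norm w)\<^sup>2"
    proof (cases "w = 0")
      case False
      define u where "u = (1 / norm w) *\<^sub>R w"
      have u: "norm u = 1" "w = norm w *\<^sub>R u" using False by (auto simp: u_def)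
      have "w \<bullet> (U (\<phi> ?t) *v w) = (norm w *\<^sub>R u) \<bullet> (U (\<phi> ?t) *v (norm w *\<^sub>R u))"
        using u(2) by simp
      also have "\<dots> = (norm w)\<^sup>2 * p (\<phi> ?t, u)"
        by (simp add: U(3) matrix_vector_mult_scaleR power2_eq_square)
      also have "\<dots> \<ge> (norm w)\<^sup>2 * e" using e(2)[OF t u(1)] by (intro mult_left_mono) auto
      finally show ?thesis by (simp add: mult.commute)
    qed simp
    from 1 2 show ?thesis by linarith
  qed
  \<comment> \<open>The Bernstein expansion of the matrix polynomial: each summand is a polynomial
    in the preordering of the ball times a constant semidefinite form in \<open>w\<close>.\<close>
  have "(\<lambda>z. \<Sum>k\<in>bernstein_index N. tensor_bernstein N k (\<psi> (fst z)) * (snd z \<bullet> (C k *v snd z))) \<in> quad_cert I g J h"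
    unfolding \<psi>_def
    by (intro quad_cert_sum quad_cert_preorder[OF _ _ b tensor_bernstein_preorder[OF r]]
        psd_sos quadratic_in_w_const_mat Csym Cpsd)
  moreover have "(\<Sum>k\<in>bernstein_index N. tensor_bernstein N k (\<psi> (fst z)) * (snd z \<bullet> (C k *v snd z))) = p z" for z
  proof -
    have "p z = snd z \<bullet> (U (\<phi> (\<psi> (fst z))) *v snd z)" using U(3)[of "fst z" "snd z"] by (simp add: \<phi>\<psi>)
    also have "\<dots> = (\<Sum>i\<in>UNIV. \<Sum>j\<in>UNIV. snd z $ i * P i j (\<psi> (fst z)) * snd z $ j)"
      by (simp add: inner_matrix_vector P_def)
    also have "\<dots> = (\<Sum>i\<in>UNIV. \<Sum>j\<in>UNIV. \<Sum>k\<in>bernstein_index N. tensor_bernstein N k (\<psi> (fst z)) * (snd z $ i * C k $ i $ j * snd z $ j))"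
    proof (intro sum.cong refl)
      fix i j
      show "snd z $ i * P i j (\<psi> (fst z)) * snd z $ j
        = (\<Sum>k\<in>bernstein_index N. tensor_bernstein N k (\<psi> (fst z)) * (snd z $ i * C k $ i $ j * snd z $ j))"
        by (subst N(1)) (simp add: sum_distrib_left sum_distrib_right C_def mult_ac)
    qed
    also have "\<dots> = (\<Sum>i\<in>UNIV. \<Sum>k\<in>bernstein_index N. \<Sum>j\<in>UNIV. tensor_bernstein N k (\<psi> (fst z)) * (snd z $ i * C k $ i $ j * snd z $ j))"
      by (intro sum.cong refl sum.swap)
    also have "\<dots> = (\<Sum>k\<in>bernstein_index N. \<Sum>i\<in>UNIV. \<Sum>j\<in>UNIV. tensor_bernstein N k (\<psi> (fst z)) * (snd z $ i * C k $ i $ j * snd z $ j))"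
      by (rule sum.swap)
    also have "\<dots> = (\<Sum>k\<in>bernstein_index N. tensor_bernstein N k (\<psi> (fst z)) * (snd z \<bullet> (C k *v snd z)))"
      by (simp add: inner_matrix_vector sum_distrib_left)
    finally show ?thesis by simp
  qed
  ultimately show ?thesis by simp
qed

lemma quad_module_add_const:
  assumes "p \<in> quad_module I g J h" "c \<ge> 0"
  shows "(\<lambda>x. p x + c) \<in> quad_module I g J h"
proof -
  obtain \<sigma> \<rho> where *: "(\<forall>i\<in>{0..I}. \<sigma> i \<in> sos \<inter> Collect real_polynomial_function) \<and>
    (\<forall>j\<in>{1..J}. \<rho> j \<in> Collect real_polynomial_function) \<and>
    p = (\<lambda>z. \<sigma> 0 z + (\<Sum>i=1..I. \<sigma> i z * g i z) + (\<Sum>j=1..J. \<rho> j z * h j z))"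
    using assms(1) unfolding quad_module_def quad_module_over_def by (elim CollectE exE) (rule that)
  have pz: "p z = \<sigma> 0 z + (\<Sum>i=1..I. \<sigma> i z * g i z) + (\<Sum>j=1..J. \<rho> j z * h j z)" for z
    using * by simp
  have "(\<lambda>z. \<sigma> 0 z + c) \<in> sos" using * assms(2) by (intro sos_add sos_const) auto
  then show ?thesis
    unfolding quad_module_def quad_module_over_def mem_Collect_eq using *
    by (intro exI[of _ "\<sigma>(0 := (\<lambda>z. \<sigma> 0 z + c))"] exI[of _ \<rho>]) (auto simp: pz intro: sos_rpf)
qed

text \<open>Subtracting \<open>c (1 - g\<^sub>i/\<lambda>)\<^sup>2\<^sup>N g\<^sub>i |w|\<^sup>2\<close> and adding \<open>c h\<^sub>j\<^sup>2 |w|\<^sup>2\<close> makes the form positive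
  on a whole cube, so that only the Archimedean constraint has to be dealt with there.\<close>
theorem quadratic_positivstellensatz:
  fixes p :: "(real^'n) \<times> (real^'m) \<Rightarrow> real"
  assumes g: "\<forall>i\<in>{1..I}. real_polynomial_function (g i)"
    and h: "\<forall>j\<in>{1..J}. real_polynomial_function (h j)"
    and arch: "archimedean_spec I g J h"
    and p: "p \<in> quadratic_in_w"
    and pos: "\<And>x w. x \<in> semialg_set I g J h \<Longrightarrow> norm w = 1 \<Longrightarrow> p (x, w) > 0"
  shows "p \<in> quad_cert I g J h"
proof -
  obtain R where R: "(\<lambda>x. R\<^sup>2 - (norm x)\<^sup>2) \<in> quad_module I g J h"
    using arch unfolding archimedean_spec_def by blast
  \<comment> \<open>\<open>R\<close> may be zero or negative. The enlarged radius is positive, and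
    the difference of the squares is a nonnegative constant that the certificate absorbs.\<close>
  define r where "r = \<bar>R\<bar> + 1"
  have r: "r > 0" "r\<^sup>2 - R\<^sup>2 \<ge> 0"
    by (auto simp: r_def power2_sum)
  have b: "(\<lambda>x. r\<^sup>2 - (norm x)\<^sup>2) \<in> quad_module I g J h"
    using quad_module_add_const[OF R r(2)] by simp
  define K :: "(real^'n) set" where "K = cbox (- r *\<^sub>R (\<Sum>Basis)) (r *\<^sub>R (\<Sum>Basis))"
  have K: "x \<in> K \<longleftrightarrow> (\<forall>e\<in>Basis. \<bar>x \<bullet> e\<bar> \<le> r)" for x
    by (auto simp: K_def mem_box inner_sum_left inner_Basis abs_le_iff)
  have cg: "continuous_on UNIV (g i)" if "i \<in> {1..I}" for i
    using g that continuous_on_polymonial_function[of "g i"] by (simp add: real_polynomial_function_eq)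
  have ch: "continuous_on UNIV (h j)" if "j \<in> {1..J}" for j
    using h that continuous_on_polymonial_function[of "h j"] by (simp add: real_polynomial_function_eq)
  \<comment> \<open>Dividing \<open>g i\<close> by \<open>L i\<close> meets the bound 1 demanded by
    \<open>compact_certificate\<close>, and positivity of \<open>L i\<close> preserves the sign of
    the constraint.\<close>
  have "\<forall>i\<in>{1..I}. \<exists>L>0. \<forall>x\<in>K. \<bar>g i x\<bar> \<le> L"
  proof
    fix i assume "i \<in> {1..I}"
    then have "bounded (g i ` K)"
      unfolding K_def using cg by (intro compact_imp_bounded compact_continuous_image compact_cbox) (auto intro: continuous_on_subset)
    then show "\<exists>L>0. \<forall>x\<in>K. \<bar>g i x\<bar> \<le> L"
      unfolding bounded_pos by auto
  qed
  then obtain L where "\<forall>i\<in>{1..I}. L i > 0 \<and> (\<forall>x\<in>K. \<bar>g i x\<bar> \<le> L i)"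
    unfolding bchoice_iff by (rule exE)
  then have L: "L i > 0" "x \<in> K \<Longrightarrow> g i x \<le> L i" if "i \<in> {1..I}" for i x
    using that by (auto simp: abs_le_iff)
  define X :: "((real^'n) \<times> (real^'m)) set" where "X = K \<times> sphere 0 1"
  have pc: "continuous_on UNIV p"
    using quadratic_in_w_rpf[OF p] continuous_on_polymonial_function[of p]
    by (simp add: real_polynomial_function_eq)
  have "\<exists>c\<ge>0. \<exists>N::nat. \<forall>z\<in>X. p z - c * (\<Sum>i=1..I. (1 - g i (fst z) / L i) ^ (2 * N) * (g i (fst z) / L i))
      + c * (\<Sum>j=1..J. (h j (fst z))\<^sup>2) > 0"
  proof (rule compact_certificate)
    show "compact X" unfolding X_def K_def by (intro compact_Times compact_cbox) simp
    show "continuous_on X p" using pc by (rule continuous_on_subset) simp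
    show "continuous_on X (\<lambda>z. g i (fst z) / L i)" if "i \<in> {1..I}" for i
      using L(1)[OF that] by (intro continuous_intros continuous_on_compose2[OF cg[OF that]]) auto
    show "continuous_on X (\<lambda>z. h j (fst z))" if "j \<in> {1..J}" for j
      by (intro continuous_intros continuous_on_compose2[OF ch[OF that]]) auto
    show "g i (fst z) / L i \<le> 1" if "i \<in> {1..I}" "z \<in> X" for i z
      using L[OF that(1)] that(2) by (auto simp: X_def)
    fix z assume z: "z \<in> X" "\<forall>i\<in>{1..I}. g i (fst z) / L i \<ge> 0" "\<forall>j\<in>{1..J}. h j (fst z) = 0"
    have "g i (fst z) \<ge> 0" if "i \<in> {1..I}" for i
      using z(2) that L(1)[OF that] by (auto simp: zero_le_divide_iff)
    then have "p (fst z, snd z) > 0"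
      using z by (intro pos) (auto simp: semialg_set_def X_def)
    then show "p z > 0" by simp
  qed
  then obtain c and N :: nat where c: "c \<ge> 0" and N: "\<And>z. z \<in> X \<Longrightarrow>
      p z - c * (\<Sum>i=1..I. (1 - g i (fst z) / L i) ^ (2 * N) * (g i (fst z) / L i))
      + c * (\<Sum>j=1..J. (h j (fst z))\<^sup>2) > 0" by blast
  \<comment> \<open>The penalty weight with the scaling factor \<open>1 / L i\<close> moved from the
    constraint into the multiplier, so that the certificate contains \<open>g i\<close>
    itself.\<close>
  define a where "a i x = c / L i * ((1 - g i x / L i) ^ N)\<^sup>2" for i x
  have a_sos: "a i \<in> sos" if "i \<in> {1..I}" for i
    unfolding a_def[abs_def] using L(1)[OF that] c g that
    by (intro sos_mult sos_const sos_square real_polynomial_function_power real_polynomial_function_diff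
        real_polynomial_function_divide rpf_const) auto
  define s where "s i z = a i (fst z) * (norm (snd z))\<^sup>2" for i and z :: "(real^'n) \<times> (real^'m)"
  define t where "t j z = (- c * h j (fst z)) * (norm (snd z))\<^sup>2" for j and z :: "(real^'n) \<times> (real^'m)"
  define q where "q z = (\<Sum>i=1..I. s i z * g i (fst z)) + (\<Sum>j=1..J. t j z * h j (fst z))" for z
  have nsos: "(\<lambda>z::(real^'n) \<times> (real^'m). (norm (snd z))\<^sup>2) \<in> sos"
    using psd_sos[of "mat 1 :: real^'m^'m"] by (simp add: power2_norm_eq_inner)
  have s: "s i \<in> sos" "s i \<in> quadratic_in_w" if "i \<in> {1..I}" for i
    unfolding s_def[abs_def]
    by (intro sos_mult sos_fst a_sos that nsos, intro quadratic_in_w_mult sos_rpf a_sos that quadratic_in_w_norm)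
  have t: "t j \<in> quadratic_in_w" if "j \<in> {1..J}" for j
    unfolding t_def[abs_def] using h that by (intro quadratic_in_w_mult[of "\<lambda>x. - c * h j x"] rpf_cmult quadratic_in_w_norm) auto
  have qC: "q \<in> quad_cert I g J h"
    by (rule quad_certI[of _ "\<lambda>i. if i = 0 then (\<lambda>z. 0) else s i" _ t])
       (auto intro!: sos_zero quadratic_in_w_zero s t simp: q_def)
  have qQ: "q \<in> quadratic_in_w"
  proof -
    have "(\<lambda>z. s i z * g i (fst z)) \<in> quadratic_in_w" if "i \<in> {1..I}" for i
      using quadratic_in_w_mult[OF _ s(2)[OF that], of "g i"] g that by (simp add: mult.commute)
    moreover have "(\<lambda>z. t j z * h j (fst z)) \<in> quadratic_in_w" if "j \<in> {1..J}" for j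
      using quadratic_in_w_mult[OF _ t[OF that], of "h j"] h that by (simp add: mult.commute)
    ultimately show ?thesis
      unfolding q_def[abs_def] by (intro quadratic_in_w_add quadratic_in_w_sum)
  qed
  have "(\<lambda>z. p z + (- 1) * q z) \<in> quadratic_in_w"
    using quadratic_in_w_mult[OF rpf_const qQ, of "- 1"] by (intro quadratic_in_w_add p)
  then have "(\<lambda>z. p z - q z) \<in> quadratic_in_w" by simp
  then have "(\<lambda>z. p z - q z) \<in> quad_cert I g J h"
  proof (rule positive_on_cube_certificate[OF _ r(1) b])
    fix x :: "real^'n" and w :: "real^'m" assume x: "\<forall>e\<in>Basis. \<bar>x \<bullet> e\<bar> \<le> r" and w: "norm w = 1"
    then have "(x, w) \<in> X" by (simp add: X_def K)
    from N[OF this]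
    have "p (x, w) - c * (\<Sum>i=1..I. (1 - g i x / L i) ^ (2 * N) * (g i x / L i)) + c * (\<Sum>j=1..J. (h j x)\<^sup>2) > 0"
      by simp
    moreover have "c * (\<Sum>i=1..I. (1 - g i x / L i) ^ (2 * N) * (g i x / L i)) = (\<Sum>i=1..I. s i (x, w) * g i x)"
    proof -
      have "c * ((1 - g i x / L i) ^ (2 * N) * (g i x / L i)) = s i (x, w) * g i x" for i
        by (simp add: s_def a_def w power_even_eq)
      then show ?thesis by (simp add: sum_distrib_left)
    qed
    moreover have "c * (\<Sum>j=1..J. (h j x)\<^sup>2) = - (\<Sum>j=1..J. t j (x, w) * h j x)"
      by (simp add: t_def w sum_distrib_left power2_eq_square mult_ac flip: sum_negf)
    ultimately show "p (x, w) - q (x, w) > 0" by (simp add: q_def)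
  qed
  from quad_cert_add[OF this qC] show ?thesis by simp
qed

section \<open>Common degree bounds for multipliers\<close>

lemma poly_upto_uniform:
  assumes "finite A" "\<And>i. i \<in> A \<Longrightarrow> real_polynomial_function (q i :: 'a::euclidean_space \<Rightarrow> real)"
  shows "\<exists>\<nu>. \<forall>i\<in>A. q i \<in> poly_upto \<nu>"
  using assms
proof (induction A rule: finite_induct)
  case (insert a A)
  then obtain \<nu> where \<nu>: "\<forall>i\<in>A. q i \<in> poly_upto \<nu>" by auto
  obtain \<mu> where "q a \<in> poly_upto \<mu>"
    using insert.prems real_polynomial_function_iff_poly_upto by blast
  then have "\<forall>i\<in>insert a A. q i \<in> poly_upto (max \<mu> \<nu>)"
    using \<nu> poly_upto_mono[of \<mu> "max \<mu> \<nu>"] poly_upto_mono[of \<nu> "max \<mu> \<nu>"] by auto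
  then show ?case ..
qed simp

lemma quad_cert_degree:
  fixes p :: "(real^'n) \<times> (real^'m) \<Rightarrow> real"
  assumes "p \<in> quad_cert I g J h"
  shows "\<exists>\<nu>. p \<in> quad_module_over (poly_upto \<nu> \<inter> quadratic_in_w) I (\<lambda>i z. g i (fst z)) J (\<lambda>j z. h j (fst z))"
proof -
  obtain \<sigma> \<rho> where *: "(\<forall>i\<in>{0..I}. \<sigma> i \<in> sos \<inter> quadratic_in_w) \<and> (\<forall>j\<in>{1..J}. \<rho> j \<in> quadratic_in_w) \<and>
     p = (\<lambda>z. \<sigma> 0 z + (\<Sum>i=1..I. \<sigma> i z * g i (fst z)) + (\<Sum>j=1..J. \<rho> j z * h j (fst z)))"
    using assms(1) unfolding quad_cert_iff by (elim exE) (rule that)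
  obtain \<mu> where \<mu>: "\<forall>i\<in>{0..I}. \<sigma> i \<in> poly_upto \<mu>"
    using poly_upto_uniform[of "{0..I}" \<sigma>] conjunct1[OF *] quadratic_in_w_rpf by blast
  obtain \<mu>' where \<mu>': "\<forall>i\<in>{1..J}. \<rho> i \<in> poly_upto \<mu>'"
    using poly_upto_uniform[of "{1..J}" \<rho>] conjunct1[OF conjunct2[OF *]] quadratic_in_w_rpf by blast
  have "\<forall>i\<in>{0..I}. \<sigma> i \<in> poly_upto (max \<mu> \<mu>')" "\<forall>i\<in>{1..J}. \<rho> i \<in> poly_upto (max \<mu> \<mu>')"
    using \<mu> \<mu>' poly_upto_mono[of \<mu> "max \<mu> \<mu>'"] poly_upto_mono[of \<mu>' "max \<mu> \<mu>'"] by auto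
  then show ?thesis
    unfolding quad_module_over_def mem_Collect_eq using *
    by (intro exI[of _ "max \<mu> \<mu>'"] exI[of _ \<sigma>] exI[of _ \<rho>]) simp
qed

lemma quad_module_over_mono:
  assumes "M \<subseteq> M'"
  shows "quad_module_over M I g J h \<subseteq> quad_module_over M' I g J h"
proof
  fix p assume "p \<in> quad_module_over M I g J h"
  then obtain \<sigma> \<rho> where *: "(\<forall>i\<in>{0..I}. \<sigma> i \<in> sos \<inter> M) \<and> (\<forall>j\<in>{1..J}. \<rho> j \<in> M) \<and>
    p = (\<lambda>z. \<sigma> 0 z + (\<Sum>i=1..I. \<sigma> i z * g i z) + (\<Sum>j=1..J. \<rho> j z * h j z))"
    unfolding quad_module_over_def by (elim CollectE exE) (rule that)
  have "\<forall>i\<in>{0..I}. \<sigma> i \<in> sos \<inter> M'" "\<forall>j\<in>{1..J}. \<rho> j \<in> M'" using * assms by auto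
  then show "p \<in> quad_module_over M' I g J h"
    unfolding quad_module_over_def using conjunct2[OF conjunct2[OF *]]
    by (intro CollectI exI[of _ \<sigma>] exI[of _ \<rho>] conjI)
qed

section \<open>Autonomous differential equations\<close>

text \<open>Neither \<open>c\<close> nor \<open>u\<close> has a prescribed sign: with
  \<open>u = - |y|^2\<close> it bounds solutions from below, and with \<open>c = 0\<close> it is the
  monotonicity of a Lyapunov function.\<close>

lemma gronwall:
  fixes u u' :: "real \<Rightarrow> real"
  assumes der: "\<And>t. t \<in> {0..T} \<Longrightarrow> (u has_real_derivative u' t) (at t within {0..T})"
    and le: "\<And>t. t \<in> {0..T} \<Longrightarrow> u' t \<le> c * u t" and t: "t \<in> {0..T}"
  shows "u t \<le> exp (c * t) * u 0"
proof -
  define v where "v s = exp (- c * s) * u s" for s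
  have vder: "(v has_real_derivative (exp (- c * s) * (u' s - c * u s))) (at s within {0..T})" if "s \<in> {0..T}" for s
    unfolding v_def by (auto intro!: derivative_eq_intros der that simp: algebra_simps)
  have "v t \<le> v 0"
  proof (rule DERIV_nonpos_imp_decreasing_open[of 0 t v])
    show "continuous_on {0..t} v"
    proof -
      have "continuous_on {0..T} v"
        using vder by (intro DERIV_continuous_on) blast
      then show ?thesis using t by (auto intro: continuous_on_subset)
    qed
    fix s assume s: "0 < s" "s < t"
    then have "at s within {0..T} = at s" using t by (intro at_within_Icc_at) auto
    then have "(v has_real_derivative (exp (- c * s) * (u' s - c * u s))) (at s)"
      using vder[of s] s t by simp
    moreover have "exp (- c * s) * (u' s - c * u s) \<le> 0"
      using le[of s] s t by (simp add: mult_le_0_iff)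
    ultimately show "\<exists>y. (v has_real_derivative y) (at s) \<and> y \<le> 0" by blast
  qed (use t in auto)
  then have "exp (c * t) * v t \<le> exp (c * t) * v 0" by simp
  then show ?thesis by (simp add: v_def mult.assoc[symmetric] flip: exp_add)
qed

lemma has_real_derivative_norm_sq:
  assumes "(x has_vector_derivative x') (at t within A)"
  shows "((\<lambda>t. (norm (x t))\<^sup>2) has_real_derivative 2 * (x t \<bullet> x')) (at t within A)"
proof -
  have "((\<lambda>t. x t \<bullet> x t) has_derivative (\<lambda>h. x t \<bullet> (h *\<^sub>R x') + (h *\<^sub>R x') \<bullet> x t)) (at t within A)"
    using assms unfolding has_vector_derivative_def by (intro has_derivative_inner)
  then show ?thesis
    unfolding has_field_derivative_def power2_norm_eq_inner
    by (rule has_derivative_eq_rhs) (auto simp: inner_commute)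
qed

lemma solves_ode_on_subset:
  "solves_ode_on A F x \<Longrightarrow> B \<subseteq> A \<Longrightarrow> solves_ode_on B F x"
  unfolding solves_ode_on_def using has_vector_derivative_within_subset by blast

lemma solves_ode_on_continuous: "solves_ode_on A F x \<Longrightarrow> continuous_on A x"
  unfolding solves_ode_on_def by (intro continuous_on_vector_derivative) auto

lemma ode_dependence:
  fixes z1 z2 :: "real \<Rightarrow> 'a::real_inner"
  assumes z: "solves_ode_on {0..T} (\<lambda>_. G) z1" "solves_ode_on {0..T} (\<lambda>_. G) z2"
    and X: "\<And>t. t \<in> {0..T} \<Longrightarrow> z1 t \<in> X" "\<And>t. t \<in> {0..T} \<Longrightarrow> z2 t \<in> X"
    and lip: "\<And>x y. x \<in> X \<Longrightarrow> y \<in> X \<Longrightarrow> norm (G x - G y) \<le> L * norm (x - y)"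
    and t: "t \<in> {0..T}"
  shows "norm (z1 t - z2 t) \<le> exp (L * t) * norm (z1 0 - z2 0)"
proof -
  have "(norm (z1 t - z2 t))\<^sup>2 \<le> exp ((2 * L) * t) * (norm (z1 0 - z2 0))\<^sup>2"
  proof (rule gronwall[OF _ _ t])
    fix s assume s: "s \<in> {0..T}"
    show "((\<lambda>t. (norm (z1 t - z2 t))\<^sup>2) has_real_derivative 2 * ((z1 s - z2 s) \<bullet> (G (z1 s) - G (z2 s)))) (at s within {0..T})"
      using z s unfolding solves_ode_on_def
      by (intro has_real_derivative_norm_sq has_vector_derivative_diff) auto
    have "(z1 s - z2 s) \<bullet> (G (z1 s) - G (z2 s)) \<le> norm (z1 s - z2 s) * norm (G (z1 s) - G (z2 s))"
      by (rule norm_cauchy_schwarz)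
    also have "\<dots> \<le> norm (z1 s - z2 s) * (L * norm (z1 s - z2 s))"
      by (intro mult_left_mono lip X s) auto
    finally show "2 * ((z1 s - z2 s) \<bullet> (G (z1 s) - G (z2 s))) \<le> 2 * L * (norm (z1 s - z2 s))\<^sup>2"
      by (simp add: power2_eq_square mult_ac)
  qed
  also have "exp ((2 * L) * t) = (exp (L * t))\<^sup>2"
    by (simp add: power2_eq_square flip: exp_add)
  finally show ?thesis
    by (rule power2_le_imp_le[OF ord_le_eq_trans]) (simp_all add: power_mult_distrib)
qed

text \<open>Clamping time by \<open>cl\<close> lets the Picard operator act on bounded continuous
  functions on the whole line. They form a complete metric type, on which Banach's theorem applies
  directly with the factor \<open>L * \<tau>\<close>.\<close>

lemma picard_short_time:
  fixes F :: "'a::euclidean_space \<Rightarrow> 'a"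
  assumes lip: "\<And>x y. norm (F x - F y) \<le> L * norm (x - y)" and L: "L \<ge> 0"
    and \<tau>: "\<tau> > 0" "L * \<tau> < 1"
  shows "\<exists>z. solves_ode_on {0..\<tau>} (\<lambda>_. F) z \<and> z 0 = p"
proof -
  have "L-lipschitz_on UNIV F"
    using lip L by (intro lipschitz_onI) (auto simp: dist_norm)
  then have Fc: "continuous_on UNIV F" by (rule lipschitz_on_continuous_on)
  define cl where "cl t = max 0 (min \<tau> t)" for t :: real
  have cl: "cl t \<in> {0..\<tau>}" for t using \<tau> by (auto simp: cl_def)
  have clc: "continuous_on UNIV cl" unfolding cl_def by (intro continuous_intros)
  define \<Phi> where "\<Phi> z t = p + integral {0..cl t} (\<lambda>s. F (z s))" for z :: "real \<Rightarrow> 'a" and t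
  have Fz: "continuous_on A (\<lambda>s. F (apply_bcontfun z s))" for A and z :: "real \<Rightarrow>\<^sub>C 'a"
    by (intro continuous_on_compose2[OF Fc]) auto
  have int: "(\<lambda>s. F (apply_bcontfun z s)) integrable_on {0..cl t}" for t and z :: "real \<Rightarrow>\<^sub>C 'a"
    by (intro integrable_continuous_interval Fz)
  have bc: "\<Phi> (apply_bcontfun z) \<in> bcontfun" for z :: "real \<Rightarrow>\<^sub>C 'a"
  proof -
    have "continuous_on {0..\<tau>} (\<lambda>t. p + integral {0..t} (\<lambda>s. F (apply_bcontfun z s)))"
      by (intro continuous_intros indefinite_integral_continuous_1 integrable_continuous_interval Fz)
    then have c: "continuous_on UNIV (\<Phi> (apply_bcontfun z))"
      unfolding \<Phi>_def using cl by (intro continuous_on_compose2[OF _ clc]) auto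
    have "range (\<Phi> (apply_bcontfun z)) \<subseteq> (\<lambda>t. p + integral {0..t} (\<lambda>s. F (apply_bcontfun z s))) ` {0..\<tau>}"
      using cl by (auto simp: \<Phi>_def)
    moreover have "bounded ((\<lambda>t. p + integral {0..t} (\<lambda>s. F (apply_bcontfun z s))) ` {0..\<tau>})"
      by (intro compact_imp_bounded compact_continuous_image) (fact, simp)
    ultimately have "bounded (range (\<Phi> (apply_bcontfun z)))" by (meson bounded_subset)
    with c show ?thesis by (simp add: bcontfun_def)
  qed
  define P where "P z = Bcontfun (\<Phi> (apply_bcontfun z))" for z
  have P: "apply_bcontfun (P z) = \<Phi> (apply_bcontfun z)" for z
    unfolding P_def by (rule Bcontfun_inverse[OF bc])
  have contr: "dist (P z1) (P z2) \<le> (L * \<tau>) * dist z1 z2" for z1 z2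
  proof (rule dist_bound)
    fix t
    have "dist (P z1 t) (P z2 t) = norm (integral {0..cl t} (\<lambda>s. F (z1 s) - F (z2 s)))"
      by (simp add: P \<Phi>_def dist_norm integral_diff int)
    also have "\<dots> \<le> integral {0..cl t} (\<lambda>s. L * dist z1 z2)"
    proof (rule integral_norm_bound_integral)
      show "(\<lambda>s. F (z1 s) - F (z2 s)) integrable_on {0..cl t}" by (intro integrable_diff int)
      fix s
      have "norm (F (z1 s) - F (z2 s)) \<le> L * dist (z1 s) (z2 s)" using lip by (simp add: dist_norm)
      also have "\<dots> \<le> L * dist z1 z2" using L by (intro mult_left_mono dist_bounded)
      finally show "norm (F (z1 s) - F (z2 s)) \<le> L * dist z1 z2" .
    qed (rule integrable_const_ivl)
    also have "\<dots> = cl t * (L * dist z1 z2)" using cl[of t] by simp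
    also have "\<dots> \<le> \<tau> * (L * dist z1 z2)" using cl[of t] L by (intro mult_right_mono) auto
    finally show "dist (P z1 t) (P z2 t) \<le> L * \<tau> * dist z1 z2" by (simp add: mult_ac)
  qed
  have "\<exists>!z. P z = z"
    by (rule banach_fix_type[of "L * \<tau>"]) (use L \<tau> contr in auto)
  then obtain z where z: "P z = z" by blast
  have zt: "apply_bcontfun z t = p + integral {0..t} (\<lambda>s. F (z s))" if "t \<in> {0..\<tau>}" for t
  proof -
    have "apply_bcontfun z t = \<Phi> (apply_bcontfun z) t" using P[of z] z by simp
    moreover have "cl t = t" using that by (auto simp: cl_def)
    ultimately show ?thesis by (simp add: \<Phi>_def)
  qed
  have "(apply_bcontfun z has_vector_derivative F (z t)) (at t within {0..\<tau>})" if t: "t \<in> {0..\<tau>}" for t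
  proof -
    have "((\<lambda>t. p + integral {0..t} (\<lambda>s. F (z s))) has_vector_derivative F (z t)) (at t within {0..\<tau>})"
      using integral_has_vector_derivative[OF Fz t] by (auto intro!: derivative_eq_intros)
    then show ?thesis
      by (rule has_vector_derivative_transform[OF t, rotated]) (simp add: zt)
  qed
  moreover have "apply_bcontfun z 0 = p" using zt[of 0] \<tau> by simp
  ultimately show ?thesis unfolding solves_ode_on_def by blast
qed

text \<open>Composing \<open>G\<close> with the projection onto the ball makes it globally
  Lipschitz. The solution moves by at most \<open>M * \<tau> \<le> 1\<close> and starts a unit
  inside, so it never leaves the ball and the projection acts as the identity along it. The same
  \<open>\<tau>\<close> works for every such starting point.\<close>

lemma local_existence:
  fixes G :: "'a::euclidean_space \<Rightarrow> 'a"
  assumes lip: "\<And>x y. x \<in> cball 0 \<rho> \<Longrightarrow> y \<in> cball 0 \<rho> \<Longrightarrow> norm (G x - G y) \<le> L * norm (x - y)" and L: "L \<ge> 0"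
    and M: "\<And>x. x \<in> cball 0 \<rho> \<Longrightarrow> norm (G x) \<le> M"
    and \<tau>: "\<tau> > 0" "L * \<tau> < 1" "M * \<tau> \<le> 1" and p: "norm p \<le> \<rho> - 1"
  shows "\<exists>z. solves_ode_on {0..\<tau>} (\<lambda>_. G) z \<and> z 0 = p"
proof -
  have \<rho>: "\<rho> \<ge> 1" using p norm_ge_zero[of p] by linarith
  then have ne: "cball (0::'a) \<rho> \<noteq> {}" by auto
  let ?c = "closest_point (cball (0::'a) \<rho>)"
  have c: "?c x \<in> cball 0 \<rho>" for x by (intro closest_point_in_set ne closed_cball)
  define F where "F x = G (?c x)" for x
  have "norm (F x - F y) \<le> L * norm (x - y)" for x y
  proof -
    have "norm (F x - F y) \<le> L * norm (?c x - ?c y)" unfolding F_def by (intro lip c)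
    also have "\<dots> \<le> L * norm (x - y)"
      using closest_point_lipschitz[OF convex_cball closed_cball ne, of x y] L
      by (intro mult_left_mono) (auto simp: dist_norm)
    finally show ?thesis .
  qed
  from picard_short_time[OF this L \<tau>(1,2), of p] obtain z where z: "solves_ode_on {0..\<tau>} (\<lambda>_. F) z" "z 0 = p"
    by blast
  have "norm (z t) \<le> \<rho>" if t: "t \<in> {0..\<tau>}" for t
  proof -
    have "norm (z t - z 0) \<le> M * norm (t - 0)"
    proof (rule differentiable_bound[of "{0..\<tau>}" z "\<lambda>t h. h *\<^sub>R F (z t)"])
      fix s assume s: "s \<in> {0..\<tau>}"
      then show "(z has_derivative (\<lambda>h. h *\<^sub>R F (z s))) (at s within {0..\<tau>})"
        using z(1) by (auto simp: solves_ode_on_def has_vector_derivative_def)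
      show "onorm (\<lambda>h. h *\<^sub>R F (z s)) \<le> M"
        using M[OF c] by (intro onorm_le) (simp add: F_def mult.commute[of M] mult_left_mono)
    qed (use t \<tau> in auto)
    also have "\<dots> \<le> M * \<tau>"
    proof -
      have "M \<ge> 0" using M[OF c] norm_ge_zero order_trans by blast
      then show ?thesis using t by (intro mult_left_mono) auto
    qed
    finally have "norm (z t - p) \<le> 1" using \<tau>(3) z(2) by simp
    then show ?thesis using p norm_triangle_ineq2[of "z t" p] by linarith
  qed
  then have "F (z t) = G (z t)" if "t \<in> {0..\<tau>}" for t
    unfolding F_def using that by (subst closest_point_self) auto
  then have "solves_ode_on {0..\<tau>} (\<lambda>_. G) z"
    using z(1) by (simp add: solves_ode_on_def)
  with z(2) show ?thesis by blast
qed

text \<open>Pieces of equal length end in \<open>X\<close> again and can be concatenated forever.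
  The delicate point is differentiability at the joints, where two one-sided derivatives are
  merged.\<close>

lemma global_from_local_existence:
  fixes G :: "'a::real_normed_vector \<Rightarrow> 'a"
  assumes \<tau>: "\<tau> > 0"
    and loc: "\<And>p. p \<in> X \<Longrightarrow> \<exists>z. solves_ode_on {0..\<tau>} (\<lambda>_. G) z \<and> z 0 = p \<and> (\<forall>t\<in>{0..\<tau>}. z t \<in> X)"
    and p: "p \<in> X"
  shows "\<exists>z. solves_ode_on {0..} (\<lambda>_. G) z \<and> z 0 = p \<and> (\<forall>t\<ge>0. z t \<in> X)"
proof -
  have "\<forall>p\<in>X. \<exists>z. solves_ode_on {0..\<tau>} (\<lambda>_. G) z \<and> z 0 = p \<and> (\<forall>t\<in>{0..\<tau>}. z t \<in> X)"
    using loc by blast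
  then obtain s where s: "\<And>p. p \<in> X \<Longrightarrow> solves_ode_on {0..\<tau>} (\<lambda>_. G) (s p)"
     "\<And>p. p \<in> X \<Longrightarrow> s p 0 = p" "\<And>p t. p \<in> X \<Longrightarrow> t \<in> {0..\<tau>} \<Longrightarrow> s p t \<in> X"
    unfolding bchoice_iff by blast
  define q where "q k = ((\<lambda>p. s p \<tau>) ^^ k) p" for k
  have q: "q k \<in> X" for k
    by (induction k) (use p s(3) \<tau> in \<open>auto simp: q_def\<close>)
  have qS: "q (Suc k) = s (q k) \<tau>" for k by (simp add: q_def)
  define z where "z t = s (q (nat \<lfloor>t / \<tau>\<rfloor>)) (t - real (nat \<lfloor>t / \<tau>\<rfloor>) * \<tau>)" for t
  define P where "P k = {real k * \<tau> .. real (Suc k) * \<tau>}" for k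
  \<comment> \<open>At the right endpoint the floor already selects piece \<open>k + 1\<close>,
    which starts where piece \<open>k\<close> ends, so both formulas agree there.\<close>
  have zk: "z t = s (q k) (t - real k * \<tau>)" if t: "t \<in> P k" for k t
  proof (cases "t = real (Suc k) * \<tau>")
    case True
    then have "t / \<tau> = real (Suc k)" using \<tau> by simp
    then have e: "nat \<lfloor>t / \<tau>\<rfloor> = Suc k" by (metis floor_of_nat nat_int)
    have "z t = s (q (Suc k)) 0" unfolding z_def e using True by simp
    moreover have "t - real k * \<tau> = \<tau>" using True by (simp add: algebra_simps)
    ultimately show ?thesis using s(2)[OF q[of "Suc k"]] qS[of k] by simp
  next
    case False
    then have "real k \<le> t / \<tau>" "t / \<tau> < real k + 1"
      using t \<tau> by (auto simp: P_def field_simps)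
    then have "\<lfloor>t / \<tau>\<rfloor> = int k" by (simp add: floor_eq_iff)
    then show ?thesis by (simp add: z_def)
  qed
  have zX: "z t \<in> X" if "t \<in> P k" for k t
    unfolding zk[OF that] using that by (intro s q) (auto simp: P_def algebra_simps)
  have zder: "(z has_vector_derivative G (z t)) (at t within P k)" if t: "t \<in> P k" for k t
  proof -
    let ?t = "t - real k * \<tau>"
    have t': "?t \<in> {0..\<tau>}" using t by (auto simp: P_def algebra_simps)
    have "(s (q k) has_vector_derivative G (s (q k) ?t)) (at ?t within {0..\<tau>})"
      using s(1)[OF q] t' by (auto simp: solves_ode_on_def)
    moreover have "(\<lambda>t. t - real k * \<tau>) ` P k \<subseteq> {0..\<tau>}" by (auto simp: P_def algebra_simps)
    ultimately have "(s (q k) has_vector_derivative G (s (q k) ?t)) (at ?t within (\<lambda>t. t - real k * \<tau>) ` P k)"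
      by (rule has_vector_derivative_within_subset)
    moreover have "((\<lambda>t. t - real k * \<tau>) has_vector_derivative 1) (at t within P k)"
      by (auto intro!: derivative_eq_intros)
    ultimately have "((s (q k) \<circ> (\<lambda>t. t - real k * \<tau>)) has_vector_derivative 1 *\<^sub>R G (s (q k) ?t)) (at t within P k)"
      by (intro vector_diff_chain_within)
    then have "((\<lambda>t. s (q k) (t - real k * \<tau>)) has_vector_derivative G (z t)) (at t within P k)"
      by (simp add: o_def zk[OF t])
    then show ?thesis
      by (rule has_vector_derivative_transform[OF t, rotated]) (simp add: zk)
  qed
  have cover: "\<exists>k. t \<in> P k" if "t \<ge> 0" for t
  proof -
    define k where "k = nat \<lfloor>t / \<tau>\<rfloor>"
    have "0 \<le> t / \<tau>" using that \<tau> by simp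
    then have "real k \<le> t / \<tau>" "t / \<tau> \<le> real k + 1" unfolding k_def by linarith+
    then have "t \<in> P k" using \<tau> by (simp add: P_def field_simps)
    then show ?thesis ..
  qed
  have "(z has_vector_derivative G (z t)) (at t within {0..})" if t: "t \<ge> 0" for t
  proof -
    define k where "k = nat \<lfloor>t / \<tau>\<rfloor>"
    have "0 \<le> t / \<tau>" using that \<tau> by simp
    then have "real k \<le> t / \<tau>" "t / \<tau> < real k + 1" unfolding k_def by linarith+
    then have k: "real k * \<tau> \<le> t" "t < real (Suc k) * \<tau>" using \<tau> by (simp_all add: field_simps)
    \<comment> \<open>The piece to the left of \<open>t\<close>. For \<open>k = 0\<close> truncated
      subtraction returns \<open>P 0\<close>, and the union with \<open>P k\<close> is still a
      neighbourhood of \<open>t\<close> relative to \<open>{0..}\<close>.\<close>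
    define j where "j = k - 1"
    have j: "(z has_vector_derivative G (z t)) (at t within P j)"
    proof (cases "t \<in> P j")
      \<comment> \<open>Off the closed set \<open>P j\<close> the filter
        \<open>at t within P j\<close> is trivial, so the derivative statement is vacuous.\<close>
      case False
      then have "t \<notin> closure (P j)" by (simp add: P_def)
      then have "at t within P j = bot"
        using closure_mono[of "P j - {t}" "P j"] by (auto simp: at_within_eq_bot_iff)
      then show ?thesis
        by (simp add: has_vector_derivative_def has_derivative_def bounded_linear_scaleR_left)
    qed (rule zder)
    have "(z has_vector_derivative G (z t)) (at t within (P j \<union> P k))"
    proof -
      have "t \<in> P k" using k by (simp add: P_def)
      from zder[OF this] j show ?thesis
        unfolding has_vector_derivative_def has_derivative_within
        by (auto simp: at_within_union intro: filterlim_sup)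
    qed
    moreover have "at t within (P j \<union> P k) = at t within {0..}"
    proof (rule at_within_nhd[of _ "if k = 0 then {..<\<tau>} else {real j * \<tau><..<real (Suc k) * \<tau>}"])
      show "t \<in> (if k = 0 then {..<\<tau>} else {real j * \<tau><..<real (Suc k) * \<tau>})"
        using k \<tau> by (cases k) (auto simp: j_def algebra_simps)
      show "open (if k = 0 then {..<\<tau>} else {real j * \<tau><..<real (Suc k) * \<tau>})" by simp
      show "(P j \<union> P k) \<inter> (if k = 0 then {..<\<tau>} else {real j * \<tau><..<real (Suc k) * \<tau>}) - {t}
         = {0..} \<inter> (if k = 0 then {..<\<tau>} else {real j * \<tau><..<real (Suc k) * \<tau>}) - {t}"
      proof (cases k)
        case 0
        then show ?thesis using \<tau> by (auto simp: j_def P_def)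
      next
        case (Suc i)
        have "real i * \<tau> \<ge> 0" using \<tau> by simp
        then show ?thesis using Suc by (auto simp: j_def P_def)
      qed
    qed
    ultimately show ?thesis by simp
  qed
  moreover have "z 0 = p" using zk[of 0 0] s(2)[OF p] \<tau> by (simp add: P_def q_def)
  moreover have "z t \<in> X" if "t \<ge> 0" for t using cover[OF that] zX by blast
  ultimately show ?thesis
    unfolding solves_ode_on_def by (intro exI[of _ z]) auto
qed

section \<open>Euler iterates of polynomial vector fields\<close>

lemma rpf_has_derivative:
  fixes p :: "'a::euclidean_space \<Rightarrow> real"
  assumes "real_polynomial_function p"
  shows "\<exists>D. (\<forall>x. (p has_derivative D x) (at x)) \<and> (\<forall>v. real_polynomial_function (\<lambda>x. D x v))"
  using assms
proof induction
  case (linear f)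
  then show ?case
    by (intro exI[of _ "\<lambda>x. f"]) (auto intro: bounded_linear_imp_has_derivative rpf_const)
next
  case (const c)
  show ?case by (intro exI[of _ "\<lambda>x v. 0"]) (auto intro: rpf_const)
next
  case (add p q)
  then obtain D D' where D: "\<forall>x. (p has_derivative D x) (at x)" "\<forall>v. real_polynomial_function (\<lambda>x. D x v)"
    and D': "\<forall>x. (q has_derivative D' x) (at x)" "\<forall>v. real_polynomial_function (\<lambda>x. D' x v)" by blast
  show ?case
    by (rule exI[of _ "\<lambda>x v. D x v + D' x v"]) (use D D' in \<open>auto intro!: has_derivative_add rpf_add\<close>)
next
  case (mult p q)
  then obtain D D' where D: "\<forall>x. (p has_derivative D x) (at x)" "\<forall>v. real_polynomial_function (\<lambda>x. D x v)"
    and D': "\<forall>x. (q has_derivative D' x) (at x)" "\<forall>v. real_polynomial_function (\<lambda>x. D' x v)" by blast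
  show ?case
    by (rule exI[of _ "\<lambda>x v. p x * D' x v + D x v * q x"])
       (use D D' mult.hyps in \<open>auto intro!: has_derivative_mult rpf_add rpf_mult\<close>)
qed

lemma polynomial_has_derivative:
  fixes G :: "'a::euclidean_space \<Rightarrow> 'b::euclidean_space"
  assumes "polynomial_function G"
  obtains D where "\<And>x. (G has_derivative D x) (at x)" "\<And>v. polynomial_function (\<lambda>x. D x v)"
proof -
  have "\<forall>b\<in>Basis. \<exists>D. (\<forall>x. ((\<lambda>x. G x \<bullet> b) has_derivative D x) (at x)) \<and> (\<forall>v. real_polynomial_function (\<lambda>x. D x v))"
    using assms unfolding polynomial_function_iff_Basis_inner by (intro ballI rpf_has_derivative) auto
  then obtain D where D: "\<And>b x. b \<in> Basis \<Longrightarrow> ((\<lambda>x. G x \<bullet> b) has_derivative D b x) (at x)"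
     "\<And>b v. b \<in> Basis \<Longrightarrow> real_polynomial_function (\<lambda>x. D b x v)"
    unfolding bchoice_iff by blast
  define E where "E x v = (\<Sum>b\<in>Basis. D b x v *\<^sub>R b)" for x v
  have Eb: "E x v \<bullet> b = D b x v" if "b \<in> Basis" for x v b
    using that by (simp add: E_def inner_sum_left inner_Basis if_distrib sum.delta cong: if_cong)
  have "(G has_derivative E x) (at x)" for x
    by (subst has_derivative_componentwise_within) (simp add: Eb D(1))
  moreover have "polynomial_function (\<lambda>x. E x v)" for v
    unfolding polynomial_function_iff_Basis_inner by (simp add: Eb D(2))
  ultimately show ?thesis by (rule that)
qed

lemma polynomial_bounded_cball:
  fixes G :: "'a::euclidean_space \<Rightarrow> 'b::euclidean_space"
  assumes "polynomial_function G"
  obtains M where "M > 0" "\<And>x. x \<in> cball 0 \<rho> \<Longrightarrow> norm (G x) \<le> M"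
proof -
  have "bounded (G ` cball 0 \<rho>)"
    by (intro compact_imp_bounded compact_continuous_image continuous_on_polymonial_function assms) auto
  then show ?thesis using that unfolding bounded_pos by auto
qed

lemma linear_norm_le_Basis:
  fixes D :: "'a::euclidean_space \<Rightarrow> 'b::real_normed_vector"
  assumes "linear D" "\<And>b. b \<in> Basis \<Longrightarrow> norm (D b) \<le> K b"
  shows "norm (D v) \<le> (\<Sum>b\<in>Basis. K b) * norm v"
proof -
  have "D v = D (\<Sum>b\<in>Basis. (v \<bullet> b) *\<^sub>R b)" by (simp add: euclidean_representation)
  also have "\<dots> = (\<Sum>b\<in>Basis. (v \<bullet> b) *\<^sub>R D b)" using assms(1) by (simp add: linear_sum linear_cmul)
  also have "norm \<dots> \<le> (\<Sum>b\<in>Basis. norm v * K b)"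
    using Basis_le_norm assms(2) by (intro sum_norm_le) (auto intro!: mult_mono)
  finally show ?thesis by (simp add: sum_distrib_left mult.commute)
qed

lemma polynomial_derivative_bounded_cball:
  fixes G :: "'a::euclidean_space \<Rightarrow> 'b::euclidean_space"
  assumes D: "\<And>x. (G has_derivative D x) (at x)" "\<And>v. polynomial_function (\<lambda>x. D x v)"
  obtains K where "K \<ge> 0" "\<And>x v. x \<in> cball 0 \<rho> \<Longrightarrow> norm (D x v) \<le> K * norm v"
proof -
  have "\<forall>b\<in>Basis. \<exists>M>0. \<forall>x\<in>cball 0 \<rho>. norm (D x b) \<le> M"
  proof
    fix b :: 'a
    obtain M where "M > 0" "\<And>x. x \<in> cball 0 \<rho> \<Longrightarrow> norm (D x b) \<le> M"
      using polynomial_bounded_cball[OF D(2)[of b], of \<rho>] by metis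
    then show "\<exists>M>0. \<forall>x\<in>cball 0 \<rho>. norm (D x b) \<le> M" by blast
  qed
  then obtain K where K: "\<And>b. b \<in> Basis \<Longrightarrow> K b > 0" "\<And>b x. b \<in> Basis \<Longrightarrow> x \<in> cball 0 \<rho> \<Longrightarrow> norm (D x b) \<le> K b"
    unfolding bchoice_iff by blast
  show ?thesis
  proof (rule that[of "\<Sum>b\<in>Basis. K b"])
    show "(\<Sum>b\<in>Basis. K b) \<ge> 0" using K(1) by (intro sum_nonneg) (auto intro: less_imp_le)
    show "norm (D x v) \<le> (\<Sum>b\<in>Basis. K b) * norm v" if "x \<in> cball 0 \<rho>" for x v
      using has_derivative_linear[OF D(1)] K(2) that by (intro linear_norm_le_Basis) auto
  qed
qed

lemma polynomial_lipschitz_cball: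
  fixes G :: "'a::euclidean_space \<Rightarrow> 'b::euclidean_space"
  assumes "polynomial_function G"
  obtains L where "L \<ge> 0" "\<And>x y. x \<in> cball 0 \<rho> \<Longrightarrow> y \<in> cball 0 \<rho> \<Longrightarrow> norm (G x - G y) \<le> L * norm (x - y)"
proof -
  obtain D where D: "\<And>x. (G has_derivative D x) (at x)" "\<And>v. polynomial_function (\<lambda>x. D x v)"
    using polynomial_has_derivative[OF assms] by metis
  obtain K where K: "K \<ge> 0" "\<And>x v. x \<in> cball 0 \<rho> \<Longrightarrow> norm (D x v) \<le> K * norm v"
    using polynomial_derivative_bounded_cball[OF D] by metis
  have "norm (G x - G y) \<le> K * norm (x - y)" if "x \<in> cball 0 \<rho>" "y \<in> cball 0 \<rho>" for x y
    by (rule differentiable_bound[of "cball 0 \<rho>" G D])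
       (use that in \<open>auto intro!: convex_cball has_derivative_at_withinI D(1) onorm_le K(2)\<close>)
  with K(1) show ?thesis by (rule that)
qed

text \<open>The map \<open>u \<mapsto> G u - D x u\<close> has derivative \<open>D u - D x\<close>,
  of order \<open>|u - x|\<close> because \<open>D\<close> applied to a basis vector is polynomial
  and hence Lipschitz. The mean value bound along the segment then gives the quadratic
  remainder.\<close>

lemma polynomial_second_order_cball:
  fixes G :: "'a::euclidean_space \<Rightarrow> 'b::euclidean_space"
  assumes D: "\<And>x. (G has_derivative D x) (at x)" "\<And>v. polynomial_function (\<lambda>x. D x v)"
  obtains C where "C \<ge> 0"
    "\<And>x y. x \<in> cball 0 \<rho> \<Longrightarrow> y \<in> cball 0 \<rho> \<Longrightarrow> norm (G y - G x - D x (y - x)) \<le> C * (norm (y - x))\<^sup>2"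
proof -
  have "\<forall>b\<in>Basis. \<exists>L\<ge>0. \<forall>x\<in>cball 0 \<rho>. \<forall>y\<in>cball 0 \<rho>. norm (D x b - D y b) \<le> L * norm (x - y)"
  proof
    fix b :: 'a
    obtain L where "L \<ge> 0" "\<And>x y. x \<in> cball 0 \<rho> \<Longrightarrow> y \<in> cball 0 \<rho> \<Longrightarrow> norm (D x b - D y b) \<le> L * norm (x - y)"
      using polynomial_lipschitz_cball[OF D(2)[of b], of \<rho>] by metis
    then show "\<exists>L\<ge>0. \<forall>x\<in>cball 0 \<rho>. \<forall>y\<in>cball 0 \<rho>. norm (D x b - D y b) \<le> L * norm (x - y)" by blast
  qed
  then obtain L where L: "\<And>b. b \<in> Basis \<Longrightarrow> L b \<ge> 0"
    "\<And>b x y. b \<in> Basis \<Longrightarrow> x \<in> cball 0 \<rho> \<Longrightarrow> y \<in> cball 0 \<rho> \<Longrightarrow> norm (D x b - D y b) \<le> L b * norm (x - y)"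
    unfolding bchoice_iff by blast
  define C where "C = (\<Sum>b\<in>Basis. L b)"
  have C: "C \<ge> 0" unfolding C_def using L(1) by (intro sum_nonneg)
  have lip: "norm (D x v - D y v) \<le> C * norm (x - y) * norm v" if "x \<in> cball 0 \<rho>" "y \<in> cball 0 \<rho>" for x y v
  proof -
    have "linear (\<lambda>v. D x v - D y v)"
      using has_derivative_linear[OF D(1)] by (intro linear_compose_sub) auto
    then have "norm (D x v - D y v) \<le> (\<Sum>b\<in>Basis. L b * norm (x - y)) * norm v"
      using L(2) that by (intro linear_norm_le_Basis) auto
    then show ?thesis by (simp add: C_def sum_distrib_right)
  qed
  have "norm (G y - G x - D x (y - x)) \<le> C * (norm (y - x))\<^sup>2" if xy: "x \<in> cball 0 \<rho>" "y \<in> cball 0 \<rho>" for x y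
  proof -
    have seg: "closed_segment x y \<subseteq> cball 0 \<rho>"
      by (rule closed_segment_subset[OF xy convex_cball])
    interpret Dx: bounded_linear "D x" using D(1) by (rule has_derivative_bounded_linear)
    have "norm ((G y - D x y) - (G x - D x x)) \<le> (C * norm (y - x)) * norm (y - x)"
    proof (rule differentiable_bound[of "closed_segment x y" "\<lambda>u. G u - D x u" "\<lambda>u v. D u v - D x v"])
      fix u assume u: "u \<in> closed_segment x y"
      show "((\<lambda>u. G u - D x u) has_derivative (\<lambda>v. D u v - D x v)) (at u within closed_segment x y)"
        by (intro has_derivative_diff has_derivative_at_withinI[OF D(1)] bounded_linear_imp_has_derivative Dx.bounded_linear_axioms)
      show "onorm (\<lambda>v. D u v - D x v) \<le> C * norm (y - x)"
      proof (rule onorm_le)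
        fix v
        have "norm (D u v - D x v) \<le> C * norm (u - x) * norm v" using seg u xy by (intro lip) auto
        also have "norm (u - x) \<le> norm (y - x)" using segment_bound(1)[OF u] by (simp add: norm_minus_commute)
        finally show "norm (D u v - D x v) \<le> C * norm (y - x) * norm v"
          using C by (simp add: mult_left_mono mult_right_mono)
      qed
    qed auto
    then show ?thesis by (simp add: Dx.diff power2_eq_square algebra_simps)
  qed
  with C show ?thesis by (rule that)
qed

lemma vector_derivative_norm_bound:
  fixes x :: "real \<Rightarrow> 'a::real_normed_vector"
  assumes "\<And>s. s \<in> {a..b} \<Longrightarrow> (x has_vector_derivative x' s) (at s within {a..b})"
    "\<And>s. s \<in> {a..b} \<Longrightarrow> norm (x' s) \<le> B" "t \<in> {a..b}"
  shows "norm (x t - x a) \<le> B * (t - a)"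
proof -
  have "norm (x t - x a) \<le> B * norm (t - a)"
  proof (rule differentiable_bound[of "{a..b}" x "\<lambda>s h. h *\<^sub>R x' s"])
    show "(x has_derivative (\<lambda>h. h *\<^sub>R x' s)) (at s within {a..b})" if "s \<in> {a..b}" for s
      using assms(1)[OF that] by (simp add: has_vector_derivative_def)
    show "onorm (\<lambda>h. h *\<^sub>R x' s) \<le> B" if "s \<in> {a..b}" for s
      using assms(2)[OF that] by (intro onorm_le) (simp add: mult.commute[of B] mult_left_mono)
  qed (use assms(3) in auto)
  then show ?thesis using assms(3) by simp
qed

text \<open>One step of the error recursion, using
  \<open>1 + \<delta> * L \<le> exp (\<delta> * L)\<close>. It serves both the Euler iterates and
  their derivatives in the direction of the field.\<close>

lemma discrete_gronwall_step:
  fixes e e' :: real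
  assumes "e \<le> real j * \<delta>\<^sup>2 * B * exp (real j * \<delta> * L)" "e' \<le> (1 + \<delta> * L) * e + \<delta>\<^sup>2 * B"
    "\<delta> \<ge> 0" "L \<ge> 0" "B \<ge> 0"
  shows "e' \<le> real (Suc j) * \<delta>\<^sup>2 * B * exp (real (Suc j) * \<delta> * L)"
proof -
  have dL: "\<delta> * L \<ge> 0" using assms by simp
  have "(1 + \<delta> * L) * e \<le> (1 + \<delta> * L) * (real j * \<delta>\<^sup>2 * B * exp (real j * \<delta> * L))"
    using dL assms(1) by (intro mult_left_mono) auto
  also have "\<dots> \<le> exp (\<delta> * L) * (real j * \<delta>\<^sup>2 * B * exp (real j * \<delta> * L))"
    using assms by (intro mult_right_mono) auto
  also have "\<dots> = real j * \<delta>\<^sup>2 * B * exp (real (Suc j) * \<delta> * L)"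
    by (simp add: algebra_simps exp_add)
  finally have 1: "(1 + \<delta> * L) * e \<le> real j * \<delta>\<^sup>2 * B * exp (real (Suc j) * \<delta> * L)" .
  have "\<delta>\<^sup>2 * B * 1 \<le> \<delta>\<^sup>2 * B * exp (real (Suc j) * \<delta> * L)"
    using assms by (intro mult_left_mono) auto
  then show ?thesis using 1 assms(2) by (simp add: algebra_simps)
qed

lemma discrete_gronwall_bound:
  assumes "real j * \<delta> \<le> T" "\<delta> \<ge> 0" "L \<ge> 0" "B \<ge> 0"
  shows "real j * \<delta>\<^sup>2 * B * exp (real j * \<delta> * L) \<le> T * B * exp (T * L) * \<delta>"
proof -
  have "0 \<le> real j * \<delta>" using assms(2) by simp
  then have "0 \<le> T" using assms(1) by linarith
  then have "(real j * \<delta>) * (B * exp (real j * \<delta> * L)) \<le> T * (B * exp (T * L))"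
    using assms by (intro mult_mono) (auto intro!: mult_right_mono mult_left_mono)
  then have "(real j * \<delta>) * (B * exp (real j * \<delta> * L)) * \<delta> \<le> T * (B * exp (T * L)) * \<delta>"
    using assms(2) by (intro mult_right_mono) auto
  then show ?thesis by (simp add: power2_eq_square mult_ac)
qed

definition euler_step :: "('a::real_vector \<Rightarrow> 'a) \<Rightarrow> real \<Rightarrow> 'a \<Rightarrow> 'a" where
  "euler_step G \<delta> z = z + \<delta> *\<^sub>R G z"

text \<open>The bounds \<open>L\<close> and \<open>M\<close> hold only on the ball of radius
  \<open>\<rho>\<close>, so the iterates must be kept inside: the exact solution stays a unit away
  from the boundary, and the step condition keeps the accumulated error at most 1. As
  \<open>C\<close> does not depend on the solution, one step size serves all initial points.\<close>

lemma euler_convergence: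
  fixes G :: "'a::euclidean_space \<Rightarrow> 'a"
  assumes G: "polynomial_function G" and T: "T > 0"
  obtains C where "C \<ge> 0"
    "\<And>m z j. m > 0 \<Longrightarrow> C * (T / real m) \<le> 1 \<Longrightarrow> j \<le> m \<Longrightarrow> solves_ode_on {0..T} (\<lambda>_. G) z \<Longrightarrow>
      (\<And>t. t \<in> {0..T} \<Longrightarrow> norm (z t) \<le> \<rho> - 1) \<Longrightarrow>
      norm ((euler_step G (T / real m) ^^ j) (z 0) - z (real j * (T / real m))) \<le> C * (T / real m)"
proof -
  obtain L where L: "L \<ge> 0" "\<And>x y. x \<in> cball 0 \<rho> \<Longrightarrow> y \<in> cball 0 \<rho> \<Longrightarrow> norm (G x - G y) \<le> L * norm (x - y)"
    using polynomial_lipschitz_cball[OF G] by metis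
  obtain M where M: "M > 0" "\<And>x. x \<in> cball 0 \<rho> \<Longrightarrow> norm (G x) \<le> M"
    using polynomial_bounded_cball[OF G] by metis
  define C where "C = T * (L * M) * exp (T * L)"
  have C: "C \<ge> 0" using T L(1) M(1) by (simp add: C_def)
  have main: "norm ((euler_step G (T / real m) ^^ j) (z 0) - z (real j * (T / real m))) \<le> C * (T / real m)"
    if m: "m > 0" and small: "C * (T / real m) \<le> 1" and jm: "j \<le> m" and sol: "solves_ode_on {0..T} (\<lambda>_. G) z"
      and bd: "\<And>t. t \<in> {0..T} \<Longrightarrow> norm (z t) \<le> \<rho> - 1" for m z j
  proof -
    define \<delta> where "\<delta> = T / real m"
    have \<delta>: "\<delta> > 0" "real m * \<delta> = T" using T m by (auto simp: \<delta>_def)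
    define E where "E j = (euler_step G \<delta> ^^ j) (z 0)" for j
    have in_T: "real i * \<delta> \<in> {0..T}" if "i \<le> m" for i
    proof -
      have "real i * \<delta> \<le> real m * \<delta>" using that \<delta>(1) by (intro mult_right_mono) auto
      then show ?thesis using \<delta> by simp
    qed
    have bound: "real i * \<delta>\<^sup>2 * (L * M) * exp (real i * \<delta> * L) \<le> C * \<delta>" if "i \<le> m" for i
      unfolding C_def using in_T[OF that] L(1) M(1) \<delta>(1) by (intro discrete_gronwall_bound) auto
    have zin: "z t \<in> cball 0 \<rho>" if "t \<in> {0..T}" for t using bd[OF that] by simp
    have "i \<le> m \<Longrightarrow> norm (E i - z (real i * \<delta>)) \<le> real i * \<delta>\<^sup>2 * (L * M) * exp (real i * \<delta> * L)" for i
    proof (induction i)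
      case 0
      show ?case by (simp add: E_def)
    next
      case (Suc i)
      let ?a = "real i * \<delta>" and ?b = "real (Suc i) * \<delta>"
      have IH: "norm (E i - z ?a) \<le> real i * \<delta>\<^sup>2 * (L * M) * exp (real i * \<delta> * L)" using Suc by simp
      have "norm (E i - z ?a) \<le> 1"
        using IH bound[of i] small[folded \<delta>_def] Suc.prems by linarith
      moreover have "norm (z ?a) \<le> \<rho> - 1" using bd in_T Suc.prems by simp
      ultimately have Ein: "E i \<in> cball 0 \<rho>"
        using norm_triangle_ineq[of "E i - z ?a" "z ?a"] by simp
      have ab: "{?a..?b} \<subseteq> {0..T}" using in_T[of i] in_T[of "Suc i"] Suc.prems by auto
      have zder: "(z has_vector_derivative G (z s)) (at s within {?a..?b})" if "s \<in> {?a..?b}" for s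
        using sol that ab has_vector_derivative_within_subset unfolding solves_ode_on_def by blast
      have d1: "norm (z s - z ?a) \<le> M * \<delta>" if s: "s \<in> {?a..?b}" for s
      proof -
        have "norm (z s - z ?a) \<le> M * (s - ?a)"
          by (rule vector_derivative_norm_bound[OF zder M(2) s]) (use zin ab in auto)
        also have "\<dots> \<le> M * \<delta>" using s M(1) by (intro mult_left_mono) (auto simp: algebra_simps)
        finally show ?thesis .
      qed
      \<comment> \<open>Local truncation error: the mean value bound is applied to
        \<open>z s - s G (z a)\<close>, whose derivative \<open>G (z s) - G (z a)\<close> is of
        order \<open>\<delta>\<close> during the step.\<close>
      have "norm ((z ?b - ?b *\<^sub>R G (z ?a)) - (z ?a - ?a *\<^sub>R G (z ?a))) \<le> (L * (M * \<delta>)) * (?b - ?a)"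
      proof (rule vector_derivative_norm_bound[where x = "\<lambda>s. z s - s *\<^sub>R G (z ?a)" and x' = "\<lambda>s. G (z s) - G (z ?a)" and b = ?b])
        fix s assume s: "s \<in> {?a..?b}"
        show "((\<lambda>s. z s - s *\<^sub>R G (z ?a)) has_vector_derivative G (z s) - G (z ?a)) (at s within {?a..?b})"
          by (intro has_vector_derivative_diff zder s) (auto intro!: derivative_eq_intros)
        have "norm (G (z s) - G (z ?a)) \<le> L * norm (z s - z ?a)"
          using s ab zin in_T[of i] Suc.prems by (intro L(2)) auto
        also have "\<dots> \<le> L * (M * \<delta>)" using L(1) d1[OF s] by (intro mult_left_mono)
        finally show "norm (G (z s) - G (z ?a)) \<le> L * (M * \<delta>)" .
      qed (use \<delta>(1) in \<open>auto simp: algebra_simps\<close>)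
      then have d2: "norm ((z ?b - ?b *\<^sub>R G (z ?a)) - (z ?a - ?a *\<^sub>R G (z ?a))) \<le> \<delta>\<^sup>2 * (L * M)"
        by (simp add: algebra_simps power2_eq_square)
      have "E (Suc i) - z ?b = (E i - z ?a) + \<delta> *\<^sub>R (G (E i) - G (z ?a))
          - ((z ?b - ?b *\<^sub>R G (z ?a)) - (z ?a - ?a *\<^sub>R G (z ?a)))"
        by (simp add: E_def euler_step_def algebra_simps)
      then have "norm (E (Suc i) - z ?b) \<le> norm (E i - z ?a) + norm (\<delta> *\<^sub>R (G (E i) - G (z ?a))) + \<delta>\<^sup>2 * (L * M)"
        using d2 by (smt (verit) norm_triangle_ineq norm_triangle_ineq4)
      also have "norm (\<delta> *\<^sub>R (G (E i) - G (z ?a))) \<le> \<delta> * (L * norm (E i - z ?a))"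
        using \<delta>(1) L(2)[OF Ein zin[OF in_T[of i]]] Suc.prems by simp
      finally have "norm (E (Suc i) - z ?b) \<le> (1 + \<delta> * L) * norm (E i - z ?a) + \<delta>\<^sup>2 * (L * M)"
        by (simp add: algebra_simps)
      then show ?case
        using L(1) M(1) \<delta>(1) by (intro discrete_gronwall_step[OF IH]) auto
    qed
    from this[OF jm] bound[OF jm] show ?thesis
      unfolding E_def \<delta>_def[symmetric] by linarith
  qed
  show ?thesis using C main by (rule that)
qed

text \<open>Differentiating an Euler iterate along \<open>G\<close> gives \<open>G\<close> at the iterate up to \<open>O(\<delta>)\<close>; hence the
  derivative of a Riemann sum of \<open>q\<close> along \<open>G\<close> telescopes up to \<open>O(\<delta>)\<close>, without any bound on second
  derivatives of the iterates.\<close>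
theorem euler_lyapunov:
  fixes G :: "'a::euclidean_space \<Rightarrow> 'a" and q :: "'a \<Rightarrow> real"
  assumes G: "polynomial_function G" and q: "real_polynomial_function q" and T: "T > 0" and \<epsilon>: "\<epsilon> > 0"
    and sol: "\<And>p. p \<in> Z \<Longrightarrow> solves_ode_on {0..T} (\<lambda>_. G) (s p)" "\<And>p. p \<in> Z \<Longrightarrow> s p 0 = p"
      "\<And>p t. p \<in> Z \<Longrightarrow> t \<in> {0..T} \<Longrightarrow> norm (s p t) \<le> \<rho> - 1"
  shows "\<exists>m>0. \<forall>p\<in>Z. \<exists>W. ((\<lambda>z. T / real m * (\<Sum>j<m. q ((euler_step G (T / real m) ^^ j) z))) has_derivative W) (at p)
      \<and> W (G p) \<le> q (s p T) - q p + \<epsilon>"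
proof -
  obtain C where C: "C \<ge> 0" and conv: "\<And>m z j. m > 0 \<Longrightarrow> C * (T / real m) \<le> 1 \<Longrightarrow> j \<le> m \<Longrightarrow> solves_ode_on {0..T} (\<lambda>_. G) z \<Longrightarrow>
      (\<And>t. t \<in> {0..T} \<Longrightarrow> norm (z t) \<le> \<rho> - 1) \<Longrightarrow>
      norm ((euler_step G (T / real m) ^^ j) (z 0) - z (real j * (T / real m))) \<le> C * (T / real m)"
    using euler_convergence[OF G T, of \<rho>] by metis
  obtain D where D: "\<And>x. (G has_derivative D x) (at x)" "\<And>v. polynomial_function (\<lambda>x. D x v)"
    using polynomial_has_derivative[OF G] by metis
  have q': "polynomial_function q" using q by (simp add: real_polynomial_function_eq)
  obtain Dq where Dq: "\<And>x. (q has_derivative Dq x) (at x)" "\<And>v. polynomial_function (\<lambda>x. Dq x v)"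
    using polynomial_has_derivative[OF q'] by metis
  obtain M where M: "M > 0" "\<And>x. x \<in> cball 0 \<rho> \<Longrightarrow> norm (G x) \<le> M"
    using polynomial_bounded_cball[OF G] by metis
  obtain K where K: "K \<ge> 0" "\<And>x v. x \<in> cball 0 \<rho> \<Longrightarrow> norm (D x v) \<le> K * norm v"
    using polynomial_derivative_bounded_cball[OF D] by metis
  obtain Kq where Kq: "Kq \<ge> 0" "\<And>x v. x \<in> cball 0 \<rho> \<Longrightarrow> norm (Dq x v) \<le> Kq * norm v"
    using polynomial_derivative_bounded_cball[OF Dq] by metis
  obtain C2 where C2: "C2 \<ge> 0"
    "\<And>x y. x \<in> cball 0 \<rho> \<Longrightarrow> y \<in> cball 0 \<rho> \<Longrightarrow> norm (G y - G x - D x (y - x)) \<le> C2 * (norm (y - x))\<^sup>2"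
    using polynomial_second_order_cball[OF D] by metis
  obtain Cq where Cq: "Cq \<ge> 0"
    "\<And>x y. x \<in> cball 0 \<rho> \<Longrightarrow> y \<in> cball 0 \<rho> \<Longrightarrow> norm (q y - q x - Dq x (y - x)) \<le> Cq * (norm (y - x))\<^sup>2"
    using polynomial_second_order_cball[OF Dq] by metis
  obtain Lq where Lq: "Lq \<ge> 0" "\<And>x y. x \<in> cball 0 \<rho> \<Longrightarrow> y \<in> cball 0 \<rho> \<Longrightarrow> norm (q x - q y) \<le> Lq * norm (x - y)"
    using polynomial_lipschitz_cball[OF q'] by metis
  \<comment> \<open>\<open>\<delta>^2 B\<close> bounds the defect in one step of the discrete
    variational equation, \<open>F \<delta>\<close> the resulting distance between the transported
    vector and \<open>G\<close>, and \<open>H \<delta>\<close> the total error after telescoping,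
    including the replacement of the last iterate by the exact solution.\<close>
  define B where "B = C2 * M\<^sup>2"
  define F where "F = T * B * exp (T * K)"
  define H where "H = T * (Kq * F + Cq * M\<^sup>2) + Lq * C"
  have B: "B \<ge> 0" using C2 by (simp add: B_def)
  have F: "F \<ge> 0" using B T by (simp add: F_def)
  have H: "H \<ge> 0" using T Kq Cq F Lq C by (simp add: H_def)
  \<comment> \<open>One \<open>m\<close> meets both needs, uniformly in \<open>p\<close>:
    \<open>C * \<delta> \<le> 1\<close> keeps the iterates in the ball, and
    \<open>H * \<delta> \<le> \<epsilon>\<close> bounds the final error.\<close>
  obtain m :: nat where m: "(C + 1) * T + H * T / \<epsilon> < real m" using reals_Archimedean2 by blast
  have "(C + 1) * T > 0" "H * T / \<epsilon> \<ge> 0" using C T H \<epsilon> by auto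
  with m have m0: "m > 0" and mC: "(C + 1) * T \<le> real m" and mH: "H * T / \<epsilon> \<le> real m"
    by (auto intro: Nat.gr0I)
  define \<delta> where "\<delta> = T / real m"
  have \<delta>: "\<delta> > 0" "real m * \<delta> = T" using T m0 by (auto simp: \<delta>_def)
  have C\<delta>: "C * \<delta> \<le> 1" using mC m0 C T by (simp add: \<delta>_def field_simps)
  have H\<delta>: "H * \<delta> \<le> \<epsilon>" using mH m0 \<epsilon> by (simp add: \<delta>_def field_simps)
  define E where "E j z = (euler_step G \<delta> ^^ j) z" for j z
  have E_Suc: "E (Suc j) z = E j z + \<delta> *\<^sub>R G (E j z)" for j z
    by (simp add: E_def euler_step_def)
  have "\<exists>W. ((\<lambda>z. \<delta> * (\<Sum>j<m. q (E j z))) has_derivative W) (at p) \<and> W (G p) \<le> q (s p T) - q p + \<epsilon>"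
    if p: "p \<in> Z" for p
  proof -
    define z where "z j = E j p" for j
    have near: "norm (z j - s p (real j * \<delta>)) \<le> C * \<delta>" if "j \<le> m" for j
      using conv[OF m0 _ that sol(1,3)[OF p]] C\<delta> sol(2)[OF p] by (simp add: z_def E_def \<delta>_def)
    have jT: "real j * \<delta> \<in> {0..T}" if "j \<le> m" for j
    proof -
      have "real j * \<delta> \<le> real m * \<delta>" using that \<delta>(1) by (intro mult_right_mono) auto
      then show ?thesis using \<delta> by simp
    qed
    have zin: "z j \<in> cball 0 \<rho>" if "j \<le> m" for j
      using near[OF that] C\<delta> sol(3)[OF p jT[OF that]] norm_triangle_ineq[of "z j - s p (real j * \<delta>)" "s p (real j * \<delta>)"]
      by simp
    have "\<exists>E'. \<forall>j. ((E j) has_derivative (E' j)) (at p) \<and> E' 0 = (\<lambda>v. v) \<and> E' (Suc j) = (\<lambda>v. E' j v + \<delta> *\<^sub>R D (z j) (E' j v))"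
    proof -
      define E' where "E' = rec_nat (\<lambda>v. v) (\<lambda>j e v. e v + \<delta> *\<^sub>R D (z j) (e v))"
      have "((E j) has_derivative (E' j)) (at p)" for j
      proof (induction j)
        case 0
        then show ?case by (simp add: E_def E'_def)
      next
        case (Suc j)
        have "((\<lambda>x. G (E j x)) has_derivative (\<lambda>v. D (z j) (E' j v))) (at p)"
          using has_derivative_compose[OF Suc D(1)] by (simp add: z_def)
        then have "((\<lambda>x. E j x + \<delta> *\<^sub>R G (E j x)) has_derivative (\<lambda>v. E' j v + \<delta> *\<^sub>R D (z j) (E' j v))) (at p)"
          by (intro has_derivative_add Suc has_derivative_scaleR_right)
        then show ?case by (simp add: E_Suc[abs_def] E'_def)
      qed
      then show ?thesis by (intro exI[of _ E']) (simp add: E'_def)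
    qed
    then obtain E' where E': "\<And>j. ((E j) has_derivative (E' j)) (at p)" "E' 0 = (\<lambda>v. v)"
      "\<And>j. E' (Suc j) = (\<lambda>v. E' j v + \<delta> *\<^sub>R D (z j) (E' j v))" by blast
    \<comment> \<open>An exact flow carries \<open>G p\<close> to \<open>G\<close> at the image
      point. The Euler map does so up to \<open>O(\<delta>)\<close>: \<open>v j\<close> and
      \<open>G (z j)\<close> agree for \<open>j = 0\<close> and satisfy the same recursion up to a
      second order remainder.\<close>
    define v where "v j = E' j (G p)" for j
    have z_Suc: "z (Suc j) - z j = \<delta> *\<^sub>R G (z j)" for j by (simp add: z_def E_Suc)
    have err: "j \<le> m \<Longrightarrow> norm (v j - G (z j)) \<le> real j * \<delta>\<^sup>2 * B * exp (real j * \<delta> * K)" for j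
    proof (induction j)
      case 0
      show ?case by (simp add: v_def E'(2) z_def E_def)
    next
      case (Suc j)
      interpret Dz: bounded_linear "D (z j)" using D(1) by (rule has_derivative_bounded_linear)
      have "v (Suc j) - G (z (Suc j)) = (v j - G (z j)) + \<delta> *\<^sub>R D (z j) (v j - G (z j))
          - (G (z (Suc j)) - G (z j) - D (z j) (z (Suc j) - z j))"
        by (simp add: v_def E'(3) z_Suc Dz.diff Dz.scaleR algebra_simps)
      moreover have "norm (G (z (Suc j)) - G (z j) - D (z j) (z (Suc j) - z j)) \<le> \<delta>\<^sup>2 * B"
      proof -
        have "norm (G (z (Suc j)) - G (z j) - D (z j) (z (Suc j) - z j)) \<le> C2 * (norm (z (Suc j) - z j))\<^sup>2"
          using Suc.prems by (intro C2(2) zin) auto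
        also have "\<dots> \<le> C2 * (\<delta> * M)\<^sup>2"
          unfolding z_Suc using \<delta>(1) M(2)[OF zin[of j]] Suc.prems C2(1)
          by (intro mult_left_mono power_mono) auto
        finally show ?thesis by (simp add: B_def power_mult_distrib mult_ac)
      qed
      moreover have "norm (\<delta> *\<^sub>R D (z j) (v j - G (z j))) \<le> \<delta> * K * norm (v j - G (z j))"
        using K(2)[OF zin[of j], of "v j - G (z j)"] \<delta>(1) Suc.prems by (simp add: mult.assoc)
      ultimately have "norm (v (Suc j) - G (z (Suc j))) \<le> norm (v j - G (z j)) + \<delta> * K * norm (v j - G (z j)) + \<delta>\<^sup>2 * B"
        by (smt (verit) norm_triangle_ineq norm_triangle_ineq4)
      then have "norm (v (Suc j) - G (z (Suc j))) \<le> (1 + \<delta> * K) * norm (v j - G (z j)) + \<delta>\<^sup>2 * B"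
        by (simp add: algebra_simps)
      then show ?case
        using Suc K(1) B \<delta>(1) by (intro discrete_gronwall_step[where e = "norm (v j - G (z j))"]) auto
    qed
    have vF: "norm (v j - G (z j)) \<le> F * \<delta>" if "j \<le> m" for j
    proof -
      have "real j * \<delta>\<^sup>2 * B * exp (real j * \<delta> * K) \<le> F * \<delta>"
        unfolding F_def using jT[OF that] B K(1) \<delta>(1) by (intro discrete_gronwall_bound) auto
      with err[OF that] show ?thesis by linarith
    qed
    define W where "W h = \<delta> * (\<Sum>j<m. Dq (z j) (E' j h))" for h
    have "((\<lambda>x. \<delta> * (\<Sum>j<m. q (E j x))) has_derivative W) (at p)"
      unfolding W_def[abs_def]
    proof (intro has_derivative_mult_right has_derivative_sum)
      fix j
      show "((\<lambda>x. q (E j x)) has_derivative (\<lambda>h. Dq (z j) (E' j h))) (at p)"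
        using has_derivative_compose[OF E'(1) Dq(1)] by (simp add: z_def)
    qed
    moreover have "W (G p) \<le> q (s p T) - q p + \<epsilon>"
    proof -
      \<comment> \<open>Because \<open>\<delta> G (z j)\<close> is exactly the Euler increment,
        \<open>\<delta> Dq (z j) (G (z j))\<close> is the first order part of
        \<open>q (z (Suc j)) - q (z j)\<close>.\<close>
      have step: "\<delta> * Dq (z j) (v j) \<le> (q (z (Suc j)) - q (z j)) + \<delta>\<^sup>2 * (Kq * F + Cq * M\<^sup>2)" if "j < m" for j
      proof -
        interpret Dz: bounded_linear "Dq (z j)" using Dq(1) by (rule has_derivative_bounded_linear)
        have zj: "z j \<in> cball 0 \<rho>" "z (Suc j) \<in> cball 0 \<rho>" using zin[of j] zin[of "Suc j"] that by simp_all
        have "norm (Dq (z j) (v j - G (z j))) \<le> Kq * norm (v j - G (z j))" by (rule Kq(2)[OF zj(1)])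
        also have "\<dots> \<le> Kq * (F * \<delta>)" using vF[of j] that Kq(1) by (intro mult_left_mono) auto
        finally have "Dq (z j) (v j) \<le> Dq (z j) (G (z j)) + Kq * (F * \<delta>)" by (simp add: Dz.diff)
        then have "\<delta> * Dq (z j) (v j) \<le> \<delta> * (Dq (z j) (G (z j)) + Kq * (F * \<delta>))"
          using \<delta>(1) by (intro mult_left_mono) auto
        also have "\<dots> = Dq (z j) (z (Suc j) - z j) + \<delta>\<^sup>2 * (Kq * F)"
          by (simp add: z_Suc Dz.scaleR power2_eq_square algebra_simps)
        also have "Dq (z j) (z (Suc j) - z j) \<le> q (z (Suc j)) - q (z j) + \<delta>\<^sup>2 * (Cq * M\<^sup>2)"
        proof -
          have "norm (q (z (Suc j)) - q (z j) - Dq (z j) (z (Suc j) - z j)) \<le> Cq * (norm (z (Suc j) - z j))\<^sup>2"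
            by (rule Cq(2)[OF zj])
          also have "\<dots> \<le> Cq * (\<delta> * M)\<^sup>2"
            unfolding z_Suc using \<delta>(1) M(2)[OF zj(1)] Cq(1)
            by (intro mult_left_mono power_mono) auto
          finally show ?thesis by (simp add: power_mult_distrib mult_ac abs_le_iff)
        qed
        finally show ?thesis by (simp add: algebra_simps)
      qed
      have "W (G p) = (\<Sum>j<m. \<delta> * Dq (z j) (v j))" by (simp add: W_def v_def sum_distrib_left)
      also have "\<dots> \<le> (\<Sum>j<m. (q (z (Suc j)) - q (z j)) + \<delta>\<^sup>2 * (Kq * F + Cq * M\<^sup>2))"
        by (intro sum_mono step) auto
      also have "\<dots> = q (z m) - q (z 0) + (real m * \<delta>) * \<delta> * (Kq * F + Cq * M\<^sup>2)"
        by (simp add: sum.distrib sum_lessThan_telescope[of "\<lambda>j. q (z j)"] power2_eq_square mult_ac)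
      also have "\<dots> = q (z m) - q p + T * (Kq * F + Cq * M\<^sup>2) * \<delta>"
        unfolding \<delta>(2) by (simp add: z_def E_def mult_ac)
      also have "q (z m) \<le> q (s p T) + Lq * C * \<delta>"
      proof -
        have "norm (s p T) \<le> \<rho>" using sol(3)[OF p, of T] T by simp
        then have "norm (q (z m) - q (s p T)) \<le> Lq * norm (z m - s p T)" by (intro Lq(2) zin) auto
        also have "\<dots> \<le> Lq * (C * \<delta>)" using near[of m] \<delta>(2) Lq(1) by (intro mult_left_mono) auto
        finally show ?thesis by simp
      qed
      finally have "W (G p) \<le> q (s p T) - q p + H * \<delta>" by (simp add: H_def algebra_simps)
      with H\<delta> show ?thesis by linarith
    qed
    ultimately show ?thesis by blast
  qed
  then show ?thesis
    using m0 unfolding E_def \<delta>_def by blast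
qed

section \<open>Polynomial Lyapunov functions for linear cocycles\<close>

lemma norm_matrix_vector_le:
  fixes M :: "real^'m^'n"
  shows "norm (M *v w) \<le> real CARD('n) * norm M * norm w"
proof -
  have "norm (M *v w) \<le> (\<Sum>i\<in>UNIV. \<bar>(M *v w) $ i\<bar>)" by (rule norm_le_l1_cart)
  also have "\<dots> \<le> (\<Sum>i\<in>(UNIV::'n set). norm M * norm w)"
  proof (rule sum_mono)
    fix i
    have "\<bar>(M *v w) $ i\<bar> \<le> norm (M $ i) * norm w"
      by (simp add: matrix_vector_mul_component Cauchy_Schwarz_ineq2)
    also have "\<dots> \<le> norm M * norm w" by (intro mult_right_mono Finite_Cartesian_Product.norm_nth_le) auto
    finally show "\<bar>(M *v w) $ i\<bar> \<le> norm M * norm w" .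
  qed
  finally show ?thesis by (simp add: mult_ac)
qed

text \<open>Adjoining \<open>x\<close> makes the linear equation over a trajectory autonomous, so
  that the existence, dependence and Euler results apply to it. Subtracting \<open>B w\<close> turns
  growth slower than \<open>exp (B t)\<close> into decay.\<close>

definition skew_field ::
  "(real^'n \<Rightarrow> real^'n) \<Rightarrow> (real^'n \<Rightarrow> real^'m^'m) \<Rightarrow> real \<Rightarrow> (real^'n) \<times> (real^'m) \<Rightarrow> (real^'n) \<times> (real^'m)" where
  "skew_field f A B z = (f (fst z), A (fst z) *v snd z - B *\<^sub>R snd z)"

lemma polynomial_function_Pair:
  fixes p :: "'a::real_normed_vector \<Rightarrow> 'b::euclidean_space" and q :: "'a \<Rightarrow> 'c::euclidean_space"
  assumes "polynomial_function p" "polynomial_function q"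
  shows "polynomial_function (\<lambda>z. (p z, q z))"
  using assms unfolding polynomial_function_iff_Basis_inner by (auto simp: Basis_prod_def)

lemma polynomial_function_matrix_vector:
  fixes M :: "'c::euclidean_space \<Rightarrow> real^'m^'n"
  assumes "polynomial_function M" "polynomial_function w"
  shows "polynomial_function (\<lambda>z. M z *v w z)"
  unfolding polynomial_function_vec real_polynomial_function_eq[symmetric] matrix_vector_mult_def using assms
  by (auto simp: polynomial_function_mat polynomial_function_vec real_polynomial_function_eq[symmetric]
           intro!: real_polynomial_function_sum rpf_mult)

lemma polynomial_skew_field:
  assumes "polynomial_function f" "polynomial_function A"
  shows "polynomial_function (skew_field f A B)"
  unfolding skew_field_def[abs_def] using assms
  by (intro polynomial_function_Pair polynomial_function_diff polynomial_function_cmul polynomial_function_snd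
      polynomial_function_matrix_vector polynomial_function_comp_fst)

definition skew_solution ::
  "(real^'n \<Rightarrow> real^'n) \<Rightarrow> (real^'n \<Rightarrow> real^'m^'m) \<Rightarrow> real \<Rightarrow> (real^'n) set \<Rightarrow> real set \<Rightarrow> (real \<Rightarrow> (real^'n) \<times> (real^'m)) \<Rightarrow> bool" where
  "skew_solution f A B S T z \<longleftrightarrow> solves_ode_on T (\<lambda>_. skew_field f A B) z \<and> (\<forall>t\<in>T. fst (z t) \<in> S)"

lemma skew_solves_iff:
  "solves_ode_on T (\<lambda>_. skew_field f A B) z \<longleftrightarrow>
    solves_ode_on T (\<lambda>_. f) (\<lambda>t. fst (z t)) \<and>
    solves_ode_on T (\<lambda>t w. A (fst (z t)) *v w - B *\<^sub>R w) (\<lambda>t. snd (z t))"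
proof
  assume *: "solves_ode_on T (\<lambda>_. skew_field f A B) z"
  have "((\<lambda>t. fst (z t)) has_vector_derivative f (fst (z t))) (at t within T)"
    "((\<lambda>t. snd (z t)) has_vector_derivative A (fst (z t)) *v snd (z t) - B *\<^sub>R snd (z t)) (at t within T)" if "t \<in> T" for t
  proof -
    have "(z has_vector_derivative skew_field f A B (z t)) (at t within T)"
      using * that by (simp add: solves_ode_on_def)
    from bounded_linear.has_vector_derivative[OF bounded_linear_fst this]
      bounded_linear.has_vector_derivative[OF bounded_linear_snd this]
    show "((\<lambda>t. fst (z t)) has_vector_derivative f (fst (z t))) (at t within T)"
      "((\<lambda>t. snd (z t)) has_vector_derivative A (fst (z t)) *v snd (z t) - B *\<^sub>R snd (z t)) (at t within T)"
      by (simp_all add: skew_field_def)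
  qed
  then show "solves_ode_on T (\<lambda>_. f) (\<lambda>t. fst (z t)) \<and>
    solves_ode_on T (\<lambda>t w. A (fst (z t)) *v w - B *\<^sub>R w) (\<lambda>t. snd (z t))"
    by (simp add: solves_ode_on_def)
next
  assume *: "solves_ode_on T (\<lambda>_. f) (\<lambda>t. fst (z t)) \<and>
    solves_ode_on T (\<lambda>t w. A (fst (z t)) *v w - B *\<^sub>R w) (\<lambda>t. snd (z t))"
  have "((\<lambda>t. (fst (z t), snd (z t))) has_vector_derivative
     (f (fst (z t)), A (fst (z t)) *v snd (z t) - B *\<^sub>R snd (z t))) (at t within T)" if "t \<in> T" for t
    using * that by (intro has_vector_derivative_Pair) (auto simp: solves_ode_on_def)
  then show "solves_ode_on T (\<lambda>_. skew_field f A B) z"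
    by (simp add: solves_ode_on_def skew_field_def)
qed

lemma skew_solution_scale:
  assumes "skew_solution f A B S T z"
  shows "skew_solution f A B S T (\<lambda>t. (fst (z t), c *\<^sub>R snd (z t)))"
proof -
  have "solves_ode_on T (\<lambda>t w. A (fst (z t)) *v w - B *\<^sub>R w) (\<lambda>t. snd (z t))"
    using assms by (simp add: skew_solution_def skew_solves_iff)
  then have "solves_ode_on T (\<lambda>t w. A (fst (z t)) *v w - B *\<^sub>R w) (\<lambda>t. c *\<^sub>R snd (z t))"
    unfolding solves_ode_on_def
    by (auto intro!: derivative_eq_intros simp: matrix_vector_mult_scaleR scaleR_diff_right)
  then show ?thesis
    using assms by (simp add: skew_solution_def skew_solves_iff)
qed

lemma skew_solution_shift:
  assumes "skew_solution f A B S {0..} z" "a \<ge> 0"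
  shows "skew_solution f A B S {0..} (\<lambda>t. z (a + t))"
proof -
  have "((\<lambda>t. z (a + t)) has_vector_derivative skew_field f A B (z (a + t))) (at t within {0..})" if "t \<ge> 0" for t
  proof -
    have "(z has_vector_derivative skew_field f A B (z (a + t))) (at (a + t) within {0..})"
      using assms that by (simp add: skew_solution_def solves_ode_on_def)
    then have "(z has_vector_derivative skew_field f A B (z (a + t))) (at (a + t) within (\<lambda>t. a + t) ` {0..})"
      by (rule has_vector_derivative_within_subset) (use assms(2) in auto)
    moreover have "((\<lambda>t. a + t) has_vector_derivative 1) (at t within {0..})"
      by (auto intro!: derivative_eq_intros)
    ultimately have "((z \<circ> (\<lambda>t. a + t)) has_vector_derivative 1 *\<^sub>R skew_field f A B (z (a + t))) (at t within {0..})"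
      by (intro vector_diff_chain_within)
    then show ?thesis by (simp add: o_def)
  qed
  then show ?thesis using assms by (auto simp: skew_solution_def solves_ode_on_def)
qed

section \<open>Uniform contraction over a compact invariant set\<close>

locale skew_system =
  fixes f :: "real^'n \<Rightarrow> real^'n" and A :: "real^'n \<Rightarrow> real^'m^'m" and B :: real and S :: "(real^'n) set"
  assumes f: "polynomial_function f" and A: "polynomial_function A"
    and S: "compact S" and inv: "forward_invariant f S"
begin

abbreviation "G \<equiv> skew_field f A B"

text \<open>A uniform time step needs bounded initial data, yet \<open>w\<close> is arbitrary.
  Linearity in \<open>w\<close> resolves this: the vector is scaled into the unit ball, solved there
  and scaled back, while forward invariance keeps \<open>x\<close> in the compact set on every
  piece.\<close>

lemma skew_existence:
  assumes "x0 \<in> S"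
  shows "\<exists>z. skew_solution f A B S {0..} z \<and> z 0 = (x0, w0)"
proof -
  obtain R where R: "\<And>x. x \<in> S \<Longrightarrow> norm x \<le> R"
    using compact_imp_bounded[OF S] unfolding bounded_iff by blast
  define \<rho> where "\<rho> = R + 2"
  obtain L where L: "L \<ge> 0" "\<And>x y. x \<in> cball 0 \<rho> \<Longrightarrow> y \<in> cball 0 \<rho> \<Longrightarrow> norm (G x - G y) \<le> L * norm (x - y)"
    using polynomial_lipschitz_cball[OF polynomial_skew_field[OF f A]] by metis
  obtain M where M: "M > 0" "\<And>x. x \<in> cball 0 \<rho> \<Longrightarrow> norm (G x) \<le> M"
    using polynomial_bounded_cball[OF polynomial_skew_field[OF f A]] by metis
  define \<tau> where "\<tau> = 1 / (L + M + 1)"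
  have \<tau>: "\<tau> > 0" "L * \<tau> < 1" "M * \<tau> \<le> 1"
    using L(1) M(1) by (auto simp: \<tau>_def field_simps)
  have "\<exists>z. solves_ode_on {0..} (\<lambda>_. G) z \<and> z 0 = (x0, w0) \<and> (\<forall>t\<ge>0. z t \<in> S \<times> UNIV)"
  proof (rule global_from_local_existence[OF \<tau>(1)])
    fix p assume p: "p \<in> S \<times> (UNIV :: (real^'m) set)"
    define c where "c = norm (snd p) + 1"
    have c: "c > 0" by (simp add: c_def add_nonneg_pos)
    have 1: "norm ((1 / c) *\<^sub>R snd p) \<le> 1" using c by (simp add: c_def)
    have 2: "norm (fst p) \<le> R" using R p by auto
    have "norm (fst p, (1 / c) *\<^sub>R snd p) \<le> norm (fst p) + norm ((1 / c) *\<^sub>R snd p)" by (rule norm_Pair_le)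
    with 1 2 have "norm (fst p, (1 / c) *\<^sub>R snd p) \<le> \<rho> - 1" unfolding \<rho>_def by linarith
    from local_existence[OF L(2,1) M(2) \<tau> this] obtain z where
      z: "solves_ode_on {0..\<tau>} (\<lambda>_. G) z" "z 0 = (fst p, (1 / c) *\<^sub>R snd p)" by blast
    have "fst (z t) \<in> S" if "t \<in> {0..\<tau>}" for t
      using inv z p \<tau>(1) that unfolding forward_invariant_def skew_solves_iff
      by (metis fst_conv less_imp_le mem_Times_iff)
    then have "skew_solution f A B S {0..\<tau>} z" using z by (simp add: skew_solution_def)
    from skew_solution_scale[OF this, of c]
    show "\<exists>z. solves_ode_on {0..\<tau>} (\<lambda>_. G) z \<and> z 0 = p \<and> (\<forall>t\<in>{0..\<tau>}. z t \<in> S \<times> UNIV)"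
      using z(2) c by (intro exI[of _ "\<lambda>t. (fst (z t), c *\<^sub>R snd (z t))"]) (auto simp: skew_solution_def)
  qed (use assms in simp)
  then obtain z where "solves_ode_on {0..} (\<lambda>_. G) z" "z 0 = (x0, w0)" "\<And>t. t \<ge> 0 \<Longrightarrow> z t \<in> S \<times> UNIV" by blast
  then show ?thesis by (intro exI[of _ z]) (auto simp: skew_solution_def mem_Times_iff)
qed

lemma skew_growth:
  obtains \<Lambda> where "\<Lambda> > 0"
    "\<And>z t. skew_solution f A B S {0..} z \<Longrightarrow> t \<ge> 0 \<Longrightarrow> norm (snd (z t)) \<le> exp (\<Lambda> * t) * norm (snd (z 0))"
proof -
  have Ac: "continuous_on S A" by (rule continuous_on_polymonial_function[OF A])
  obtain K where K: "\<And>x. x \<in> S \<Longrightarrow> norm (A x) \<le> K"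
    using compact_imp_bounded[OF compact_continuous_image[OF Ac S]] unfolding bounded_iff by blast
  define \<Lambda> where "\<Lambda> = real CARD('m) * max K 0 + \<bar>B\<bar> + 1"
  have \<Lambda>: "\<Lambda> > 0" by (simp add: \<Lambda>_def add_nonneg_pos)
  have "norm (snd (z t)) \<le> exp (\<Lambda> * t) * norm (snd (z 0))" if z: "skew_solution f A B S {0..} z" and t: "t \<ge> 0" for z t
  proof -
    have "(norm (snd (z t)))\<^sup>2 \<le> exp ((2 * \<Lambda>) * t) * (norm (snd (z 0)))\<^sup>2"
    proof (rule gronwall[where T = t])
      fix s assume s: "s \<in> {0..t}"
      let ?w = "snd (z s)"
      have "((\<lambda>t. snd (z t)) has_vector_derivative A (fst (z s)) *v ?w - B *\<^sub>R ?w) (at s within {0..})"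
        using z s by (simp add: skew_solution_def skew_solves_iff solves_ode_on_def)
      then have "((\<lambda>t. snd (z t)) has_vector_derivative A (fst (z s)) *v ?w - B *\<^sub>R ?w) (at s within {0..t})"
        by (rule has_vector_derivative_within_subset) auto
      then show "((\<lambda>t. (norm (snd (z t)))\<^sup>2) has_real_derivative 2 * (?w \<bullet> (A (fst (z s)) *v ?w - B *\<^sub>R ?w))) (at s within {0..t})"
        by (rule has_real_derivative_norm_sq)
      have "norm (A (fst (z s)) *v ?w - B *\<^sub>R ?w) \<le> norm (A (fst (z s)) *v ?w) + norm (B *\<^sub>R ?w)"
        by (rule norm_triangle_ineq4)
      also have "\<dots> \<le> (real CARD('m) * norm (A (fst (z s)))) * norm ?w + \<bar>B\<bar> * norm ?w"
        using norm_matrix_vector_le[of "A (fst (z s))" ?w] by simp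
      also have "\<dots> \<le> (real CARD('m) * max K 0) * norm ?w + (\<bar>B\<bar> + 1) * norm ?w"
        using K[of "fst (z s)"] z s by (intro add_mono mult_right_mono mult_left_mono) (auto simp: skew_solution_def le_max_iff_disj)
      also have "\<dots> = \<Lambda> * norm ?w" by (simp add: \<Lambda>_def algebra_simps)
      finally have "norm ?w * norm (A (fst (z s)) *v ?w - B *\<^sub>R ?w) \<le> norm ?w * (\<Lambda> * norm ?w)"
        by (intro mult_left_mono) auto
      then have "?w \<bullet> (A (fst (z s)) *v ?w - B *\<^sub>R ?w) \<le> norm ?w * (\<Lambda> * norm ?w)"
        using norm_cauchy_schwarz[of ?w "A (fst (z s)) *v ?w - B *\<^sub>R ?w"] by linarith
      then show "2 * (?w \<bullet> (A (fst (z s)) *v ?w - B *\<^sub>R ?w)) \<le> 2 * \<Lambda> * (norm ?w)\<^sup>2"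
        by (simp add: power2_eq_square mult_ac)
    qed (use t in simp)
    also have "exp ((2 * \<Lambda>) * t) = (exp (\<Lambda> * t))\<^sup>2"
      by (simp add: power2_eq_square flip: exp_add)
    finally have "(norm (snd (z t)))\<^sup>2 \<le> (exp (\<Lambda> * t) * norm (snd (z 0)))\<^sup>2"
      by (simp add: power_mult_distrib)
    then show ?thesis by (rule power2_le_imp_le) simp
  qed
  with \<Lambda> show ?thesis by (rule that)
qed

end

context skew_system
begin

abbreviation "global_solution \<equiv> skew_solution f A B S {0..}"

lemma skew_bounded:
  obtains \<rho> where "\<And>z t. global_solution z \<Longrightarrow> norm (snd (z 0)) = 1 \<Longrightarrow> t \<in> {0..T} \<Longrightarrow> norm (z t) \<le> \<rho>"
proof -
  obtain \<Lambda> where \<Lambda>: "\<Lambda> > 0"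
    "\<And>z t. global_solution z \<Longrightarrow> t \<ge> 0 \<Longrightarrow> norm (snd (z t)) \<le> exp (\<Lambda> * t) * norm (snd (z 0))"
    using skew_growth by metis
  obtain R where R: "\<And>x. x \<in> S \<Longrightarrow> norm x \<le> R"
    using compact_imp_bounded[OF S] unfolding bounded_iff by blast
  have "norm (z t) \<le> R + exp (\<Lambda> * T)"
    if z: "global_solution z" "norm (snd (z 0)) = 1" and t: "t \<in> {0..T}" for z t
  proof -
    have "norm (snd (z t)) \<le> exp (\<Lambda> * t)" using \<Lambda>(2)[OF z(1), of t] z t by simp
    also have "\<dots> \<le> exp (\<Lambda> * T)" using t \<Lambda>(1) by simp
    finally have "norm (snd (z t)) \<le> exp (\<Lambda> * T)" .
    moreover have "norm (fst (z t)) \<le> R" using z t R by (simp add: skew_solution_def)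
    moreover have "norm (z t) \<le> norm (fst (z t)) + norm (snd (z t))"
      using norm_Pair_le[of "fst (z t)" "snd (z t)"] by simp
    ultimately show ?thesis by linarith
  qed
  then show ?thesis by (rule that)
qed

text \<open>The contraction time of one initial point serves a neighbourhood by continuous
  dependence, and finitely many neighbourhoods cover the unit vectors over \<open>S\<close>;
  linearity extends the result to all vectors. The positive lower bound \<open>\<tau>\<close> is
  recorded because a later induction advances by it.\<close>

lemma uniform_contraction_times:
  assumes contr: "\<And>z. global_solution z \<Longrightarrow> norm (snd (z 0)) = 1 \<Longrightarrow> \<exists>t>0. norm (snd (z t)) < 1 / 2"
  obtains \<tau> r where "\<tau> > 0" "r > 0"
    "\<And>z. global_solution z \<Longrightarrow> \<exists>t. \<tau> \<le> t \<and> t \<le> r \<and> norm (snd (z t)) \<le> norm (snd (z 0)) / 2"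
proof -
  obtain \<Lambda> where \<Lambda>: "\<Lambda> > 0"
    "\<And>z t. global_solution z \<Longrightarrow> t \<ge> 0 \<Longrightarrow> norm (snd (z t)) \<le> exp (\<Lambda> * t) * norm (snd (z 0))"
    using skew_growth by metis
  define C where "C = S \<times> sphere (0 :: real^'m) 1"
  have "\<exists>t \<eta>. t > 0 \<and> \<eta> > 0 \<and> (\<forall>z. global_solution z \<longrightarrow> norm (snd (z 0)) = 1 \<longrightarrow> dist (z 0) p < \<eta> \<longrightarrow> norm (snd (z t)) < 1 / 2)"
    if p: "p \<in> C" for p
  proof -
    obtain y where y: "global_solution y" "y 0 = p"
      using skew_existence[of "fst p" "snd p"] p by (auto simp: C_def)
    obtain t where t: "t > 0" "norm (snd (y t)) < 1 / 2"
      using contr[OF y(1)] y(2) p by (auto simp: C_def)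
    obtain \<rho> where "\<And>z s. global_solution z \<Longrightarrow> norm (snd (z 0)) = 1 \<Longrightarrow> s \<in> {0..t} \<Longrightarrow> norm (z s) \<le> \<rho>"
      using skew_bounded by metis
    then have bd: "z s \<in> cball 0 \<rho>" if "global_solution z" "norm (snd (z 0)) = 1" "s \<in> {0..t}" for z s
      using that by simp
    obtain L where L: "L \<ge> 0" "\<And>x y. x \<in> cball 0 \<rho> \<Longrightarrow> y \<in> cball 0 \<rho> \<Longrightarrow> norm (G x - G y) \<le> L * norm (x - y)"
      using polynomial_lipschitz_cball[OF polynomial_skew_field[OF f A]] by metis
    \<comment> \<open>An initial distance below \<open>\<eta>\<close>, magnified by at most
      \<open>exp (L * t)\<close>, stays within the slack
      \<open>1 / 2 - norm (snd (y t))\<close>.\<close>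
    define \<eta> where "\<eta> = (1 / 2 - norm (snd (y t))) / exp (L * t)"
    have \<eta>: "\<eta> > 0" "exp (L * t) * \<eta> = 1 / 2 - norm (snd (y t))" using t by (auto simp: \<eta>_def)
    have "norm (snd (z t)) < 1 / 2" if z: "global_solution z" "norm (snd (z 0)) = 1" "dist (z 0) p < \<eta>" for z
    proof -
      have yn: "norm (snd (y 0)) = 1" using y(2) p by (auto simp: C_def)
      have "norm (z t - y t) \<le> exp (L * t) * norm (z 0 - y 0)"
      proof (rule ode_dependence[of t G z y "cball 0 \<rho>"])
        show "solves_ode_on {0..t} (\<lambda>_. G) z" "solves_ode_on {0..t} (\<lambda>_. G) y"
          using z(1) y(1) by (auto simp: skew_solution_def intro: solves_ode_on_subset)
      qed (use bd z(1,2) y(1) yn L(2) t(1) in auto)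
      also have "\<dots> < exp (L * t) * \<eta>" using z(3) y(2) by (simp add: dist_norm)
      finally have "norm (z t - y t) < 1 / 2 - norm (snd (y t))" using \<eta>(2) by simp
      moreover have "norm (snd (z t) - snd (y t)) \<le> norm (z t - y t)"
        by (metis norm_snd_le prod.collapse snd_diff)
      ultimately show ?thesis using norm_triangle_ineq2[of "snd (z t)" "snd (y t)"] by linarith
    qed
    with t(1) \<eta>(1) show ?thesis by blast
  qed
  then obtain t \<eta> where t: "\<And>p. p \<in> C \<Longrightarrow> t p > 0" and \<eta>: "\<And>p. p \<in> C \<Longrightarrow> \<eta> p > 0"
    and near: "\<And>p z. p \<in> C \<Longrightarrow> global_solution z \<Longrightarrow> norm (snd (z 0)) = 1 \<Longrightarrow> dist (z 0) p < \<eta> p \<Longrightarrow> norm (snd (z (t p))) < 1 / 2"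
    by metis
  have "compact C" unfolding C_def by (intro compact_Times S) simp
  moreover have "C \<subseteq> (\<Union>p\<in>C. ball p (\<eta> p))" using \<eta> by auto
  ultimately obtain F where F: "F \<subseteq> C" "finite F" "C \<subseteq> (\<Union>p\<in>F. ball p (\<eta> p))"
    using compactE_image[of C C "\<lambda>p. ball p (\<eta> p)"] open_ball by metis
  \<comment> \<open>Inserting 1 keeps the extrema defined for an empty cover and gives
    \<open>\<tau> \<le> 1 \<le> r\<close>, so that \<open>r\<close> is an admissible time when
    \<open>snd (z 0) = 0\<close>.\<close>
  define \<tau> where "\<tau> = Min (insert 1 (t ` F))"
  define r where "r = Max (insert 1 (t ` F))"
  have \<tau>: "\<tau> > 0" using F(1,2) t by (auto simp: \<tau>_def)
  have r: "r \<ge> 1" using F(2) by (simp add: r_def)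
  have unit: "\<exists>s. \<tau> \<le> s \<and> s \<le> r \<and> norm (snd (z s)) \<le> 1 / 2"
    if z: "global_solution z" "norm (snd (z 0)) = 1" for z
  proof -
    have "z 0 \<in> C" using z by (auto simp: C_def skew_solution_def mem_Times_iff)
    then obtain p where p: "p \<in> F" "dist p (z 0) < \<eta> p" using F(3) by auto
    then have "norm (snd (z (t p))) < 1 / 2" using near[of p z] z F(1) by (auto simp: dist_commute)
    moreover have "\<tau> \<le> t p" "t p \<le> r" using p(1) F(2) by (auto simp: \<tau>_def r_def)
    ultimately show ?thesis by (intro exI[of _ "t p"]) auto
  qed
  have "\<exists>s. \<tau> \<le> s \<and> s \<le> r \<and> norm (snd (z s)) \<le> norm (snd (z 0)) / 2" if z: "global_solution z" for z
  proof (cases "snd (z 0) = 0")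
    case True
    have "\<tau> \<le> 1" using F(2) by (simp add: \<tau>_def)
    with r have "\<tau> \<le> r" by linarith
    moreover have "norm (snd (z r)) \<le> norm (snd (z 0)) / 2" using \<Lambda>(2)[OF z, of r] r True by simp
    ultimately show ?thesis by blast
  next
    case False
    let ?c = "norm (snd (z 0))"
    have "\<exists>s. \<tau> \<le> s \<and> s \<le> r \<and> norm ((1 / ?c) *\<^sub>R snd (z s)) \<le> 1 / 2"
      using unit[OF skew_solution_scale[OF z, of "1 / ?c"]] False by simp
    then show ?thesis using False by (auto simp: field_simps)
  qed
  then show ?thesis using \<tau> r that[of \<tau> r] by simp
qed

text \<open>Solutions halve at different times, so the halvings are iterated: restarting at each
  contraction time, none larger than \<open>r\<close>, yields decay at rate \<open>ln 2 / r\<close>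
  with a common constant, and then one \<open>T\<close> suits every solution.\<close>

lemma uniform_contraction:
  assumes contr: "\<And>z. global_solution z \<Longrightarrow> norm (snd (z 0)) = 1 \<Longrightarrow> \<exists>t>0. norm (snd (z t)) < 1 / 2"
  obtains T where "T > 0"
    "\<And>z. global_solution z \<Longrightarrow> norm (snd (z T)) \<le> norm (snd (z 0)) / 2"
proof -
  obtain \<Lambda> where \<Lambda>: "\<Lambda> > 0"
    "\<And>z t. global_solution z \<Longrightarrow> t \<ge> 0 \<Longrightarrow> norm (snd (z t)) \<le> exp (\<Lambda> * t) * norm (snd (z 0))"
    using skew_growth by metis
  obtain \<tau> r where \<tau>r: "\<tau> > 0" "r > 0"
    "\<And>z. global_solution z \<Longrightarrow> \<exists>t. \<tau> \<le> t \<and> t \<le> r \<and> norm (snd (z t)) \<le> norm (snd (z 0)) / 2"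
    using uniform_contraction_times[OF contr] by blast
  define a where "a = ln 2 / r"
  define K where "K = 2 * exp (\<Lambda> * r)"
  have a: "a > 0" "a * r = ln 2" using \<tau>r(2) by (auto simp: a_def)
  have K: "K > 0" "K \<ge> 2" using \<Lambda>(1) \<tau>r(2) by (auto simp: K_def)
  have half: "exp (a * s) \<le> 2" if "s \<le> r" for s
  proof -
    have "a * s \<le> a * r" using that a(1) by (intro mult_left_mono) auto
    then have "exp (a * s) \<le> exp (ln 2)" using a(2) by (simp only: exp_le_cancel_iff)
    then show ?thesis by simp
  qed
  \<comment> \<open>Each restart happens at some \<open>s \<ge> \<tau>\<close> and so shortens the
    remaining time by at least \<open>\<tau>\<close>, which makes induction on \<open>k\<close>
    possible. Up to time \<open>r\<close> the plain growth bound suffices; this fixes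
    \<open>K = 2 * exp (\<Lambda> * r)\<close>.\<close>
  have decay: "\<forall>z t. global_solution z \<longrightarrow> 0 \<le> t \<longrightarrow> t \<le> real k * \<tau> \<longrightarrow>
     norm (snd (z t)) \<le> K * exp (- (a * t)) * norm (snd (z 0))" for k
  proof (induction k)
    case 0
    have "K * norm (snd (z 0)) \<ge> 1 * norm (snd (z 0))" for z :: "real \<Rightarrow> (real^'n) \<times> (real^'m)"
      using K by (intro mult_right_mono) auto
    then show ?case by auto
  next
    case (Suc k)
    show ?case
    proof (intro allI impI)
      fix z t assume z: "global_solution z" and t: "0 \<le> t" "t \<le> real (Suc k) * \<tau>"
      show "norm (snd (z t)) \<le> K * exp (- (a * t)) * norm (snd (z 0))"
      proof (cases "t \<le> r")
        case True
        have "norm (snd (z t)) \<le> exp (\<Lambda> * t) * norm (snd (z 0))" by (rule \<Lambda>(2)[OF z t(1)])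
        also have "exp (\<Lambda> * t) \<le> K * exp (- (a * t))"
        proof -
          have "exp (\<Lambda> * t) * exp (a * t) \<le> exp (\<Lambda> * r) * 2"
            using True \<Lambda>(1) half[OF True] by (intro mult_mono) auto
          then show ?thesis by (simp add: K_def exp_minus field_simps)
        qed
        finally show ?thesis by (simp add: mult_right_mono)
      next
        case False
        obtain s where s: "\<tau> \<le> s" "s \<le> r" "norm (snd (z s)) \<le> norm (snd (z 0)) / 2"
          using \<tau>r(3)[OF z] by blast
        have "s \<ge> 0" using s(1) \<tau>r(1) by linarith
        have "global_solution (\<lambda>u. z (s + u))" by (rule skew_solution_shift[OF z \<open>s \<ge> 0\<close>])
        moreover have "0 \<le> t - s" "t - s \<le> real k * \<tau>"
          using False s t by (auto simp: algebra_simps)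
        ultimately have "norm (snd (z (s + (t - s)))) \<le> K * exp (- (a * (t - s))) * norm (snd (z (s + 0)))"
          using Suc.IH by blast
        then have "norm (snd (z t)) \<le> K * exp (- (a * (t - s))) * norm (snd (z s))" by simp
        also have "\<dots> \<le> K * exp (- (a * (t - s))) * (norm (snd (z 0)) / 2)"
          using s(3) K(1) by (intro mult_left_mono) auto
        also have "\<dots> = K * exp (- (a * t)) * (exp (a * s) * (norm (snd (z 0)) / 2))"
          by (simp add: right_diff_distrib exp_diff exp_minus field_simps)
        also have "\<dots> \<le> K * exp (- (a * t)) * (2 * (norm (snd (z 0)) / 2))"
          using half[OF s(2)] K(1) by (intro mult_left_mono mult_right_mono) auto
        finally show ?thesis by simp
      qed
    qed
  qed
  define T where "T = ln (2 * K) / a"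
  have T: "T > 0" using a(1) K by (simp add: T_def)
  obtain k :: nat where k: "T / \<tau> < real k" using reals_Archimedean2 by blast
  then have Tk: "T \<le> real k * \<tau>" using \<tau>r(1) by (simp add: field_simps)
  have KT: "K * exp (- (a * T)) = 1 / 2"
    using a(1) K by (simp add: T_def exp_minus)
  have "norm (snd (z T)) \<le> norm (snd (z 0)) / 2" if "global_solution z" for z
    using decay[of k, rule_format, OF that less_imp_le[OF T] Tk] unfolding KT by simp
  with T show ?thesis by (rule that)
qed

text \<open>The base point evolves without \<open>w\<close>, and every step acts on \<open>w\<close>
  by a matrix determined by the base point. The squared norm of an iterate is therefore a quadratic
  form in \<open>w\<close>.\<close>

lemma euler_iterate_linear:
  "\<exists>x' \<Psi>. \<forall>w. (euler_step G \<delta> ^^ j) (x, w) = (x', \<Psi> *v w)"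
proof (induction j)
  case 0
  show ?case by (intro exI[of _ x] exI[of _ "mat 1"]) simp
next
  case (Suc j)
  then obtain x' \<Psi> where IH: "\<And>w. (euler_step G \<delta> ^^ j) (x, w) = (x', \<Psi> *v w)" by blast
  have step: "euler_step G \<delta> (x', v) = (x' + \<delta> *\<^sub>R f x', (mat 1 + \<delta> *\<^sub>R (A x' - B *\<^sub>R mat 1)) *v v)" for v
    by (simp add: euler_step_def skew_field_def matrix_vector_mult_add_rdistrib
         matrix_vector_mult_diff_rdistrib scaleR_matrix_vector_assoc[symmetric])
  show ?case
    by (rule exI[of _ "x' + \<delta> *\<^sub>R f x'"], rule exI[of _ "(mat 1 + \<delta> *\<^sub>R (A x' - B *\<^sub>R mat 1)) ** \<Psi>"])
       (simp add: IH step matrix_vector_mul_assoc)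
qed

lemma polynomial_euler_iterate: "polynomial_function (euler_step G \<delta> ^^ j)"
proof (induction j)
  case 0
  show ?case by (simp add: id_def)
next
  case (Suc j)
  have "polynomial_function (euler_step G \<delta>)"
    unfolding euler_step_def[abs_def]
    by (intro polynomial_function_add polynomial_function_cmul polynomial_function_id polynomial_skew_field f A)
  from polynomial_function_compose[OF Suc this] show ?case by (simp only: funpow.simps)
qed

lemma euler_iterate_quadratic: "(\<lambda>z. (norm (snd ((euler_step G \<delta> ^^ j) z)))\<^sup>2) \<in> quadratic_in_w"
proof (rule quadratic_in_wI)
  have "polynomial_function (\<lambda>z. snd ((euler_step G \<delta> ^^ j) z))"
    using polynomial_function_compose[OF polynomial_euler_iterate polynomial_function_snd] by (simp add: o_def)
  from real_polynomial_function_compose[OF this rpf_norm_sq]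
  show "real_polynomial_function (\<lambda>z. (norm (snd ((euler_step G \<delta> ^^ j) z)))\<^sup>2)" by (simp add: o_def)
  fix x
  obtain x' \<Psi> where E: "\<And>w. (euler_step G \<delta> ^^ j) (x, w) = (x', \<Psi> *v w)"
    using euler_iterate_linear[where \<delta> = \<delta> and j = j and x = x] by blast
  have "(norm (\<Psi> *v w))\<^sup>2 = w \<bullet> ((transpose \<Psi> ** \<Psi>) *v w)" for w
    by (metis dot_lmul_matrix inner_commute matrix_vector_mul_assoc power2_norm_eq_inner transpose_matrix_vector)
  then show "\<exists>M. \<forall>w. (norm (snd ((euler_step G \<delta> ^^ j) (x, w))))\<^sup>2 = w \<bullet> (M *v w)"
    by (intro exI[of _ "transpose \<Psi> ** \<Psi>"]) (simp add: E)
qed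

theorem lyapunov_polynomial:
  assumes contr: "\<And>z. global_solution z \<Longrightarrow> norm (snd (z 0)) = 1 \<Longrightarrow> \<exists>t>0. norm (snd (z t)) < 1 / 2"
  shows "\<exists>V\<in>quadratic_in_w. \<forall>x\<in>S. \<forall>w. norm w = 1 \<longrightarrow> V (x, w) > 1 \<and>
     (\<exists>W. (V has_derivative W) (at (x, w)) \<and> W (G (x, w)) < 0)"
proof -
  obtain T where T: "T > 0" and half: "\<And>z. global_solution z \<Longrightarrow> norm (snd (z T)) \<le> norm (snd (z 0)) / 2"
    using uniform_contraction[OF contr] by metis
  obtain \<rho> where \<rho>: "\<And>z t. global_solution z \<Longrightarrow> norm (snd (z 0)) = 1 \<Longrightarrow> t \<in> {0..T} \<Longrightarrow> norm (z t) \<le> \<rho>"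
    using skew_bounded by metis
  define Z where "Z = S \<times> sphere (0 :: real^'m) 1"
  have "\<exists>z. global_solution z \<and> z 0 = p" if "p \<in> Z" for p
    using skew_existence[of "fst p" "snd p"] that by (auto simp: Z_def)
  then obtain s where s: "\<And>p. p \<in> Z \<Longrightarrow> global_solution (s p)" "\<And>p. p \<in> Z \<Longrightarrow> s p 0 = p" by metis
  define q where "q z = (norm (snd z))\<^sup>2" for z :: "(real^'n) \<times> (real^'m)"
  have q: "real_polynomial_function q"
    unfolding q_def[abs_def] by (rule quadratic_in_w_rpf[OF quadratic_in_w_norm])
  \<comment> \<open>By time \<open>T\<close> the value of \<open>q\<close> has dropped from 1 to at
    most \<open>1 / 4\<close>, so an error of \<open>1 / 4\<close> still leaves a derivative of at
    most \<open>- 1 / 2\<close>.\<close>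
  have "\<exists>m>0. \<forall>p\<in>Z. \<exists>W. ((\<lambda>z. T / real m * (\<Sum>j<m. q ((euler_step G (T / real m) ^^ j) z))) has_derivative W) (at p)
      \<and> W (G p) \<le> q (s p T) - q p + 1 / 4"
  proof (rule euler_lyapunov[OF polynomial_skew_field[OF f A] q T])
    fix p assume p: "p \<in> Z"
    show "solves_ode_on {0..T} (\<lambda>_. G) (s p)"
      using s(1)[OF p] by (auto simp: skew_solution_def intro: solves_ode_on_subset)
    show "s p 0 = p" by (rule s(2)[OF p])
    show "norm (s p t) \<le> (\<rho> + 1) - 1" if "t \<in> {0..T}" for t
      using \<rho>[OF s(1)[OF p] _ that] s(2)[OF p] p by (auto simp: Z_def)
  qed simp
  then obtain m where m: "m > 0" and W: "\<And>p. p \<in> Z \<Longrightarrow>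
      \<exists>W. ((\<lambda>z. T / real m * (\<Sum>j<m. q ((euler_step G (T / real m) ^^ j) z))) has_derivative W) (at p)
      \<and> W (G p) \<le> q (s p T) - q p + 1 / 4" by blast
  \<comment> \<open>A rescaling made once \<open>m\<close> is known: every term gets weight 2, so
    the term \<open>j = 0\<close> alone gives \<open>V \<ge> 2\<close> on unit vectors, however
    small the step is.\<close>
  define c where "c = 2 * real m / T"
  have c: "c > 0" "c * (T / real m) = 2" using m T by (auto simp: c_def)
  define V where "V z = c * (T / real m * (\<Sum>j<m. q ((euler_step G (T / real m) ^^ j) z)))" for z
  have V2: "V z = 2 * (\<Sum>j<m. q ((euler_step G (T / real m) ^^ j) z))" for z
    unfolding V_def mult.assoc[symmetric] c(2) ..
  have "V \<in> quadratic_in_w"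
  proof -
    have "(\<lambda>z. \<Sum>j<m. q ((euler_step G (T / real m) ^^ j) z)) \<in> quadratic_in_w"
      unfolding q_def by (intro quadratic_in_w_sum euler_iterate_quadratic)
    from quadratic_in_w_mult[OF rpf_const[of 2] this] show ?thesis by (simp add: V2[abs_def])
  qed
  moreover have "V (x, w) > 1 \<and> (\<exists>W. (V has_derivative W) (at (x, w)) \<and> W (G (x, w)) < 0)"
    if x: "x \<in> S" and w: "norm w = 1" for x w
  proof
    have p: "(x, w) \<in> Z" using x w by (simp add: Z_def)
    have qp: "q (x, w) = 1" by (simp add: q_def w)
    have "q ((euler_step G (T / real m) ^^ 0) (x, w)) \<le> (\<Sum>j<m. q ((euler_step G (T / real m) ^^ j) (x, w)))"
      using m by (intro member_le_sum) (auto simp: q_def)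
    then show "V (x, w) > 1" using qp by (simp add: V2)
    obtain W where W: "((\<lambda>z. T / real m * (\<Sum>j<m. q ((euler_step G (T / real m) ^^ j) z))) has_derivative W) (at (x, w))"
      "W (G (x, w)) \<le> q (s (x, w) T) - q (x, w) + 1 / 4" using W[OF p] by blast
    have "norm (snd (s (x, w) T)) \<le> 1 / 2" using half[OF s(1)[OF p]] s(2)[OF p] w by simp
    then have "q (s (x, w) T) \<le> (1 / 2)\<^sup>2" unfolding q_def by (intro power_mono) auto
    then have neg: "W (G (x, w)) < 0" using W(2) qp by (simp add: power2_eq_square)
    have "(V has_derivative (\<lambda>h. c * W h)) (at (x, w))"
      unfolding V_def[abs_def] by (rule has_derivative_mult_right[OF W(1)])
    moreover have "c * W (G (x, w)) < 0" using neg c(1) by (simp add: mult_pos_neg)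
    ultimately show "\<exists>W. (V has_derivative W) (at (x, w)) \<and> W (G (x, w)) < 0" by blast
  qed
  ultimately show ?thesis by blast
qed

end

section \<open>Lyapunov exponents and the optimization problem\<close>

lemma inner_gradient:
  fixes F :: "'a::euclidean_space \<Rightarrow> real"
  assumes "(F has_derivative d) (at x)"
  shows "v \<bullet> gradient F x = d v"
proof -
  interpret d: bounded_linear d using assms by (rule has_derivative_bounded_linear)
  define e where "e = (\<Sum>b\<in>Basis. d b *\<^sub>R b)"
  have de: "d = (\<lambda>v. v \<bullet> e)"
  proof
    fix v
    have "d v = d (\<Sum>b\<in>Basis. (v \<bullet> b) *\<^sub>R b)" by (simp add: euclidean_representation)
    also have "\<dots> = (\<Sum>b\<in>Basis. (v \<bullet> b) * d b)" by (simp add: d.sum d.scaleR)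
    finally show "d v = v \<bullet> e" by (simp add: e_def inner_sum_right mult.commute)
  qed
  have "GDERIV F x :> e" using assms unfolding gderiv_def de .
  moreover have "e' = e" if "GDERIV F x :> e'" for e'
  proof -
    have "(\<lambda>h. h \<bullet> e') = (\<lambda>h. h \<bullet> e)"
      using has_derivative_unique[OF that[unfolded gderiv_def] assms[unfolded de]] .
    then have "(e' - e) \<bullet> e' = (e' - e) \<bullet> e" by meson
    then have "(e' - e) \<bullet> (e' - e) = 0" by (simp add: inner_diff_right)
    then show ?thesis by simp
  qed
  ultimately have "gradient F x = e" unfolding gradient_def by (rule the_equality)
  then show ?thesis by (simp add: de)
qed

lemma polynomial_jacobian:
  fixes f :: "real^'n \<Rightarrow> real^'n"
  assumes "polynomial_function f"
  shows "polynomial_function (\<lambda>x. jacobian f (at x))"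
proof -
  obtain D where D: "\<And>x. (f has_derivative D x) (at x)" "\<And>v. polynomial_function (\<lambda>x. D x v)"
    using polynomial_has_derivative[OF assms] by metis
  have "frechet_derivative f (at x) = D x" for x
    using frechet_derivative_at[OF D(1)] by simp
  then have "jacobian f (at x) $ i $ j = D x (axis j 1) $ i" for x i j
    by (simp add: jacobian_def matrix_def)
  then show ?thesis
    unfolding polynomial_function_mat using D(2)
    by (simp add: polynomial_function_vec real_polynomial_function_eq)
qed

text \<open>The additive compound of a polynomial matrix \<open>M(x)\<close> is a partial derivative of the polynomial
  \<open>(\<delta>, x) \<mapsto> (I + \<delta> M(x))\<^sup>(\<^sup>k\<^sup>)\<close>.\<close>
lemma polynomial_add_compound:
  fixes M :: "'c::euclidean_space \<Rightarrow> ((real, 'n::{finite,linorder}) vec, 'n) vec"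
  assumes M: "polynomial_function M"
  shows "polynomial_function (\<lambda>x. add_compound (M x) :: ('k::{finite,linorder}, 'n) kmat)"
proof -
  define H :: "real \<times> 'c \<Rightarrow> ('k, 'n) kmat" where "H z = mult_compound (mat 1 + fst z *\<^sub>R M (snd z))" for z
  have Mij: "real_polynomial_function (\<lambda>z::real \<times> 'c. M (snd z) $ i $ j)" for i j
    using M rpf_compose_linear[OF _ bounded_linear_snd, of "\<lambda>x. M x $ i $ j"] by (simp add: polynomial_function_mat)
  have fstp: "real_polynomial_function (\<lambda>z::real \<times> 'c. fst z)"
    by (intro rpf_linear bounded_linear_fst)
  have "polynomial_function H"
    unfolding H_def[abs_def] mult_compound_def polynomial_function_mat
    by (auto simp: det_def intro!: real_polynomial_function_sum rpf_mult rpf_const real_polynomial_function_prod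
          rpf_add Mij fstp)
  then obtain D where D: "\<And>z. (H has_derivative D z) (at z)" "\<And>v. polynomial_function (\<lambda>z. D z v)"
    using polynomial_has_derivative by metis
  have "add_compound (M x) = D (0, x) (1, 0)" for x
  proof -
    have "((\<lambda>\<delta>. (\<delta>, x)) has_derivative (\<lambda>h. (h, 0))) (at 0)"
      by (intro has_derivative_Pair has_derivative_ident has_derivative_const)
    from has_derivative_compose[OF this D(1)]
    have "((\<lambda>\<delta>. H (\<delta>, x)) has_derivative (\<lambda>h. D (0, x) (h, 0))) (at 0)" .
    moreover have "(\<lambda>h. D (0, x) (h, 0)) = (\<lambda>h. h *\<^sub>R D (0, x) (1, 0))"
    proof
      fix h :: real
      show "D (0, x) (h, 0) = h *\<^sub>R D (0, x) (1, 0)"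
        using linear_cmul[OF has_derivative_linear[OF D(1)], of "(0, x)" h "(1, 0)"] by simp
    qed
    ultimately have "((\<lambda>\<delta>. H (\<delta>, x)) has_vector_derivative D (0, x) (1, 0)) (at 0)"
      by (simp only: has_vector_derivative_def)
    then show ?thesis
      unfolding add_compound_def by (intro vector_derivative_at) (simp add: H_def)
  qed
  moreover have "polynomial_function (\<lambda>x::'c. D (0::real, x) (1, 0))"
  proof -
    have "polynomial_function (\<lambda>x::'c. (0::real, x))"
      by (intro polynomial_function_bounded_linear bounded_linear_Pair bounded_linear_zero bounded_linear_ident)
    from polynomial_function_compose[OF this D(2)] show ?thesis by (simp add: o_def)
  qed
  ultimately show ?thesis by simp
qed

section \<open>The upper bound for the exponents\<close>

lemma quad_module_over_nonneg:
  assumes "p \<in> quad_module_over M I g J h" "z \<in> semialg_set I g J h"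
  shows "p z \<ge> 0"
proof -
  obtain \<sigma> \<rho> where *: "(\<forall>i\<in>{0..I}. \<sigma> i \<in> sos \<inter> M) \<and> (\<forall>j\<in>{1..J}. \<rho> j \<in> M) \<and>
    p = (\<lambda>z. \<sigma> 0 z + (\<Sum>i=1..I. \<sigma> i z * g i z) + (\<Sum>j=1..J. \<rho> j z * h j z))"
    using assms(1) unfolding quad_module_over_def by (elim CollectE exE) (rule that)
  have "\<sigma> 0 z \<ge> 0" using * by (intro sos_nonneg) auto
  moreover have "(\<Sum>i=1..I. \<sigma> i z * g i z) \<ge> 0"
  proof (rule sum_nonneg)
    fix i assume i: "i \<in> {1..I}"
    have "\<sigma> i z \<ge> 0" using * i by (intro sos_nonneg) auto
    moreover have "g i z \<ge> 0" using assms(2) i by (simp add: semialg_set_def)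
    ultimately show "\<sigma> i z * g i z \<ge> 0" by simp
  qed
  moreover have "(\<Sum>j=1..J. \<rho> j z * h j z) = 0"
    using assms(2) by (intro sum.neutral) (auto simp: semialg_set_def)
  moreover have "p z = \<sigma> 0 z + (\<Sum>i=1..I. \<sigma> i z * g i z) + (\<Sum>j=1..J. \<rho> j z * h j z)"
    using * by simp
  ultimately show ?thesis by linarith
qed

text \<open>The Gronwall inequality for \<open>- |y|^2\<close> gives
  \<open>|y t|^2 \<ge> exp (- 2 L t) |y 0|^2 > 0\<close>. Nonvanishing is needed before the
  logarithm of \<open>|y|\<close> can be compared with that of an upper bound.\<close>

lemma linear_ode_nonzero:
  fixes y :: "real \<Rightarrow> real^'m" and A :: "real \<Rightarrow> real^'m^'m"
  assumes y: "solves_ode_on {0..} (\<lambda>t v. A t *v v) y" and A: "continuous_on {0..} A"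
    and y0: "y 0 \<noteq> 0" and t: "t \<ge> 0"
  shows "y t \<noteq> 0"
proof -
  have "bounded (A ` {0..t})"
    using A by (intro compact_imp_bounded compact_continuous_image) (auto intro: continuous_on_subset)
  then have "\<exists>K. \<forall>s\<in>{0..t}. norm (A s) \<le> K" unfolding bounded_iff by simp
  then obtain K where K: "\<And>s. s \<in> {0..t} \<Longrightarrow> norm (A s) \<le> K" by blast
  define L where "L = real CARD('m) * K"
  have bd: "norm (A s *v v) \<le> L * norm v" if "s \<in> {0..t}" for s v
  proof -
    have "norm (A s *v v) \<le> real CARD('m) * norm (A s) * norm v" by (rule norm_matrix_vector_le)
    also have "\<dots> \<le> L * norm v"
      unfolding L_def using K[OF that] by (intro mult_right_mono mult_left_mono) auto
    finally show ?thesis .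
  qed
  have "- (norm (y t))\<^sup>2 \<le> exp ((- 2 * L) * t) * (- (norm (y 0))\<^sup>2)"
  proof (rule gronwall[where T = t and u = "\<lambda>t. - (norm (y t))\<^sup>2"])
    fix s assume s: "s \<in> {0..t}"
    have "(y has_vector_derivative A s *v y s) (at s within {0..})"
      using y s by (simp add: solves_ode_on_def)
    then have "(y has_vector_derivative A s *v y s) (at s within {0..t})"
      by (rule has_vector_derivative_within_subset) auto
    from DERIV_minus[OF has_real_derivative_norm_sq[OF this]]
    show "((\<lambda>t. - (norm (y t))\<^sup>2) has_real_derivative - (2 * (y s \<bullet> (A s *v y s)))) (at s within {0..t})" .
    have "- (y s \<bullet> (A s *v y s)) \<le> norm (y s) * norm (A s *v y s)"
      using Cauchy_Schwarz_ineq2[of "y s" "A s *v y s"] by linarith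
    also have "\<dots> \<le> norm (y s) * (L * norm (y s))" using bd[OF s] by (intro mult_left_mono) auto
    also have "\<dots> = L * (norm (y s))\<^sup>2" by (simp only: power2_eq_square mult.left_commute)
    finally show "- (2 * (y s \<bullet> (A s *v y s))) \<le> - 2 * L * - (norm (y s))\<^sup>2"
      by (simp only: mult_minus_left mult_minus_right minus_minus)
  qed (use t in simp)
  moreover have "exp ((- 2 * L) * t) * (- (norm (y 0))\<^sup>2) < 0" using y0 by (simp add: mult_pos_neg)
  ultimately show ?thesis by auto
qed

lemma limsup_growth_rate_le:
  fixes y :: "real \<Rightarrow> 'a::real_normed_vector"
  assumes "\<And>t. t > 0 \<Longrightarrow> y t \<noteq> 0" "\<And>t. t > 0 \<Longrightarrow> norm (y t) \<le> exp (B * t) * c"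
  shows "Limsup at_top (\<lambda>t. ereal (ln (norm (y t)) / t)) \<le> ereal B"
proof -
  have le: "ln (norm (y t)) / t \<le> B + ln c / t" if t: "t > 0" for t
  proof -
    have y: "norm (y t) > 0" using assms(1)[OF t] by simp
    have P: "exp (B * t) * c > 0" using assms(2)[OF t] y by linarith
    with P have c: "c > 0" by (simp add: zero_less_mult_iff)
    have "ln (norm (y t)) \<le> ln (exp (B * t) * c)" by (simp only: ln_le_cancel_iff[OF y P] assms(2)[OF t])
    also have "\<dots> = B * t + ln c" using c by (simp add: ln_mult)
    finally show ?thesis using t by (simp add: field_simps)
  qed
  have "((\<lambda>t. B + ln c / t) \<longlongrightarrow> B + 0) at_top"
    by (rule tendsto_add[OF tendsto_const real_tendsto_divide_at_top[OF tendsto_const filterlim_ident]])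
  then have lim: "((\<lambda>t. ereal (B + ln c / t)) \<longlongrightarrow> ereal B) at_top" by simp
  have "Limsup at_top (\<lambda>t. ereal (ln (norm (y t)) / t)) \<le> Limsup at_top (\<lambda>t. ereal (B + ln c / t))"
    by (rule Limsup_mono, rule eventually_mono[OF eventually_gt_at_top[of 0]]) (simp add: le)
  also have "\<dots> = ereal B" by (rule lim_imp_Limsup[OF _ lim]) simp
  finally show ?thesis .
qed

text \<open>An exponential factor shifts the rate. With \<open>C = 0\<close> this passes from the
  compound equation to the one with \<open>B w\<close> subtracted; with parameters of opposite sign
  it returns.\<close>

lemma skew_solution_of_linear_ode:
  fixes x :: "real \<Rightarrow> (real, 'n::{finite,linorder}) vec" and y :: "real \<Rightarrow> real^'m"
  assumes "solves_ode_on {0..} (\<lambda>_. f) x" "solves_ode_on {0..} (\<lambda>t v. A (x t) *v v - C *\<^sub>R v) y"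
    "\<And>t. t \<ge> 0 \<Longrightarrow> x t \<in> S"
  shows "skew_solution f A (C + B) S {0..} (\<lambda>t. (x t, exp (- B * t) *\<^sub>R y t))"
proof -
  have "((\<lambda>t. exp (- B * t) *\<^sub>R y t) has_vector_derivative
     A (x t) *v (exp (- B * t) *\<^sub>R y t) - (C + B) *\<^sub>R (exp (- B * t) *\<^sub>R y t)) (at t within {0..})" if "t \<ge> 0" for t
  proof -
    have "(y has_vector_derivative A (x t) *v y t - C *\<^sub>R y t) (at t within {0..})"
      using assms(2) that by (simp add: solves_ode_on_def)
    moreover have "((\<lambda>t. exp (- B * t)) has_real_derivative (- B * exp (- B * t))) (at t within {0..})"
      by (auto intro!: derivative_eq_intros)
    ultimately have "((\<lambda>t. exp (- B * t) *\<^sub>R y t) has_vector_derivative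
       exp (- B * t) *\<^sub>R (A (x t) *v y t - C *\<^sub>R y t) + (- B * exp (- B * t)) *\<^sub>R y t) (at t within {0..})"
      by (intro has_vector_derivative_scaleR)
    then show ?thesis
      by (simp add: matrix_vector_mult_scaleR algebra_simps)
  qed
  then have "solves_ode_on {0..} (\<lambda>t w. A (x t) *v w - (C + B) *\<^sub>R w) (\<lambda>t. exp (- B * t) *\<^sub>R y t)"
    by (simp add: solves_ode_on_def)
  with assms show ?thesis by (simp add: skew_solution_def skew_solves_iff)
qed

lemma lyap_sum_le_of_lyapunov:
  fixes f :: "(real, 'n::{finite,linorder}) vec \<Rightarrow> (real, 'n) vec"
    and V :: "(real, 'n) vec \<times> ('k::{finite,linorder}, 'n) kvec \<Rightarrow> real"
  assumes f: "polynomial_function f" and inv: "forward_invariant f S" and x0: "x0 \<in> S"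
    and V: "\<And>z. (V has_derivative D z) (at z)"
    and lower: "\<And>x w. x \<in> S \<Longrightarrow> (norm w)\<^sup>2 \<le> V (x, w)"
    and decr: "\<And>x w. x \<in> S \<Longrightarrow> D (x, w) (skew_field f (\<lambda>x. add_compound (jacobian f (at x))) B (x, w)) \<le> 0"
  shows "lyap_sum TYPE('k) f x0 \<le> ereal B"
  unfolding lyap_sum_def
proof (rule Sup_least, elim CollectE exE conjE)
  fix l x and y :: "real \<Rightarrow> ('k, 'n) kvec"
  let ?A = "\<lambda>x. add_compound (jacobian f (at x)) :: ('k, 'n) kmat"
  assume l: "l = Limsup at_top (\<lambda>t. ereal (ln (norm (y t)) / t))"
    and tr: "trajectory f x0 x"
    and y: "solves_ode_on {0..} (\<lambda>t v. add_compound (jacobian f (at (x t))) *v v) y"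
    and y0: "y 0 \<in> sphere 0 1"
  have x: "solves_ode_on {0..} (\<lambda>_. f) x" "x 0 = x0" using tr by (auto simp: trajectory_def)
  have xS: "x t \<in> S" if "t \<ge> 0" for t
  proof -
    have "solves_ode_on {0..t} (\<lambda>_. f) x" using x(1) by (rule solves_ode_on_subset) auto
    with inv x0 x(2) that show ?thesis unfolding forward_invariant_def by auto
  qed
  define z where "z t = (x t, exp (- B * t) *\<^sub>R y t)" for t
  have z: "skew_solution f ?A (0 + B) S {0..} z"
    unfolding z_def[abs_def] by (rule skew_solution_of_linear_ode) (use x y xS in auto)
  have Vle: "V (z t) \<le> V (z 0)" if t: "t \<ge> 0" for t
  proof -
    have "V (z t) \<le> exp (0 * t) * V (z 0)"
    proof (rule gronwall[where T = t])
      fix s assume s: "s \<in> {0..t}"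
      have "(z has_vector_derivative skew_field f ?A B (z s)) (at s within {0..})"
        using z s by (simp add: skew_solution_def solves_ode_on_def)
      then have "(z has_vector_derivative skew_field f ?A B (z s)) (at s within {0..t})"
        by (rule has_vector_derivative_within_subset) auto
      then have "((\<lambda>s. V (z s)) has_derivative (\<lambda>h. D (z s) (h *\<^sub>R skew_field f ?A B (z s)))) (at s within {0..t})"
        unfolding has_vector_derivative_def by (rule has_derivative_compose[OF _ V])
      moreover have "D (z s) (h *\<^sub>R v) = D (z s) v * h" for h v
        using linear_cmul[OF has_derivative_linear[OF V]] by simp
      ultimately show "((\<lambda>s. V (z s)) has_real_derivative D (z s) (skew_field f ?A B (z s))) (at s within {0..t})"
        by (simp add: has_field_derivative_def)
      show "D (z s) (skew_field f ?A B (z s)) \<le> 0 * V (z s)"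
        using decr[OF xS, of s] s by (simp add: z_def)
    qed (use t in simp)
    then show ?thesis by simp
  qed
  have ynz: "y t \<noteq> 0" if "t \<ge> 0" for t
  proof (rule linear_ode_nonzero[OF y _ _ that])
    have "continuous_on UNIV ?A"
      by (intro continuous_on_polymonial_function polynomial_add_compound polynomial_jacobian f)
    then show "continuous_on {0..} (\<lambda>t. ?A (x t))"
      by (rule continuous_on_compose2[OF _ solves_ode_on_continuous[OF x(1)]]) auto
  qed (use y0 in auto)
  show "l \<le> ereal B"
    unfolding l
  proof (rule limsup_growth_rate_le)
    fix t :: real assume t: "t > 0"
    show "y t \<noteq> 0" using ynz t by simp
    have "(norm (exp (- B * t) *\<^sub>R y t))\<^sup>2 \<le> V (z t)" using lower[OF xS[of t], of "exp (- B * t) *\<^sub>R y t"] t by (simp only: z_def less_imp_le)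
    also have "\<dots> \<le> V (z 0)" using Vle t by simp
    finally have "norm (exp (- B * t) *\<^sub>R y t) \<le> sqrt (V (z 0))" by (rule real_le_rsqrt)
    then have "exp (B * t) * norm (exp (- B * t) *\<^sub>R y t) \<le> exp (B * t) * sqrt (V (z 0))" by simp
    then show "norm (y t) \<le> exp (B * t) * sqrt (V (z 0))"
      by (simp add: mult.assoc[symmetric] flip: exp_add)
  qed
qed

lemma inner_gradient_partial:
  fixes V :: "'a::euclidean_space \<times> 'b::euclidean_space \<Rightarrow> real"
  assumes "(V has_derivative d) (at (x, w))"
  shows "a \<bullet> gradient (\<lambda>x'. V (x', w)) x + b \<bullet> gradient (\<lambda>w'. V (x, w')) w = d (a, b)"
proof -
  have "((\<lambda>x'. (x', w)) has_derivative (\<lambda>h. (h, 0))) (at x)" by (auto intro!: derivative_eq_intros)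
  from has_derivative_compose[OF this assms]
  have 1: "a \<bullet> gradient (\<lambda>x'. V (x', w)) x = d (a, 0)" by (rule inner_gradient)
  have "((\<lambda>w'. (x, w')) has_derivative (\<lambda>h. (0, h))) (at w)" by (auto intro!: derivative_eq_intros)
  from has_derivative_compose[OF this assms]
  have 2: "b \<bullet> gradient (\<lambda>w'. V (x, w')) w = d (0, b)" by (rule inner_gradient)
  show ?thesis
    using 1 2 linear_add[OF has_derivative_linear[OF assms], of "(a, 0)" "(0, b)"] by simp
qed

text \<open>The form \<open>Q\<close> is arbitrary, since certificates are nonnegative over the set
  whatever their shape. \<open>Q = UNIV\<close> yields the first claim, and
  \<open>quadratic_in_w\<close> one inequality of the second.\<close>

lemma lyap_sum_le_C3_over:
  fixes f :: "(real, 'n::{finite,linorder}) vec \<Rightarrow> (real, 'n) vec"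
    and Q :: "((real, 'n) vec \<times> ('k::{finite,linorder}, 'n) kvec \<Rightarrow> real) set"
  assumes f: "polynomial_function f" and inv: "forward_invariant f (semialg_set I g J h)"
    and x0: "x0 \<in> semialg_set I g J h"
  shows "lyap_sum TYPE('k) f x0 \<le> C3_over Q f I g J h \<nu> \<nu>'"
  unfolding C3_over_def Let_def
proof (rule Inf_greatest, elim CollectE exE conjE)
  fix l B and V :: "(real, 'n) vec \<times> ('k, 'n) kvec \<Rightarrow> real"
  let ?QM = "quad_module_over (poly_upto \<nu>' \<inter> Q) I (\<lambda>i z. g i (fst z)) J (\<lambda>j z. h j (fst z))"
  assume l: "l = ereal B" and V: "V \<in> poly_upto \<nu> \<inter> Q"
    and 1: "(\<lambda>(x, w). V (x, w) - (norm w)\<^sup>2) \<in> ?QM"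
    and 2: "(\<lambda>(x, w). - (f x \<bullet> gradient (\<lambda>x'. V (x', w)) x +
                          m_field f B x w \<bullet> gradient (\<lambda>w'. V (x, w')) w)) \<in> ?QM"
  have "real_polynomial_function V" using V real_polynomial_function_iff_poly_upto by blast
  then obtain D where D: "\<And>z. (V has_derivative D z) (at z)"
    using rpf_has_derivative by blast
  have S: "(x, w) \<in> semialg_set I (\<lambda>i z. g i (fst z)) J (\<lambda>j z. h j (fst z))" if "x \<in> semialg_set I g J h"
    for x and w :: "('k, 'n) kvec" using that by (simp add: semialg_set_def)
  show "lyap_sum TYPE('k) f x0 \<le> l"
    unfolding l
  proof (rule lyap_sum_le_of_lyapunov[OF f inv x0 D])
    fix x and w :: "('k, 'n) kvec" assume x: "x \<in> semialg_set I g J h"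
    show "(norm w)\<^sup>2 \<le> V (x, w)" using quad_module_over_nonneg[OF 1 S[OF x, of w]] by simp
    show "D (x, w) (skew_field f (\<lambda>x. add_compound (jacobian f (at x))) B (x, w)) \<le> 0"
      using quad_module_over_nonneg[OF 2 S[OF x, of w]] inner_gradient_partial[OF D, of "f x" w x "m_field f B x w"]
      by (simp add: skew_field_def m_field_def)
  qed
qed

text \<open>With \<open>M = A x - B I\<close> and \<open>N\<close> the derivative of
  \<open>U\<close> along \<open>f\<close>, the derivative of \<open>w \<bullet> U w\<close> is the
  form of \<open>U M + N + M^T U\<close>. This is computed for fixed \<open>x\<close> only;
  polynomiality comes separately, from expanding the derivative in a basis.\<close>

lemma quadratic_in_w_derivative:
  fixes V :: "(real^'n) \<times> (real^'m) \<Rightarrow> real"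
  assumes V: "V \<in> quadratic_in_w" and D: "\<And>z. (V has_derivative D z) (at z)"
    and f: "polynomial_function f" and A: "polynomial_function A"
  shows "(\<lambda>z. D z (skew_field f A B z)) \<in> quadratic_in_w"
proof (rule quadratic_in_wI)
  obtain U :: "real^'n \<Rightarrow> real^'m^'m" where U: "polynomial_function U" "\<And>x w. V (x, w) = w \<bullet> (U x *v w)"
    using quadratic_in_wE[OF V] by metis
  obtain D' where D': "\<And>z. (V has_derivative D' z) (at z)" "\<And>v. real_polynomial_function (\<lambda>z. D' z v)"
    using rpf_has_derivative[OF quadratic_in_w_rpf[OF V]] by blast
  have DD: "D z = D' z" for z using D D'(1) by (rule has_derivative_unique)
  let ?G = "skew_field f A B"
  have "D z (?G z) = (\<Sum>b\<in>Basis. (?G z \<bullet> b) * D' z b)" for z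
  proof -
    interpret d: bounded_linear "D' z" using D'(1) by (rule has_derivative_bounded_linear)
    have "D' z (?G z) = D' z (\<Sum>b\<in>Basis. (?G z \<bullet> b) *\<^sub>R b)" by (simp add: euclidean_representation)
    then show ?thesis by (simp add: DD d.sum d.scaleR)
  qed
  moreover have "real_polynomial_function (\<lambda>z. \<Sum>b\<in>Basis. (?G z \<bullet> b) * D' z b)"
    using polynomial_skew_field[OF f A, of B] D'(2)
    by (intro real_polynomial_function_sum rpf_mult) (auto simp: polynomial_function_iff_Basis_inner)
  ultimately show "real_polynomial_function (\<lambda>z. D z (?G z))" by simp
  fix x
  have "\<forall>i j. \<exists>d. ((\<lambda>x. U x $ i $ j) has_derivative d) (at x)"
    using rpf_has_derivative U(1) unfolding polynomial_function_mat by blast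
  then obtain d where d: "\<And>i j. ((\<lambda>x. U x $ i $ j) has_derivative d i j) (at x)" by metis
  define M where "M = A x - B *\<^sub>R mat 1"
  define N where "N = (\<chi> i j. d i j (f x))"
  have Gx: "?G (x, w) = (f x, M *v w)" for w
    by (simp add: skew_field_def M_def matrix_vector_mult_diff_rdistrib scaleR_matrix_vector_assoc[symmetric])
  have "D (x, w) (?G (x, w)) = w \<bullet> ((U x ** M + N + transpose M ** U x) *v w)" for w
  proof -
    have du: "((\<lambda>z. U (fst z) $ i $ j) has_derivative (\<lambda>h. d i j (fst h))) (at (x, w))" for i j
      by (rule has_derivative_compose[OF bounded_linear_imp_has_derivative[OF bounded_linear_fst]]) (simp add: d)
    have dw: "((\<lambda>z. snd z $ i) has_derivative (\<lambda>h. snd h $ i)) (at (x, w))" for i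
      by (rule bounded_linear_imp_has_derivative[OF bounded_linear_compose[OF bounded_linear_vec_nth bounded_linear_snd]])
    have "((\<lambda>z. \<Sum>i\<in>UNIV. \<Sum>j\<in>UNIV. snd z $ i * U (fst z) $ i $ j * snd z $ j) has_derivative
       (\<lambda>h. \<Sum>i\<in>UNIV. \<Sum>j\<in>UNIV. snd (x, w) $ i * U (fst (x, w)) $ i $ j * snd h $ j
          + (snd (x, w) $ i * d i j (fst h) + snd h $ i * U (fst (x, w)) $ i $ j) * snd (x, w) $ j)) (at (x, w))"
      by (intro has_derivative_sum has_derivative_mult du dw)
    moreover have "(\<lambda>z. \<Sum>i\<in>UNIV. \<Sum>j\<in>UNIV. snd z $ i * U (fst z) $ i $ j * snd z $ j) = V"
    proof
      fix z
      show "(\<Sum>i\<in>UNIV. \<Sum>j\<in>UNIV. snd z $ i * U (fst z) $ i $ j * snd z $ j) = V z"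
        using U(2)[of "fst z" "snd z"] by (simp add: inner_matrix_vector)
    qed
    ultimately have "D (x, w) = (\<lambda>h. \<Sum>i\<in>UNIV. \<Sum>j\<in>UNIV. snd (x, w) $ i * U (fst (x, w)) $ i $ j * snd h $ j
          + (snd (x, w) $ i * d i j (fst h) + snd h $ i * U (fst (x, w)) $ i $ j) * snd (x, w) $ j)"
      using has_derivative_unique[OF D] by simp
    then have "D (x, w) (?G (x, w)) = (\<Sum>i\<in>UNIV. \<Sum>j\<in>UNIV. w $ i * U x $ i $ j * (M *v w) $ j)
        + ((\<Sum>i\<in>UNIV. \<Sum>j\<in>UNIV. w $ i * N $ i $ j * w $ j) + (\<Sum>i\<in>UNIV. \<Sum>j\<in>UNIV. (M *v w) $ i * U x $ i $ j * w $ j))"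
      unfolding Gx by (simp add: N_def sum.distrib distrib_right)
    also have "\<dots> = w \<bullet> (U x *v (M *v w)) + (w \<bullet> (N *v w) + (M *v w) \<bullet> (U x *v w))"
      by (simp only: inner_matrix_vector)
    also have "(M *v w) \<bullet> (U x *v w) = w \<bullet> (transpose M *v (U x *v w))"
      by (metis dot_lmul_matrix inner_commute transpose_matrix_vector)
    finally show ?thesis
      by (simp add: matrix_vector_mult_add_rdistrib matrix_vector_mul_assoc inner_add_right)
  qed
  then show "\<exists>M. \<forall>w. D (x, w) (?G (x, w)) = w \<bullet> (M *v w)" by blast
qed

text \<open>As \<open>y = exp (B t) w\<close> grows at a rate below some \<open>b < B\<close>, the
  vector \<open>w\<close> decays at least like \<open>exp (- (B - b) t)\<close>. Only the limsup of
  this one solution enters, so the time depends on the solution.\<close>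

lemma skew_contraction_of_lyap_sum:
  fixes f :: "(real, 'n::{finite,linorder}) vec \<Rightarrow> (real, 'n) vec"
  assumes less: "lyap_sum TYPE('k::{finite,linorder}) f (fst (z 0)) < ereal B"
    and z: "skew_solution f (\<lambda>x. add_compound (jacobian f (at x)) :: ('k, 'n) kmat) B S {0..} z"
    and unit: "norm (snd (z 0)) = 1"
  shows "\<exists>t>0. norm (snd (z t)) < 1 / 2"
proof -
  let ?A = "\<lambda>x. add_compound (jacobian f (at x)) :: ('k, 'n) kmat"
  define x where "x t = fst (z t)" for t
  define y where "y t = exp (B * t) *\<^sub>R snd (z t)" for t
  have "skew_solution f ?A (B + (- B)) S {0..} (\<lambda>t. (fst (z t), exp (- (- B) * t) *\<^sub>R snd (z t)))"
    using z by (intro skew_solution_of_linear_ode) (auto simp: skew_solution_def skew_solves_iff)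
  then have "solves_ode_on {0..} (\<lambda>_. f) x" "solves_ode_on {0..} (\<lambda>t v. ?A (x t) *v v) y"
    by (simp_all add: skew_solution_def skew_solves_iff x_def[abs_def] y_def[abs_def])
  then have "Limsup at_top (\<lambda>t. ereal (ln (norm (y t)) / t)) \<le> lyap_sum TYPE('k) f (fst (z 0))"
    unfolding lyap_sum_def using unit
    by (intro Sup_upper CollectI exI[of _ x] exI[of _ y] conjI refl)
       (auto simp: trajectory_def x_def y_def)
  also note less
  finally obtain b where b: "Limsup at_top (\<lambda>t. ereal (ln (norm (y t)) / t)) < ereal b" "ereal b < ereal B"
    using ereal_dense2 by blast
  from Limsup_lessD[OF b(1)] have "\<forall>\<^sub>F t in at_top. ln (norm (y t)) / t < b" by simp
  then obtain t0 where t0: "\<And>t. t \<ge> t0 \<Longrightarrow> ln (norm (y t)) / t < b"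
    unfolding eventually_at_top_linorder by blast
  \<comment> \<open>Late enough for the rate bound to hold and for \<open>exp (- (B - b) t)\<close>
    to fall below \<open>1 / 2\<close>.\<close>
  define t where "t = max (max t0 1) ((ln 2 + 1) / (B - b))"
  have t: "t \<ge> t0" "t > 0" "t \<ge> (ln 2 + 1) / (B - b)" by (auto simp: t_def)
  have "(B - b) * t \<ge> ln 2 + 1" using t(3) b(2) by (simp add: field_simps)
  have "norm (snd (z t)) < 1 / 2"
  proof (cases "snd (z t) = 0")
    case False
    then have y0: "norm (y t) > 0" by (simp add: y_def)
    have "ln (norm (y t)) < b * t" using t0[OF t(1)] t(2) by (simp add: field_simps)
    moreover have "ln (norm (y t)) = B * t + ln (norm (snd (z t)))"
      using False by (simp add: y_def ln_mult)
    ultimately have "ln (norm (snd (z t))) < - ln 2"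
      using \<open>(B - b) * t \<ge> ln 2 + 1\<close> by (simp add: algebra_simps)
    also have "- ln 2 = ln (1 / 2 :: real)" by (simp add: ln_div)
    finally show ?thesis using False by (subst (asm) ln_less_cancel_iff) auto
  qed simp
  with t(2) show ?thesis by blast
qed

text \<open>The strict Lyapunov inequalities for unit vectors over the set are what the
  Positivstellensatz converts into exact certificates. Hence \<open>B\<close> itself is feasible,
  with whatever degrees \<open>V\<close> and its multipliers happen to have.\<close>

lemma C3_quadratic_le:
  fixes f :: "(real, 'n::{finite,linorder}) vec \<Rightarrow> (real, 'n) vec"
  assumes f: "polynomial_function f"
    and g: "\<forall>i\<in>{1..I}. real_polynomial_function (g i)"
    and h: "\<forall>j\<in>{1..J}. real_polynomial_function (h j)"
    and inv: "forward_invariant f (semialg_set I g J h)"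
    and S: "compact (semialg_set I g J h)" and arch: "archimedean_spec I g J h"
    and less: "\<And>x0. x0 \<in> semialg_set I g J h \<Longrightarrow> lyap_sum TYPE('k::{finite,linorder}) f x0 < ereal B"
  shows "\<exists>\<nu> \<nu>'. C3_quadratic TYPE('k) f I g J h \<nu> \<nu>' \<le> ereal B"
proof -
  let ?S = "semialg_set I g J h"
  let ?A = "\<lambda>x. add_compound (jacobian f (at x)) :: ('k, 'n) kmat"
  let ?QM = "\<lambda>\<nu>. quad_module_over (poly_upto \<nu> \<inter> quadratic_in_w) I (\<lambda>i z. g i (fst z)) J (\<lambda>j z. h j (fst z))
     :: ((real, 'n) vec \<times> ('k, 'n) kvec \<Rightarrow> real) set"
  have A: "polynomial_function ?A" by (intro polynomial_add_compound polynomial_jacobian f)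
  interpret skew_system f ?A B ?S by unfold_locales (fact f A S inv)+
  have "\<exists>V\<in>quadratic_in_w. \<forall>x\<in>?S. \<forall>w. norm w = 1 \<longrightarrow> V (x, w) > 1 \<and>
     (\<exists>W. (V has_derivative W) (at (x, w)) \<and> W (skew_field f ?A B (x, w)) < 0)"
  proof (rule lyapunov_polynomial)
    fix z assume z: "skew_solution f ?A B ?S {0..} z" "norm (snd (z 0)) = 1"
    then have "fst (z 0) \<in> ?S" by (simp add: skew_solution_def)
    from skew_contraction_of_lyap_sum[OF less[OF this] z]
    show "\<exists>t>0. norm (snd (z t)) < 1 / 2" .
  qed
  then obtain V where V: "V \<in> quadratic_in_w" and lyap: "\<And>x w. x \<in> ?S \<Longrightarrow> norm w = 1 \<Longrightarrow> V (x, w) > 1 \<and>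
     (\<exists>W. (V has_derivative W) (at (x, w)) \<and> W (skew_field f ?A B (x, w)) < 0)" by blast
  obtain D where D: "\<And>z. (V has_derivative D z) (at z)"
    using rpf_has_derivative[OF quadratic_in_w_rpf[OF V]] by blast
  define p1 where "p1 z = V z + (- 1) * (norm (snd z))\<^sup>2" for z
  define p2 where "p2 z = (- 1) * D z (skew_field f ?A B z)" for z
  have "p1 \<in> quad_cert I g J h"
  proof (rule quadratic_positivstellensatz[OF g h arch])
    show "p1 \<in> quadratic_in_w"
      unfolding p1_def[abs_def]
      using quadratic_in_w_mult[OF rpf_const[of "- 1"] quadratic_in_w_norm] by (intro quadratic_in_w_add V)
    show "p1 (x, w) > 0" if "x \<in> ?S" "norm w = 1" for x w
      using lyap[OF that] that by (simp add: p1_def)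
  qed
  then obtain \<nu>1 where \<nu>1: "p1 \<in> ?QM \<nu>1" using quad_cert_degree by blast
  have "p2 \<in> quad_cert I g J h"
  proof (rule quadratic_positivstellensatz[OF g h arch])
    show "p2 \<in> quadratic_in_w"
      unfolding p2_def[abs_def]
      by (rule quadratic_in_w_mult[OF rpf_const[of "- 1"] quadratic_in_w_derivative[OF V D f A]])
    show "p2 (x, w) > 0" if xw: "x \<in> ?S" "norm w = 1" for x w
    proof -
      obtain W where W: "(V has_derivative W) (at (x, w))" "W (skew_field f ?A B (x, w)) < 0"
        using lyap[OF xw] by blast
      have "W = D (x, w)" using W(1) D by (rule has_derivative_unique)
      then show ?thesis using W(2) by (simp add: p2_def)
    qed
  qed
  then obtain \<nu>2 where \<nu>2: "p2 \<in> ?QM \<nu>2" using quad_cert_degree by blast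
  \<comment> \<open>The two certificates arise with their own degrees but have to share one
    bound.\<close>
  have sub: "?QM \<nu>1 \<subseteq> ?QM (max \<nu>1 \<nu>2)" "?QM \<nu>2 \<subseteq> ?QM (max \<nu>1 \<nu>2)"
    using poly_upto_mono[of \<nu>1 "max \<nu>1 \<nu>2"] poly_upto_mono[of \<nu>2 "max \<nu>1 \<nu>2"]
    by (intro quad_module_over_mono; auto)+
  obtain \<nu> where \<nu>: "V \<in> poly_upto \<nu>"
    using quadratic_in_w_rpf[OF V] real_polynomial_function_iff_poly_upto by blast
  have "(\<lambda>(x, w). V (x, w) - (norm w)\<^sup>2) = p1"
    by (auto simp: p1_def)
  moreover have "(\<lambda>(x, w). - (f x \<bullet> gradient (\<lambda>x'. V (x', w)) x +
       m_field f B x w \<bullet> gradient (\<lambda>w'. V (x, w')) w)) = p2"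
    by (auto simp: p2_def inner_gradient_partial[OF D] skew_field_def m_field_def)
  ultimately have "C3_quadratic TYPE('k) f I g J h \<nu> (max \<nu>1 \<nu>2) \<le> ereal B"
    unfolding C3_quadratic_def C3_over_def Let_def using \<nu> V \<nu>1 \<nu>2 sub
    by (intro Inf_lower CollectI exI[of _ B] exI[of _ V]) auto
  then show ?thesis by blast
qed

theorem proposition2p18:
  fixes f :: "(real, 'n::{finite,linorder}) vec \<Rightarrow> (real, 'n) vec"
    and g h :: "nat \<Rightarrow> (real, 'n) vec \<Rightarrow> real" and I J :: nat
    and S :: "(real, 'n) vec set"
  assumes "polynomial_function f"
    and "\<forall>i\<in>{1..I}. real_polynomial_function (g i)"
    and "\<forall>j\<in>{1..J}. real_polynomial_function (h j)"
    and "S = semialg_set I g J h"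
    and "forward_invariant f S"
    and "CARD('k::{finite,linorder}) \<le> CARD('n)"
  shows "((\<forall>x0\<in>S. \<exists>x. trajectory f x0 x \<and> bounded (x ` {0..})) \<longrightarrow>
           (\<forall>\<nu> \<nu>'. (SUP x0\<in>S. lyap_sum TYPE('k) f x0) \<le> C3 TYPE('k) f I g J h \<nu> \<nu>'))
       \<and> (compact S \<and> archimedean_spec I g J h \<longrightarrow>
           (SUP x0\<in>S. lyap_sum TYPE('k) f x0)
             = (INF (\<nu>, \<nu>') \<in> UNIV. C3_quadratic TYPE('k) f I g J h \<nu> \<nu>'))"
proof (intro conjI impI allI)
  note S = assms(4)
  have inv: "forward_invariant f (semialg_set I g J h)" using assms(4,5) by simp
  show "(SUP x0\<in>S. lyap_sum TYPE('k) f x0) \<le> C3 TYPE('k) f I g J h \<nu> \<nu>'" for \<nu> \<nu>'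
    unfolding S C3_def by (intro SUP_least lyap_sum_le_C3_over assms(1) inv)
  assume *: "compact S \<and> archimedean_spec I g J h"
  let ?M = "SUP x0\<in>S. lyap_sum TYPE('k) f x0"
  let ?C = "INF (\<nu>, \<nu>') \<in> UNIV. C3_quadratic TYPE('k) f I g J h \<nu> \<nu>'"
  show "?M = ?C"
  proof (rule antisym)
    show "?M \<le> ?C"
      unfolding S C3_quadratic_def
      by (intro SUP_least INF_greatest) (auto intro!: lyap_sum_le_C3_over assms(1) inv)
    show "?C \<le> ?M"
    proof (rule ccontr)
      assume "\<not> ?C \<le> ?M"
      then have "?M < ?C" by simp
      \<comment> \<open>A real number strictly in between lies above every single exponent, which
        supplies the strict inequality at each point; this includes the value
        \<open>- \<infinity>\<close> of the supremum over an empty set.\<close>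
      then obtain B where B: "?M < ereal B" "ereal B < ?C"
        using ereal_dense2 by blast
      have "\<exists>\<nu> \<nu>'. C3_quadratic TYPE('k) f I g J h \<nu> \<nu>' \<le> ereal B"
      proof (rule C3_quadratic_le[OF assms(1-3) inv])
        show "lyap_sum TYPE('k) f x0 < ereal B" if "x0 \<in> semialg_set I g J h" for x0
          using SUP_upper[of x0 S "lyap_sum TYPE('k) f"] that B(1) S by simp
      qed (use * S in auto)
      then obtain \<nu> \<nu>' where "C3_quadratic TYPE('k) f I g J h \<nu> \<nu>' \<le> ereal B" by blast
      moreover have "?C \<le> C3_quadratic TYPE('k) f I g J h \<nu> \<nu>'"
        by (rule INF_lower2[of "(\<nu>, \<nu>')"]) auto
      ultimately show False using B(2) by simp
    qed
  qed
qed

end
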